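(* Let $M_\psi>0$ and let $\psi$ be a positive increasing function defined for $\lambda>M_\psi$. Then $\psi$ belongs to the upper class in the one-sided unbounded forecasting game if and only if $$I(\psi)=\int_{M_\psi}^\infty\psi(\lambda)\,e^{-\psi(\lambda)^2/2}\,\frac{d\lambda}{\lambda}<\infty .$$
   Context: "Increasing" means nondecreasing. One-sided unbounded forecasting game (OUFG). Skeptic starts with an initial capital $\mathcal K_0>0$. On each round $n=1,2,\dots$, Skeptic announces $M_n\in\mathbb R$, then Reality announces $x_n\in[-1,\infty)$, and $\mathcal K_n=\mathcal K_{n-1}+M_nx_n$. Skeptic must keep $\mathcal K_n\ge0$ for all $n$ whatever Reality does. A path is an infinite sequence $(x_n)_{n\ge1}$ in $[-1,\infty)$; an event is a set of paths. Skeptic can force an event $E$ if he has a strategy ($M_n$ as a function of $x_1,\dots,x_{n-1}$, keeping the capital nonnegative on every path) such that $\mathcal K_n\to\infty$ on every path not in $E$. The event "$P\Rightarrow Q$" is the set of paths for which $P$ fails or $Q$ holds. Notation: $S_n=x_1+\dots+x_n$, $A_n^2=x_1^2+\dots+x_n^2$ with $A_n\ge0$, $A_\infty=\lim_nA_n$. A positive function $\psi(\lambda)$ defined for $\lambda>M_\psi>0$ belongs to the upper class in OUFG if Skeptic can force the event $$A_\infty=\infty\ \Longrightarrow\ S_n-A_n\psi(A_n^2)\le0\text{ for all but finitely many }n .$$ *)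

theory Defs
  imports "HOL-Analysis.Analysis"
begin

text \<open>
  Rounds are indexed from 0: \<open>x i\<close> is Reality's move in round \<open>i + 1\<close>, so that
  \<open>capital K0 \<sigma> x n\<close>, \<open>S x n\<close> and \<open>A x n\<close> below are the values after the first \<open>n\<close> rounds.
\<close>

definition paths :: "(nat \<Rightarrow> real) set"
  where "paths = {x. \<forall>i. x i \<ge> -1}"

text \<open>
  A strategy maps the list of Reality's previous moves to Skeptic's next move.
\<close>

type_synonym strategy = "real list \<Rightarrow> real"

primrec capital :: "real \<Rightarrow> strategy \<Rightarrow> (nat \<Rightarrow> real) \<Rightarrow> nat \<Rightarrow> real"
  where
    "capital K0 \<sigma> x 0 = K0"
  | "capital K0 \<sigma> x (Suc n) = capital K0 \<sigma> x n + \<sigma> (map x [0..<n]) * x n"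

definition can_force :: "real \<Rightarrow> (nat \<Rightarrow> real) set \<Rightarrow> bool"
  where "can_force K0 E \<longleftrightarrow>
    (\<exists>\<sigma>. (\<forall>x\<in>paths. \<forall>n. capital K0 \<sigma> x n \<ge> 0) \<and>
         (\<forall>x\<in>paths - E. filterlim (capital K0 \<sigma> x) at_top sequentially))"

definition S :: "(nat \<Rightarrow> real) \<Rightarrow> nat \<Rightarrow> real"
  where "S x n = (\<Sum>i<n. x i)"

definition A :: "(nat \<Rightarrow> real) \<Rightarrow> nat \<Rightarrow> real"
  where "A x n = sqrt (\<Sum>i<n. (x i)\<^sup>2)"

text \<open>
  The function \<open>\<psi>\<close> is meaningful only on \<open>{M<..}\<close> for some \<open>M\<close>. Its other values have no
  influence on the event: if \<open>A x n\<close> tends to infinity, then \<open>(A x n)\<^sup>2 > M\<close> for all but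
  finitely many \<open>n\<close>.
\<close>

definition upper_class :: "real \<Rightarrow> (real \<Rightarrow> real) \<Rightarrow> bool"
  where "upper_class K0 \<psi> \<longleftrightarrow>
    can_force K0 {x \<in> paths. filterlim (A x) at_top sequentially \<longrightarrow>
      (\<forall>\<^sub>F n in sequentially. S x n - A x n * \<psi> ((A x n)\<^sup>2) \<le> 0)}"

end

theory Submission
  imports Defs "HOL-Probability.Probability"
begin

text \<open>
  Monotonicity of \<open>\<psi>\<close> reduces the integral test to the convergence of the series
  \<open>\<Sum>u. gtail (\<psi> (4^u))\<close>, where \<open>gtail y = y * exp (- y^2 / 2)\<close>.

  If the series converges, Skeptic mixes the capital processes \<open>\<Prod>i. 1 + g * x i\<close>, which dominate
  \<open>exp (g S - g^2 A^2 / 2 - g^3 A^2)\<close>. While \<open>A\<close> runs through \<open>[2^u, 2^(u+1))\<close>, about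
  \<open>a = \<psi> (4^u)\<close> values \<open>g = a / B\<close>, with \<open>B\<close> equally spaced in this interval, suffice to reach a
  multiple of \<open>exp (a^2 / 2)\<close> whenever \<open>S > A \<psi> (A^2)\<close>. Starting each of them with a capital of
  \<open>exp (- a^2 / 2)\<close> costs a multiple of \<open>gtail a\<close> per block \<open>u\<close>, and the convergence leaves room
  for additional weights that tend to infinity.

  If the series diverges, Reality tosses a fair coin, so that \<open>A^2 = n\<close>. With about \<open>a^2\<close> equally
  spaced times in \<open>[2 * 4^u, 4^(u+1))\<close>, the probabilities of \<open>a < S / A \<le> a + 1 / a\<close> sum up to a
  multiple of \<open>gtail a\<close>. By estimates for binomial coefficients and the Kochen-Stone lemma,
  infinitely many of these events occur with positive probability. By Ville's inequality the
  capital of Skeptic stays bounded with probability arbitrarily close to one, so it stays bounded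
  on some path along which \<open>S > A \<psi> (A^2)\<close> infinitely often.
\<close>

section \<open>Strategies and capital processes\<close>

text \<open>Neither half works with \<psi> itself. A fast growing \<psi> would push the bet
  \<open>g = a / B\<close> beyond \<open>1/2\<close> and make the cubic error
  \<open>g^3 * A^2\<close> unbounded, so the upper half cuts the threshold of block \<open>u\<close>
  at \<open>u\<close>; the added terms \<open>gtail u\<close> are summable. In the lower half the
  critical order of \<open>a^2\<close> is \<open>ln u\<close>: with
  \<open>a^2 \<ge> 4 * ln u\<close> the terms are summable anyway, and smaller thresholds can be
  raised. Keeping only blocks with \<open>L \<le> a^2 \<le> 4 * L\<close>, \<open>L\<close> about
  \<open>ln u\<close>, fixes the number of test times independently of \<psi>. This number is
  unbounded, so in the second moment the dependence inside a block and between close blocks must be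
  summed. Hence the upper end of the window, which pins down the walk at the earlier hit, and a tilt
  chosen separately for close and distant pairs. Constants must be uniform while thresholds grow
  with time, which a central limit theorem would not give; hence the explicit binomial bounds. The
  mixture makes the capital large only at crossing times, while forcing asks for a limit; stopping
  repairs this.\<close>

lemma capital_cong:
  assumes "\<And>i. i < n \<Longrightarrow> x i = y i"
  shows "capital K \<sigma> x n = capital K \<sigma> y n"
  using assms
proof (induction n)
  case (Suc n)
  have "map x [0..<n] = map y [0..<n]" using Suc.prems by auto
  moreover have "capital K \<sigma> x n = capital K \<sigma> y n" using Suc by simp
  ultimately show ?case using Suc.prems[of n] by (simp del: map_eq_conv)
qed simp

lemma capital_scale: "capital (c * K) (\<lambda>l. c * \<sigma> l) x n = c * capital K \<sigma> x n"
  by (induction n) (auto simp: algebra_simps)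

lemma capital_mixture:
  assumes "w sums W" and "\<And>l. (\<lambda>k. w k * \<sigma> k l) sums \<tau> l"
  shows "(\<lambda>k. w k * capital 1 (\<sigma> k) x n) sums capital W \<tau> x n"
proof (induction n)
  case (Suc n)
  show ?case
    using sums_add[OF Suc sums_mult2[OF assms(2), of "map x [0..<n]" "x n"]]
    by (simp add: algebra_simps)
qed (use assms in simp)

text \<open>A strategy sees only the list of past moves, so the past capital is recomputed from
  \<open>l\<close>. Entries \<open>l ! j\<close> beyond the list are unspecified, but the capital
  after \<open>i \<le> length l\<close> rounds does not read them.\<close>

definition stopped :: "strategy \<Rightarrow> real \<Rightarrow> strategy"
  where "stopped \<sigma> c l =
    (if \<exists>i\<le>length l. capital 1 \<sigma> (\<lambda>j. l ! j) i \<ge> c then 0 else \<sigma> l)"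

lemma capital_stopped:
  "(capital 1 (stopped \<sigma> c) x n = capital 1 \<sigma> x n \<and> (\<forall>i<n. capital 1 \<sigma> x i < c)) \<or>
   (\<exists>t. capital 1 (stopped \<sigma> c) x n = capital 1 \<sigma> x t \<and> capital 1 \<sigma> x t \<ge> c)"
proof (induction n)
  case (Suc n)
  let ?l = "map x [0..<n]"
  have eq: "capital 1 \<sigma> (\<lambda>j. ?l ! j) i = capital 1 \<sigma> x i" if "i \<le> n" for i
    using that by (intro capital_cong) auto
  have st: "stopped \<sigma> c ?l = (if \<exists>i\<le>n. capital 1 \<sigma> x i \<ge> c then 0 else \<sigma> ?l)"
    unfolding stopped_def using eq by auto
  show ?case
  proof (cases "\<exists>i\<le>n. capital 1 \<sigma> x i \<ge> c")
    case True
    then have "capital 1 (stopped \<sigma> c) x (Suc n) = capital 1 (stopped \<sigma> c) x n"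
      by (simp add: st)
    moreover have "\<exists>t. capital 1 (stopped \<sigma> c) x n = capital 1 \<sigma> x t \<and> capital 1 \<sigma> x t \<ge> c"
    proof -
      have "capital 1 \<sigma> x n \<ge> c" if "\<forall>i<n. capital 1 \<sigma> x i < c"
        using True that by (metis le_less not_le)
      then show ?thesis using Suc by blast
    qed
    ultimately show ?thesis by metis
  next
    case False
    then have *: "capital 1 \<sigma> x i < c" if "i \<le> n" for i using that by (meson not_le)
    have "capital 1 (stopped \<sigma> c) x n = capital 1 \<sigma> x n"
      using Suc
    proof
      \<comment> \<open>The time \<open>t\<close> is not known to lie before \<open>n\<close>, so
        there is no immediate contradiction with \<open>False\<close>. That no stop has occurred
        before round \<open>n\<close> is shown by a separate induction on \<open>m\<close>.\<close>
      assume "\<exists>t. capital 1 (stopped \<sigma> c) x n = capital 1 \<sigma> x t \<and> capital 1 \<sigma> x t \<ge> c"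
      then obtain t where t: "capital 1 (stopped \<sigma> c) x n \<ge> c" by auto
      have "capital 1 (stopped \<sigma> c) x m = capital 1 \<sigma> x m" if "m \<le> n" for m
        using that
      proof (induction m)
        case (Suc m)
        have "capital 1 \<sigma> (\<lambda>j. map x [0..<m] ! j) i < c" if "i \<le> m" for i
          using capital_cong[of i "\<lambda>j. map x [0..<m] ! j" x 1 \<sigma>] *[of i] that Suc.prems by auto
        then have "stopped \<sigma> c (map x [0..<m]) = \<sigma> (map x [0..<m])"
          unfolding stopped_def using linorder_not_le by fastforce
        then show ?case using Suc by simp
      qed simp
      then show ?thesis by simp
    qed simp
    then show ?thesis using False * by (auto simp: st less_Suc_eq_le)
  qed
qed simp

text \<open>Stopping at the levels \<open>2^m\<close> and mixing with weights \<open>2^-(m+1)\<close> locks in half a unit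
  of capital per level reached.\<close>

lemma can_force_if_unbounded:
  assumes K: "K > 0"
    and nonneg: "\<And>x n. x \<in> paths \<Longrightarrow> capital 1 \<sigma> x n \<ge> 0"
    and unb: "\<And>x c. x \<in> paths \<Longrightarrow> x \<notin> E \<Longrightarrow> \<exists>n. capital 1 \<sigma> x n \<ge> c"
  shows "can_force K E"
proof -
  define w :: "nat \<Rightarrow> real" where "w m = (1/2)^Suc m" for m
  have w: "w sums 1" using power_half_series by (simp add: w_def[abs_def])
  define \<tau> where "\<tau> l = (\<Sum>m. w m * stopped \<sigma> (2^m) l)" for l
  have "summable (\<lambda>m. w m * stopped \<sigma> (2^m) l)" for l
  proof (rule summable_comparison_test')
    show "summable (\<lambda>m. w m * \<bar>\<sigma> l\<bar>)" using w by (intro summable_mult2) (simp add: sums_iff)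
    show "norm (w m * stopped \<sigma> (2^m) l) \<le> w m * \<bar>\<sigma> l\<bar>" if "m \<ge> 0" for m
      by (auto simp: stopped_def abs_mult w_def)
  qed
  then have \<tau>: "(\<lambda>m. w m * stopped \<sigma> (2^m) l) sums \<tau> l" for l
    by (simp add: \<tau>_def summable_sums)
  have mix: "(\<lambda>m. w m * capital 1 (stopped \<sigma> (2^m)) x n) sums capital 1 \<tau> x n" for x n
    by (rule capital_mixture[OF w \<tau>])
  have st_nonneg: "capital 1 (stopped \<sigma> c) x n \<ge> 0" if "x \<in> paths" for x n c
    using capital_stopped[of \<sigma> c x n] nonneg[OF that] by metis
  have pos: "capital 1 \<tau> x n \<ge> 0" if "x \<in> paths" for x n
    using mix[of x n] st_nonneg[OF that] by (intro sums_le[OF _ sums_zero mix]) (auto simp: w_def)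
  have lim: "filterlim (capital 1 \<tau> x) at_top sequentially" if "x \<in> paths - E" for x
    unfolding filterlim_at_top
  proof
    fix Z :: real
    obtain N :: nat where N: "Z \<le> real N / 2" using real_arch_simple[of "2*Z"] by (auto simp: field_simps)
    have x: "x \<in> paths" "x \<notin> E" using that by auto
    have "\<forall>m. \<exists>n. capital 1 \<sigma> x n \<ge> 2^m" using unb[OF x] by blast
    then obtain t where t: "\<And>m. capital 1 \<sigma> x (t m) \<ge> 2^m" by metis
    have ev: "\<forall>\<^sub>F n in sequentially. \<forall>m\<in>{..<N}. n > t m"
      by (intro eventually_ball_finite) (auto intro: eventually_gt_at_top)
    show "\<forall>\<^sub>F n in sequentially. Z \<le> capital 1 \<tau> x n"
      using ev
    proof eventually_elim
      case (elim n)
      have "capital 1 (stopped \<sigma> (2^m)) x n \<ge> 2^m" if "m < N" for m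
        using capital_stopped[of \<sigma> "2^m" x n] t[of m] elim that by (auto simp: not_less[symmetric])
      then have "real N / 2 \<le> (\<Sum>m<N. w m * capital 1 (stopped \<sigma> (2^m)) x n)"
      proof -
        have "real N / 2 = (\<Sum>m<N. w m * 2^m)" by (simp add: w_def power_divide)
        also have "\<dots> \<le> (\<Sum>m<N. w m * capital 1 (stopped \<sigma> (2^m)) x n)"
          using \<open>\<And>m. m < N \<Longrightarrow> _\<close> by (intro sum_mono mult_left_mono) (auto simp: w_def)
        finally show ?thesis .
      qed
      also have "\<dots> \<le> capital 1 \<tau> x n"
        using mix[of x n] st_nonneg[OF x(1)]
        by (subst sums_unique[OF mix]) (intro sum_le_suminf, auto simp: w_def sums_iff)
      finally show ?case using N by linarith
    qed
  qed
  show ?thesis unfolding can_force_def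
  proof (intro exI[of _ "\<lambda>l. K * \<tau> l"] conjI ballI allI)
    have eq: "capital K (\<lambda>l. K * \<tau> l) x = (\<lambda>n. K * capital 1 \<tau> x n)" for x
      using capital_scale[of K 1 \<tau>] by auto
    show "capital K (\<lambda>l. K * \<tau> l) x n \<ge> 0" if "x \<in> paths" for x n
      using pos[OF that] K by (simp add: eq)
    show "filterlim (capital K (\<lambda>l. K * \<tau> l) x) at_top sequentially" if "x \<in> paths - E" for x
      unfolding eq by (rule filterlim_tendsto_pos_mult_at_top[OF tendsto_const K lim[OF that]])
  qed
qed

section \<open>Betting a fixed fraction of the capital\<close>

definition prod_strategy :: "real \<Rightarrow> strategy"
  where "prod_strategy g l = g * (\<Prod>y\<leftarrow>l. 1 + g * y)"

lemma capital_prod_strategy: "capital 1 (prod_strategy g) x n = (\<Prod>i<n. 1 + g * x i)"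
proof (induction n)
  case (Suc n)
  have "(\<Prod>y\<leftarrow>map x [0..<n]. 1 + g * y) = (\<Prod>i<n. 1 + g * x i)"
    by (simp add: o_def prod.distinct_set_conv_list[symmetric] atLeast0LessThan)
  then show ?case using Suc by (simp add: prod_strategy_def algebra_simps)
qed simp

text \<open>For \<open>y \<ge> 0\<close> no cubic correction is needed, which is why unbounded upward moves of Reality
  do no harm; for \<open>y < 0\<close> the one-sided bound \<open>x \<ge> -1\<close> makes the correction quadratic in \<open>x\<close>.\<close>

lemma ln_one_plus_lower:
  fixes y :: real
  assumes "y \<ge> -1/2"
  shows "ln (1 + y) \<ge> y - y\<^sup>2 / 2 - (if y < 0 then \<bar>y\<bar>^3 else 0)"
proof (cases "y \<ge> 0")
  case True
  have "(\<lambda>t. ln (1 + t) - t + t\<^sup>2 / 2) 0 \<le> (\<lambda>t. ln (1 + t) - t + t\<^sup>2 / 2) y"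
  proof (rule DERIV_nonneg_imp_nondecreasing[OF True])
    fix t :: real assume t: "0 \<le> t" "t \<le> y"
    have "((\<lambda>t. ln (1 + t) - t + t\<^sup>2 / 2) has_real_derivative (1 / (1 + t) - 1 + t)) (at t)"
      using t by (auto intro!: derivative_eq_intros)
    moreover have "1 / (1 + t) - 1 + t = t\<^sup>2 / (1 + t)"
      using t by (simp add: field_simps power2_eq_square)
    ultimately show "\<exists>d. ((\<lambda>t. ln (1 + t) - t + t\<^sup>2 / 2) has_real_derivative d) (at t) \<and> 0 \<le> d"
      using t by auto
  qed
  then show ?thesis using True by simp
next
  case False
  then have y: "y \<le> 0" by simp
  have "(\<lambda>t. ln (1 + t) - t + t\<^sup>2 / 2 - t^3) y \<ge> (\<lambda>t. ln (1 + t) - t + t\<^sup>2 / 2 - t^3) 0"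
  proof (rule DERIV_nonpos_imp_nonincreasing[OF y])
    fix t :: real assume t: "y \<le> t" "t \<le> 0"
    have d: "((\<lambda>t. ln (1 + t) - t + t\<^sup>2 / 2 - t^3) has_real_derivative (1 / (1 + t) - 1 + t - 3*t\<^sup>2)) (at t)"
      using t assms by (auto intro!: derivative_eq_intros)
    \<comment> \<open>The factor \<open>-2 - 3*t\<close> is nonpositive for
      \<open>t \<ge> -2/3\<close>. The bound \<open>-1/2\<close> on \<open>y\<close> leaves a margin
      and later becomes the condition \<open>g \<le> 1/2\<close>.\<close>
    have "1 / (1 + t) - 1 + t - 3*t\<^sup>2 = t\<^sup>2 * (-2 - 3*t) / (1 + t)"
      using t assms by (simp add: field_simps power2_eq_square)
    also have "\<dots> \<le> 0"
      using t assms by (intro divide_nonpos_pos mult_nonneg_nonpos) auto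
    finally show "\<exists>d. ((\<lambda>t. ln (1 + t) - t + t\<^sup>2 / 2 - t^3) has_real_derivative d) (at t) \<and> d \<le> 0"
      using d by blast
  qed
  then show ?thesis using False by (simp add: power3_eq_cube)
qed

lemma A_nonneg: "A x n \<ge> 0"
  by (simp add: A_def sum_nonneg)

lemma A_squared: "(A x n)\<^sup>2 = (\<Sum>i<n. (x i)\<^sup>2)"
  by (simp add: A_def sum_nonneg)

text \<open>The logarithmic bound is summed over the rounds. For \<open>-1 \<le> x i < 0\<close> the
  cubic term is at most \<open>g^3 * (x i)^2\<close>, otherwise it is absent, so the result depends
  on the path only through \<open>S\<close> and \<open>A\<close>.\<close>

lemma prod_strategy_lower:
  assumes x: "x \<in> paths" and g: "0 \<le> g" "g \<le> 1/2"
  shows "(\<Prod>i<n. 1 + g * x i) \<ge> exp (g * S x n - g\<^sup>2 * (A x n)\<^sup>2 / 2 - g^3 * (A x n)\<^sup>2)"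
proof -
  have *: "1 + g * x i > 0 \<and>
      1 + g * x i \<ge> exp (g * x i - g\<^sup>2 * (x i)\<^sup>2 / 2 - g^3 * (x i)\<^sup>2)" for i
  proof -
    have xi: "x i \<ge> -1" using x by (simp add: paths_def)
    then have gx: "g * x i \<ge> -1/2"
      using mult_left_mono[OF xi g(1)] g by linarith
    have "(if g * x i < 0 then \<bar>g * x i\<bar>^3 else 0) \<le> g^3 * (x i)\<^sup>2"
    proof (cases "g * x i < 0")
      case True
      then have "x i < 0" using g by (simp add: mult_less_0_iff)
      then have "\<bar>x i\<bar>^3 \<le> (x i)\<^sup>2"
        using xi power_decreasing[of 2 3 "\<bar>x i\<bar>"] by auto
      then have "g^3 * \<bar>x i\<bar>^3 \<le> g^3 * (x i)\<^sup>2" using g by (intro mult_left_mono) auto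
      then show ?thesis using True g by (simp add: abs_mult power_mult_distrib)
    qed (use g in auto)
    then have "g * x i - g\<^sup>2 * (x i)\<^sup>2 / 2 - g^3 * (x i)\<^sup>2 \<le> ln (1 + g * x i)"
      using ln_one_plus_lower[OF gx] by (simp add: power_mult_distrib)
    moreover have pos: "1 + g * x i > 0" using gx by linarith
    ultimately show ?thesis
      using exp_le_cancel_iff[of _ "ln (1 + g * x i)"] by (metis exp_ln)
  qed
  have "exp (g * S x n - g\<^sup>2 * (A x n)\<^sup>2 / 2 - g^3 * (A x n)\<^sup>2)
      = exp (\<Sum>i<n. g * x i - g\<^sup>2 * (x i)\<^sup>2 / 2 - g^3 * (x i)\<^sup>2)"
    by (simp add: S_def A_squared sum_subtractf sum_distrib_left sum_divide_distrib)
  also have "\<dots> = (\<Prod>i<n. exp (g * x i - g\<^sup>2 * (x i)\<^sup>2 / 2 - g^3 * (x i)\<^sup>2))"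
    by (simp add: exp_sum)
  also have "\<dots> \<le> (\<Prod>i<n. 1 + g * x i)"
    using * by (intro prod_mono) auto
  finally show ?thesis .
qed

text \<open>A bound free of \<open>g\<close>: it makes the infinite mixture of these strategies
  converge for every list of moves.\<close>

lemma prod_strategy_bound:
  assumes "0 \<le> g" "g \<le> 1"
  shows "\<bar>prod_strategy g l\<bar> \<le> (\<Prod>y\<leftarrow>l. 1 + \<bar>y\<bar>)"
proof -
  have "\<bar>\<Prod>y\<leftarrow>l. 1 + g * y\<bar> \<le> (\<Prod>y\<leftarrow>l. 1 + \<bar>y\<bar>)"
  proof (induction l)
    case (Cons y l)
    have "\<bar>1 + g * y\<bar> \<le> 1 + \<bar>y\<bar>"
      using assms mult_right_mono[of g 1 "\<bar>y\<bar>"] abs_triangle_ineq[of 1 "g*y"] by (auto simp: abs_mult)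
    then show ?case using Cons by (simp add: abs_mult mult_mono)
  qed simp
  then show ?thesis
    unfolding prod_strategy_def abs_mult using assms
    using mult_mono[of "\<bar>g\<bar>" 1 "\<bar>\<Prod>y\<leftarrow>l. 1 + g * y\<bar>"] by simp
qed

section \<open>Convergence of the series\<close>

text \<open>With \<open>R k\<close> the tail of the series, \<open>h k = 1 / sqrt (R k)\<close>
  works: \<open>a k = R k - R (Suc k)\<close> makes \<open>h k * a k\<close> at most twice a
  difference of square roots, which telescopes. Without the factor \<open>h\<close> the capital
  would be bounded below at each crossing, but not unbounded.\<close>

lemma summable_slack_weights:
  fixes a :: "nat \<Rightarrow> real"
  assumes pos: "\<And>k. a k > 0" and sm: "summable a"
  obtains h where "\<And>k. h k > 0" "filterlim h at_top sequentially" "summable (\<lambda>k. h k * a k)"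
proof -
  define R where "R k = (\<Sum>i. a (i + k))" for k
  have smk: "summable (\<lambda>i. a (i + k))" for k using sm by (simp add: summable_iff_shift)
  have Rpos: "R k > 0" for k unfolding R_def using smk pos by (intro suminf_pos)
  have Rstep: "R k = a k + R (Suc k)" for k
    unfolding R_def using suminf_split_head[OF smk[of k]] by simp
  have R0: "R \<longlonglongrightarrow> 0" unfolding R_def[abs_def] by (rule suminf_exist_split2[OF sm])
  define h where "h k = inverse (sqrt (R k))" for k
  have "(\<lambda>k. sqrt (R k)) \<longlonglongrightarrow> 0" using tendsto_real_sqrt[OF R0] by simp
  then have lim: "filterlim h at_top sequentially" unfolding h_def[abs_def]
    by (intro filterlim_inverse_at_top) (auto simp: Rpos)
  have bound: "h k * a k \<le> 2 * (sqrt (R k) - sqrt (R (Suc k)))" for k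
  proof -
    define p q where "p = sqrt (R k)" and "q = sqrt (R (Suc k))"
    have pq: "p > 0" "q > 0" "p\<^sup>2 = R k" "q\<^sup>2 = R (Suc k)" using Rpos by (auto simp: p_def q_def less_imp_le)
    have "q \<le> p" unfolding p_def q_def using Rstep[of k] pos[of k] by simp
    have "p\<^sup>2 - q\<^sup>2 \<le> 2 * (p - q) * p"
      using mult_left_mono[OF \<open>q \<le> p\<close>, of "p - q"] \<open>q \<le> p\<close> by (simp add: power2_eq_square algebra_simps)
    then have "inverse p * (p\<^sup>2 - q\<^sup>2) \<le> 2 * (p - q)" using pq by (simp add: field_simps)
    moreover have "a k = p\<^sup>2 - q\<^sup>2" using Rstep[of k] pq by simp
    ultimately show ?thesis by (simp add: h_def p_def q_def)
  qed
  have "summable (\<lambda>k. 2 * (sqrt (R k) - sqrt (R (Suc k))))"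
    by (intro summable_mult telescope_summable'[of _ 0]) fact
  then have "summable (\<lambda>k. h k * a k)"
    using bound pos Rpos
    by (elim summable_comparison_test'[of _ 0]) (auto simp: h_def abs_mult less_imp_le)
  then show thesis using that[of h] lim Rpos by (simp add: h_def)
qed

lemma capital_average:
  assumes "L > 0"
  shows "capital 1 (\<lambda>l. (\<Sum>v<L. \<sigma> v l) / real L) x n = (\<Sum>v<L. capital 1 (\<sigma> v) x n) / real L"
proof (induction n)
  case (Suc n)
  then show ?case by (simp add: sum.distrib add_divide_distrib sum_distrib_right)
qed (use assms in simp)

lemma ex_pow2_interval:
  fixes y :: real
  assumes "y \<ge> 1"
  obtains u :: nat where "2^u \<le> y" "y < 2^Suc u"
proof -
  obtain n where n: "y < 2^n" using real_arch_pow[of 2 y] by auto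
  define m where "m = (LEAST n. y < 2^n)"
  have m: "y < 2^m" unfolding m_def using n by (rule LeastI)
  then have "m \<noteq> 0" using assms by (intro notI) simp
  then obtain u where u: "m = Suc u" by (cases m) auto
  have "\<not> y < 2^u" using not_less_Least[of u "\<lambda>n. y < 2^n"] u by (simp add: m_def)
  then show thesis using that[of u] m u by auto
qed

text \<open>With \<open>r = A / B\<close> the Gaussian part of the exponent is at least
  \<open>a^2 * (r - r^2 / 2) = a^2 / 2 - (a * (r - 1))^2 / 2\<close>. A relative mismatch
  \<open>1 / a\<close> between \<open>B\<close> and \<open>A\<close> thus costs only
  \<open>1/2\<close>, which is why about \<open>a\<close> values of \<open>B\<close> per dyadic
  interval suffice. The cubic term is at most \<open>4 * a^3 / B\<close>, since
  \<open>r \<le> 2\<close>.\<close>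

lemma exponent_lower:
  fixes a B A S D :: real
  assumes a: "a \<ge> 1" and B: "B > 0" "B \<le> A" "A \<le> B * (1 + 1/a)" and S: "S \<ge> A * a"
    and D: "4 * a^3 \<le> D * B"
  shows "(a/B) * S - (a/B)\<^sup>2 * A\<^sup>2 / 2 - (a/B)^3 * A\<^sup>2 \<ge> a\<^sup>2/2 - 1/2 - D"
proof -
  define r where "r = A / B"
  have A: "A = r * B" using B by (simp add: r_def)
  have r: "r \<ge> 1" "r \<le> 1 + 1/a" using B by (simp_all add: r_def field_simps)
  have r2: "r \<le> 2" using r(2) a by (smt (verit) divide_le_eq_1_pos)
  have "(a/B) * S \<ge> (a/B) * (A * a)" using S a B by (intro mult_left_mono) auto
  then have 1: "(a/B) * S \<ge> a\<^sup>2 * r" using B by (simp add: A power2_eq_square mult_ac)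
  have 2: "(a/B)\<^sup>2 * A\<^sup>2 = a\<^sup>2 * r\<^sup>2" using B by (simp add: A power_divide power_mult_distrib)
  have "(a/B)^3 * A\<^sup>2 = a^3 / B * r\<^sup>2"
    using B by (simp add: A power_divide power_mult_distrib power2_eq_square power3_eq_cube)
  also have "\<dots> \<le> a^3 / B * 4"
    using a B r r2 power_mono[of r 2 2] by (intro mult_left_mono) auto
  also have "\<dots> \<le> D" using D B by (simp add: field_simps)
  finally have 3: "(a/B)^3 * A\<^sup>2 \<le> D" .
  have "a * (r - 1) \<le> 1" using r a by (simp add: field_simps)
  then have "(a * (r - 1))\<^sup>2 \<le> 1" using r a by (simp add: power_le_one)
  then have "a\<^sup>2 * r - a\<^sup>2 * r\<^sup>2 / 2 \<ge> a\<^sup>2/2 - 1/2"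
    by (simp add: power2_eq_square algebra_simps)
  then show ?thesis using 1 2 3 by linarith
qed

lemma cube_le_power2: "(real u)^3 \<le> 8 * 2^u"
proof (cases "u \<ge> 4")
  case True
  then show ?thesis
  proof (induction u rule: nat_induct_at_least)
    case (Suc u)
    \<comment> \<open>The induction starts at 4 because \<open>(5/4)^3 < 2\<close>.\<close>
    have "(real u + 1) \<le> 5/4 * real u" using Suc by simp
    then have "(real u + 1)^3 \<le> (5/4 * real u)^3" by (intro power_mono) auto
    also have "\<dots> \<le> 2 * (real u)^3" by (simp add: power_mult_distrib power_divide)
    finally show ?case using Suc by (simp add: add.commute)
  qed simp
next
  case False
  then have "u = 0 \<or> u = 1 \<or> u = 2 \<or> u = 3" by linarith
  then show ?thesis by (elim disjE) simp_all
qed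

text \<open>This is \<open>y^2\<close> times the order \<open>exp (- y^2 / 2) / y\<close> of the
  Gaussian tail; the factor \<open>y^2\<close> counts the essentially different times in one
  block.\<close>

definition gtail :: "real \<Rightarrow> real"
  where "gtail y = y * exp (- y\<^sup>2 / 2)"

lemma gtail_pos: "y > 0 \<Longrightarrow> gtail y > 0"
  by (simp add: gtail_def)

text \<open>An eighth of \<open>y^2\<close> in the exponent pays for the factor \<open>y\<close>.
  The remaining \<open>3/8\<close> is enough because \<open>y^2 \<ge> 4 * ln u\<close> still leaves
  the summable \<open>u powr (-3/2)\<close>.\<close>

lemma gtail_le: "gtail y \<le> 2 * exp (- (3/8) * y\<^sup>2)"
proof -
  have "y \<le> 2 * (1 + y\<^sup>2/8)"
    using zero_le_power2[of "y/2 - 1"] by (simp add: power2_eq_square algebra_simps)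
  also have "\<dots> \<le> 2 * exp (y\<^sup>2/8)" by (intro mult_left_mono exp_ge_add_one_self) auto
  finally have "gtail y \<le> 2 * exp (y\<^sup>2/8) * exp (- y\<^sup>2 / 2)"
    unfolding gtail_def by (rule mult_right_mono) simp
  also have "\<dots> = 2 * exp (- (3/8) * y\<^sup>2)" by (simp add: exp_add[symmetric])
  finally show ?thesis .
qed

lemma gtail_antimono:
  assumes "1 \<le> x" "x \<le> y"
  shows "gtail y \<le> gtail x"
proof (rule DERIV_nonpos_imp_nonincreasing[OF assms(2)])
  fix t assume t: "x \<le> t" "t \<le> y"
  have "(gtail has_real_derivative exp (- t\<^sup>2 / 2) - t * (t * exp (- t\<^sup>2 / 2))) (at t)"
    unfolding gtail_def[abs_def] by (auto intro!: derivative_eq_intros)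
  moreover have "exp (- t\<^sup>2 / 2) - t * (t * exp (- t\<^sup>2 / 2)) \<le> 0"
    using assms t mult_mono[of 1 t 1 t] by (simp add: mult.assoc[symmetric])
  ultimately show "\<exists>d. (gtail has_real_derivative d) (at t) \<and> d \<le> 0" by blast
qed

text \<open>These are the terms added when the thresholds are cut off at the block number.\<close>

lemma summable_gtail_nat: "summable (\<lambda>n. gtail (real n))"
proof (rule summable_comparison_test')
  show "summable (\<lambda>n. 2 * exp (-(3/8)) ^ n :: real)" by (intro summable_mult summable_geometric) simp
  show "norm (gtail (real n)) \<le> 2 * exp (-(3/8)) ^ n" if "n \<ge> 0" for n
  proof -
    have "real n \<le> (real n)\<^sup>2" by (cases n) (auto simp: power2_eq_square)
    then have "gtail n \<le> 2 * exp (real n * -(3/8))"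
      by (intro order_trans[OF gtail_le]) simp
    moreover have "gtail (real n) \<ge> 0" by (simp add: gtail_def)
    ultimately show ?thesis by (simp add: exp_of_nat_mult[symmetric])
  qed
qed

text \<open>\<open>gtail\<close> is also small near 0, so small terms alone do not make
  \<open>b\<close> large. But a positive monotone \<open>b\<close> staying below 1 would keep every
  term at least \<open>b 0 * exp (-1/2)\<close>.\<close>

lemma eventually_ge_1_if_summable_gtail:
  fixes b :: "nat \<Rightarrow> real"
  assumes pos: "b 0 > 0" and mono: "mono b" and sm: "summable (\<lambda>u. gtail (b u))"
  shows "\<exists>u. b u \<ge> 1"
proof (rule ccontr)
  assume "\<not> ?thesis"
  then have lt: "b u < 1" for u by (meson not_le)
  have "b 0 * exp (-1/2) \<le> gtail (b u)" for u
  proof -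
    have "b 0 \<le> b u" using mono by (rule monoD) simp
    moreover have "(b u)\<^sup>2 \<le> 1" using lt[of u] pos calculation by (intro power_le_one) auto
    ultimately show ?thesis unfolding gtail_def using pos by (intro mult_mono) auto
  qed
  then have "b 0 * exp (-1/2) \<le> 0"
    using summable_LIMSEQ_zero[OF sm]
    by (intro tendsto_lowerbound[where F = sequentially]) auto
  then show False using pos by (simp add: mult_le_0_iff)
qed

theorem upper_class_if_summable:
  fixes \<psi> :: "real \<Rightarrow> real"
  assumes K: "K > 0" and pos: "\<And>l. l > M \<Longrightarrow> \<psi> l > 0" and mono: "mono_on {M<..} \<psi>"
    and sm: "summable (\<lambda>u. gtail (\<psi> (4^u)))"
  shows "upper_class K \<psi>"
proof -
  obtain u0 :: nat where u0: "M < 4^u0" using real_arch_pow[of 4 M] by auto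
  have M: "M < 4^u" if "u \<ge> u0" for u
    using that u0 power_increasing[of u0 u "4::real"] by linarith
  have mono_pow: "\<psi> (4^u) \<le> \<psi> (4^v)" if "u0 \<le> u" "u \<le> v" for u v
    using M[of u] M[of v] that power_increasing[of u v "4::real"] by (intro mono_onD[OF mono]) auto
  have "\<exists>u. \<psi> (4^(u + max u0 4)) \<ge> 1"
  proof (rule eventually_ge_1_if_summable_gtail)
    show "summable (\<lambda>u. gtail (\<psi> (4^(u + max u0 4))))" using sm by (rule summable_ignore_initial_segment)
    show "mono (\<lambda>u. \<psi> (4^(u + max u0 4)))" by (intro monoI mono_pow) auto
    show "\<psi> (4^(0 + max u0 4)) > 0" by (intro pos M) simp
  qed
  then have "\<exists>u\<ge>max u0 4. \<psi> (4^u) \<ge> 1" by (metis le_add2)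
  then obtain U where U: "U \<ge> u0" "U \<ge> 4" "\<psi> (4^U) \<ge> 1" by auto
  \<comment> \<open>The cut at \<open>U + k\<close> keeps \<open>g k v \<le> 1/2\<close> and
    \<open>a^3 \<le> 8 * 2^(U+k)\<close>. Being at most \<psi>, the new threshold is exceeded
    whenever \<psi> is.\<close>
  define a where "a k = min (\<psi> (4^(U+k))) (real (U+k))" for k
  have a1: "a k \<ge> 1" for k
    using mono_pow[of U "U+k"] U by (auto simp: a_def)
  have a_le: "a k \<le> real (U+k)" "a k \<le> \<psi> (4^(U+k))" for k by (auto simp: a_def)
  define L where "L k = nat \<lceil>a k\<rceil>" for k
  have L: "a k \<le> real (L k)" "real (L k) \<le> 2 * a k" "L k > 0" for k
    using a1[of k] of_int_ceiling_le_add_one[of "a k"] by (auto simp: L_def) linarith+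
  define c where "c k = real (L k) * exp (- (a k)\<^sup>2 / 2)" for k
  have cpos: "c k > 0" for k using L by (simp add: c_def)
  have "summable c"
  proof (rule summable_comparison_test')
    show "summable (\<lambda>k. 2 * (gtail (\<psi> (4^(k+U))) + gtail (real (k+U))))"
      using summable_ignore_initial_segment[OF sm, of U]
        summable_ignore_initial_segment[OF summable_gtail_nat, of U]
      by (intro summable_mult summable_add)
    show "norm (c k) \<le> 2 * (gtail (\<psi> (4^(k+U))) + gtail (real (k+U)))" if "k \<ge> 0" for k
    proof -
      have "c k \<le> 2 * gtail (a k)"
        using mult_right_mono[OF L(2)[of k], of "exp (- (a k)\<^sup>2 / 2)"] by (simp add: c_def gtail_def)
      moreover have "gtail (a k) \<le> gtail (\<psi> (4^(k+U))) + gtail (real (k+U))"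
        using gtail_pos[OF pos, OF M[of "k+U"]] gtail_pos[of "real (k+U)"] U
        by (auto simp: a_def min_def add.commute)
      ultimately show ?thesis using cpos[of k] by simp
    qed
  qed
  then obtain h where h: "\<And>k. h k > 0" "filterlim h at_top sequentially" "summable (\<lambda>k. h k * c k)"
    using summable_slack_weights[of c] cpos by blast
  define W where "W = (\<Sum>k. h k * c k)"
  have W: "W > 0" unfolding W_def using h cpos by (intro suminf_pos) auto
  define w where "w k = h k * c k / W" for k
  have wpos: "w k > 0" for k using W h cpos by (simp add: w_def)
  have w: "w sums 1"
    using sums_divide[OF summable_sums[OF h(3)], of W] W by (simp add: w_def[abs_def] W_def)
  \<comment> \<open>The grid step \<open>2^(U+k) / L k\<close> is at most
    \<open>B k v / a k\<close>, the precision that \<open>exponent_lower\<close> tolerates.\<close>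
  define B where "B k v = 2^(U+k) * (1 + real v / real (L k))" for k v
  have B_ge: "B k v \<ge> 2^(U+k)" for k v by (simp add: B_def algebra_simps)
  have B_pos: "B k v > 0" for k v by (rule less_le_trans[OF _ B_ge]) simp
  define g where "g k v = a k / B k v" for k v
  have g: "0 \<le> g k v" "g k v \<le> 1/2" for k v
  proof -
    have "2 * real n \<le> 2^n" if "n \<ge> 4" for n :: nat
      using that by (induction n rule: nat_induct_at_least) auto
    from this[of "U+k"] have "2 * real (U+k) \<le> 2^(U+k)" using U by simp
    then have "2 * a k \<le> 2^(U+k)" using order_trans[OF mult_left_mono[OF a_le(1)[of k], of 2]] by simp
    then have "2 * a k \<le> B k v" using B_ge[of k v] by (rule order_trans)
    then show "g k v \<le> 1/2" using B_pos[of k v] by (simp add: g_def field_simps)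
    show "0 \<le> g k v" using a1[of k] B_pos[of k v] by (simp add: g_def)
  qed
  define \<sigma> where "\<sigma> k = (\<lambda>l. (\<Sum>v<L k. prod_strategy (g k v) l) / real (L k))" for k
  have \<sigma>_bd: "\<bar>\<sigma> k l\<bar> \<le> (\<Prod>y\<leftarrow>l. 1 + \<bar>y\<bar>)" for k l
  proof -
    have "\<bar>\<Sum>v<L k. prod_strategy (g k v) l\<bar> \<le> (\<Sum>v<L k. \<Prod>y\<leftarrow>l. 1 + \<bar>y\<bar>)"
      using g(1) order_trans[OF g(2)]
      by (intro order_trans[OF sum_abs] sum_mono prod_strategy_bound) auto
    then show ?thesis using L(3)[of k] by (simp add: \<sigma>_def field_simps)
  qed
  define \<tau> where "\<tau> l = (\<Sum>k. w k * \<sigma> k l)" for l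
  have "summable (\<lambda>k. w k * \<sigma> k l)" for l
  proof (rule summable_comparison_test')
    show "summable (\<lambda>k. w k * (\<Prod>y\<leftarrow>l. 1 + \<bar>y\<bar>))"
      using w by (intro summable_mult2) (simp add: sums_iff)
    show "norm (w k * \<sigma> k l) \<le> w k * (\<Prod>y\<leftarrow>l. 1 + \<bar>y\<bar>)" if "k \<ge> 0" for k
      using \<sigma>_bd[of k l] wpos[of k] by (simp add: abs_mult)
  qed
  then have \<tau>: "(\<lambda>k. w k * \<sigma> k l) sums \<tau> l" for l
    by (simp add: \<tau>_def summable_sums)
  have mix: "(\<lambda>k. w k * capital 1 (\<sigma> k) x n) sums capital 1 \<tau> x n" for x n
    by (rule capital_mixture[OF w \<tau>])
  have prod_nonneg: "(\<Prod>i<n. 1 + g k v * x i) \<ge> 0" if "x \<in> paths" for x n k v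
    using prod_strategy_lower[OF that g] by (meson exp_ge_zero order_trans)
  have cap: "capital 1 (\<sigma> k) x n = (\<Sum>v<L k. \<Prod>i<n. 1 + g k v * x i) / real (L k)" for k x n
    unfolding \<sigma>_def capital_average[OF L(3)] capital_prod_strategy ..
  have cap_nonneg: "capital 1 (\<sigma> k) x n \<ge> 0" if "x \<in> paths" for k x n
    unfolding cap using prod_nonneg[OF that] by (intro divide_nonneg_nonneg sum_nonneg) auto
  have lower: "capital 1 \<tau> x n \<ge> h k * exp (-(1/2) - 32) / W"
    if x: "x \<in> paths" and An: "2^(U+k) \<le> A x n" "A x n < 2^Suc (U+k)"
      and Sn: "S x n \<ge> A x n * \<psi> ((A x n)\<^sup>2)" for x n k
  proof -
    define r where "r = A x n / 2^(U+k)"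
    have r: "1 \<le> r" "r < 2" using An by (simp_all add: r_def field_simps)
    \<comment> \<open>Index of the largest grid point not above \<open>A x n\<close>;
      \<open>r < 2\<close> makes it smaller than \<open>L k\<close>.\<close>
    define v where "v = nat \<lfloor>(r - 1) * real (L k)\<rfloor>"
    have v: "real v \<le> (r - 1) * real (L k)" "(r - 1) * real (L k) < real v + 1"
      using r by (simp_all add: v_def)
    have "(r - 1) * real (L k) < 1 * real (L k)" using r L(3)[of k] by (intro mult_strict_right_mono) auto
    then have vL: "v < L k" using v by linarith
    have A_eq: "A x n = r * 2^(U+k)" by (simp add: r_def)
    have BA: "B k v \<le> A x n" 
    proof -
      have "1 + real v / real (L k) \<le> r" using v(1) L(3)[of k] by (simp add: field_simps)
      then show ?thesis unfolding A_eq B_def by (simp add: mult.commute)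
    qed
    have AB: "A x n \<le> B k v * (1 + 1 / a k)"
    proof -
      have "r \<le> 1 + real v / real (L k) + 1 / real (L k)" using v(2) L(3)[of k] by (simp add: field_simps)
      then have "A x n \<le> B k v + 2^(U+k) / real (L k)"
        unfolding A_eq B_def using mult_right_mono[of r _ "2^(U+k)"] by (fastforce simp: algebra_simps)
      also have "2^(U+k) / real (L k) \<le> B k v / a k"
        using B_ge[of k v] B_pos[of k v] L(1)[of k] a1[of k] by (intro frac_le) auto
      finally show ?thesis by (simp add: algebra_simps)
    qed
    have sq: "4^(U+k) \<le> (A x n)\<^sup>2"
      using power_mono[OF An(1), of 2] by (simp add: power_mult[symmetric] power_mult_distrib[symmetric] power2_eq_square)
    have "a k \<le> \<psi> ((A x n)\<^sup>2)"
      using a_le(2)[of k] sq M[of "U+k"] U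
      by (intro order_trans[OF a_le(2)] mono_onD[OF mono]) auto
    then have SA: "S x n \<ge> A x n * a k"
      using Sn A_nonneg[of x n] mult_left_mono by (meson order_trans)
    \<comment> \<open>\<open>32 = 4 * 8\<close>, with 8 from \<open>cube_le_power2\<close>. The
      cubic loss is thereby independent of \<open>k\<close>.\<close>
    have D: "4 * (a k)^3 \<le> 32 * B k v"
    proof -
      have "(a k)^3 \<le> (real (U+k))^3" using a_le(1)[of k] a1[of k] by (intro power_mono) auto
      also have "\<dots> \<le> 8 * 2^(U+k)" by (rule cube_le_power2)
      also have "\<dots> \<le> 8 * B k v" using B_ge[of k v] by (intro mult_left_mono) auto
      finally show ?thesis by simp
    qed
    have "exp ((a k)\<^sup>2/2 - 1/2 - 32) \<le> (\<Prod>i<n. 1 + g k v * x i)"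
      using order_trans[OF iffD2[OF exp_le_cancel_iff exponent_lower[OF a1 B_pos BA AB SA D]]
          prod_strategy_lower[OF x g, of k v n, unfolded g_def]]
      unfolding g_def .
    also have "\<dots> \<le> (\<Sum>v<L k. \<Prod>i<n. 1 + g k v * x i)"
      using vL prod_nonneg[OF x] by (intro member_le_sum) auto
    finally have "capital 1 (\<sigma> k) x n \<ge> exp ((a k)\<^sup>2/2 - 1/2 - 32) / real (L k)"
      unfolding cap by (intro divide_right_mono) auto
    then have "w k * capital 1 (\<sigma> k) x n \<ge> w k * (exp ((a k)\<^sup>2/2 - 1/2 - 32) / real (L k))"
      using wpos[of k] by (intro mult_left_mono) auto
    \<comment> \<open>The weight \<open>w k\<close> contains \<open>L k * exp (- a^2 / 2)\<close>,
      which cancels the averaging and the gain of the winning process. Only \<open>h k\<close> and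
      constants remain, and \<open>h k\<close> tends to infinity.\<close>
    also have "w k * (exp ((a k)\<^sup>2/2 - 1/2 - 32) / real (L k))
        = h k / W * (exp (- (a k)\<^sup>2/2) * exp ((a k)\<^sup>2/2 - 1/2 - 32))"
      using L(3)[of k] by (simp add: w_def c_def)
    also have "\<dots> = h k * exp (-(1/2) - 32) / W" unfolding exp_add[symmetric] by simp
    finally have "h k * exp (-(1/2) - 32) / W \<le> w k * capital 1 (\<sigma> k) x n" .
    also have "\<dots> \<le> capital 1 \<tau> x n"
      using sum_le_suminf[of "\<lambda>k. w k * capital 1 (\<sigma> k) x n" "{k}"] mix[of x n] cap_nonneg[OF x] wpos
      by (simp add: sums_iff less_imp_le)
    finally show ?thesis .
  qed
  show ?thesis unfolding upper_class_def
  proof (rule can_force_if_unbounded[OF K, of \<tau>])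
    show "capital 1 \<tau> x n \<ge> 0" if "x \<in> paths" for x n
      using cap_nonneg[OF that] wpos
      by (intro sums_le[OF _ sums_zero mix[of x n]]) (simp add: less_imp_le)
    fix x c assume x: "x \<in> paths"
      and nE: "x \<notin> {x \<in> paths. filterlim (A x) at_top sequentially \<longrightarrow>
        (\<forall>\<^sub>F n in sequentially. S x n - A x n * \<psi> ((A x n)\<^sup>2) \<le> 0)}"
    have lim: "filterlim (A x) at_top sequentially"
      and fr: "\<exists>\<^sub>F n in sequentially. S x n > A x n * \<psi> ((A x n)\<^sup>2)"
      using x nE by (auto simp: frequently_def not_less)
    have "\<forall>\<^sub>F k in sequentially. h k \<ge> c * W / exp (-(1/2) - 32)"
      using h(2) by (simp add: filterlim_at_top)
    then obtain k0 where k0: "\<And>k. k \<ge> k0 \<Longrightarrow> h k \<ge> c * W / exp (-(1/2) - 32)"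
      by (auto simp: eventually_sequentially)
    have "\<forall>\<^sub>F n in sequentially. A x n \<ge> 2^(U+k0)" using lim by (simp add: filterlim_at_top)
    then obtain n where n: "S x n > A x n * \<psi> ((A x n)\<^sup>2)" "A x n \<ge> 2^(U+k0)"
      using frequently_ex[OF frequently_eventually_conj[OF fr]] by blast
    have "(1::real) \<le> 2^(U+k0)" by (rule one_le_power) simp
    from ex_pow2_interval[OF order_trans[OF this n(2)]]
    obtain u where u: "2^u \<le> A x n" "A x n < 2^Suc u" .
    have "(2::real)^(U+k0) < 2^Suc u" using n(2) u(2) by linarith
    then have "U + k0 < Suc u" by (rule power_less_imp_less_exp[rotated]) simp
    then obtain k where k: "u = U + k" "k \<ge> k0" using le_Suc_ex[of "U+k0" u] by (auto simp: add.assoc)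
    have "c \<le> h k * exp (-(1/2) - 32) / W" using k0[OF k(2)] W by (simp add: field_simps)
    also have "\<dots> \<le> capital 1 \<tau> x n" using lower[OF x, of k n] u n(1) k by simp
    finally show "\<exists>n. capital 1 \<tau> x n \<ge> c" by blast
  qed
qed

section \<open>The integral test\<close>

text \<open>The step function with value \<open>g i\<close> on the cell \<open>i\<close> lies below
  \<open>F\<close>, since each point meets at most one cell. A cell has length
  \<open>3 * 4^(u+i)\<close>; the 3 is removed at the end.\<close>

lemma summable_if_cell_lower:
  fixes F :: "real \<Rightarrow> real" and g :: "nat \<Rightarrow> real"
  assumes g: "\<And>i. g i \<ge> 0" and u: "M < 4^u"
    and le: "\<And>i l. 4^(u+i) \<le> l \<Longrightarrow> l < 4^(u+Suc i) \<Longrightarrow> g i \<le> F l"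
    and fin: "(\<integral>\<^sup>+l\<in>{M<..}. ennreal (F l) \<partial>lborel) < \<infinity>"
  shows "summable (\<lambda>i. g i * 4^(u+i))"
proof -
  let ?C = "\<lambda>i. {4^(u+i)..<4^(u+Suc i)::real}"
  have point: "(\<Sum>i. ennreal (g i) * indicator (?C i) l) \<le> ennreal (F l) * indicator {M<..} l" for l
  proof (cases "\<exists>j. l \<in> ?C j")
    case True
    then obtain j where j: "l \<in> ?C j" by blast
    have other: "l \<notin> ?C i" if "i \<noteq> j" for i
    proof
      assume i: "l \<in> ?C i"
      then have "(4::real)^(u+i) < 4^(u+Suc j)" "(4::real)^(u+j) < 4^(u+Suc i)"
        using j by (auto intro: le_less_trans)
      then have "u + i < u + Suc j" "u + j < u + Suc i"
        by (auto intro: power_less_imp_less_exp[of "4::real", rotated] simp del: power_Suc)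
      then show False using that by simp
    qed
    have "(\<Sum>i. ennreal (g i) * indicator (?C i) l) = (\<Sum>i\<in>{j}. ennreal (g i) * indicator (?C i) l)"
      using other by (intro suminf_finite) (auto simp: indicator_def)
    also have "\<dots> = ennreal (g j)" using j by simp
    also have "\<dots> \<le> ennreal (F l)" using le[of j l] j by (intro ennreal_leI) auto
    also have "ennreal (F l) = ennreal (F l) * indicator {M<..} l"
    proof -
      have "(4::real)^u \<le> 4^(u+j)" by (intro power_increasing) auto
      also have "\<dots> \<le> l" using j by simp
      finally have "M < l" using u by (rule less_le_trans[rotated])
      then show ?thesis by simp
    qed
    finally show ?thesis .
  next
    case False
    then have "(\<lambda>i. ennreal (g i) * indicator (?C i) l) = (\<lambda>i. 0)" by (auto simp: indicator_def)
    then show ?thesis by simp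
  qed
  have "(\<Sum>i. ennreal (g i * (3 * 4^(u+i)))) = (\<Sum>i. \<integral>\<^sup>+l. ennreal (g i) * indicator (?C i) l \<partial>lborel)"
  proof (rule suminf_cong)
    fix i
    have "(\<integral>\<^sup>+l. ennreal (g i) * indicator (?C i) l \<partial>lborel) = ennreal (g i) * ennreal (4^(u+Suc i) - 4^(u+i))"
      by (subst nn_integral_cmult_indicator) auto
    also have "\<dots> = ennreal (g i * (3 * 4^(u+i)))" using g by (subst ennreal_mult[symmetric]) auto
    finally show "ennreal (g i * (3 * 4^(u+i))) = (\<integral>\<^sup>+l. ennreal (g i) * indicator (?C i) l \<partial>lborel)" by simp
  qed
  also have "\<dots> = (\<integral>\<^sup>+l. (\<Sum>i. ennreal (g i) * indicator (?C i) l) \<partial>lborel)"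
    by (intro nn_integral_suminf[symmetric]) auto
  also have "\<dots> \<le> (\<integral>\<^sup>+l\<in>{M<..}. ennreal (F l) \<partial>lborel)" by (intro nn_integral_mono point)
  also have "\<dots> < \<infinity>" by fact
  finally have "summable (\<lambda>i. g i * (3 * 4^(u+i)))"
    using g by (intro summable_suminf_not_top) auto
  from summable_mult[OF this, of "1/3"] show ?thesis by simp
qed

text \<open>The counterpart with a step function above \<open>F\<close>. The piece
  \<open>{M<..4^u}\<close> before the first cell is covered by the constant
  \<open>B\<close>.\<close>

lemma integral_finite_if_cell_upper:
  fixes F :: "real \<Rightarrow> real" and g :: "nat \<Rightarrow> real"
  assumes g: "\<And>i. g i \<ge> 0" and u: "M < 4^u" and B: "B \<ge> 0" "\<And>l. l > M \<Longrightarrow> F l \<le> B"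
    and le: "\<And>i l. 4^(u+i) \<le> l \<Longrightarrow> l < 4^(u+Suc i) \<Longrightarrow> F l \<le> g i"
    and sm: "summable (\<lambda>i. g i * 4^(u+i))"
  shows "(\<integral>\<^sup>+l\<in>{M<..}. ennreal (F l) \<partial>lborel) < \<infinity>"
proof -
  let ?C = "\<lambda>i. {4^(u+i)..<4^(u+Suc i)::real}"
  let ?s = "\<lambda>l. \<Sum>i. ennreal (g i) * indicator (?C i) l"
  have point: "ennreal (F l) * indicator {M<..} l \<le> ennreal B * indicator {M<..4^u} l + ?s l" for l
  proof (cases "l \<ge> 4^u")
    case True
    have "\<exists>n. l < 4^(u+n)"
    proof -
      obtain n where "l < 4^n" using real_arch_pow[of 4 l] by auto
      also have "(4::real)^n \<le> 4^(u+n)" by (intro power_increasing) auto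
      finally show ?thesis by blast
    qed
    define n where "n = (LEAST n. l < 4^(u+n))"
    have n: "l < 4^(u+n)" unfolding n_def by (rule LeastI_ex) fact
    then have "n \<noteq> 0" using True by (intro notI) simp
    then obtain j where j: "n = Suc j" by (cases n) auto
    have "\<not> l < 4^(u+j)" using not_less_Least[of j "\<lambda>n. l < 4^(u+n)"] j by (simp add: n_def)
    then have lj: "l \<in> ?C j" using n j by auto
    have "ennreal (F l) * indicator {M<..} l \<le> ennreal (g j)"
      using le[of j l] lj by (auto simp: indicator_def intro: ennreal_leI)
    also have "\<dots> = (\<Sum>i\<in>{j}. ennreal (g i) * indicator (?C i) l)" using lj by simp
    also have "\<dots> \<le> ?s l" by (intro sum_le_suminf) auto
    also have "\<dots> \<le> ennreal B * indicator {M<..4^u} l + ?s l" by simp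
    finally show ?thesis .
  next
    case False
    then have "ennreal (F l) * indicator {M<..} l \<le> ennreal B * indicator {M<..4^u} l"
      using B(2)[of l] by (auto simp: indicator_def intro: ennreal_leI)
    then show ?thesis by (simp add: add_increasing2)
  qed
  have "(\<integral>\<^sup>+l. ?s l \<partial>lborel) = (\<Sum>i. \<integral>\<^sup>+l. ennreal (g i) * indicator (?C i) l \<partial>lborel)"
    by (intro nn_integral_suminf) auto
  also have "\<dots> = (\<Sum>i. ennreal (g i * (3 * 4^(u+i))))"
  proof (rule suminf_cong)
    fix i
    have "(\<integral>\<^sup>+l. ennreal (g i) * indicator (?C i) l \<partial>lborel) = ennreal (g i) * ennreal (4^(u+Suc i) - 4^(u+i))"
      by (subst nn_integral_cmult_indicator) auto
    also have "\<dots> = ennreal (g i * (3 * 4^(u+i)))" using g by (subst ennreal_mult[symmetric]) auto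
    finally show "(\<integral>\<^sup>+l. ennreal (g i) * indicator (?C i) l \<partial>lborel) = ennreal (g i * (3 * 4^(u+i)))" .
  qed
  also have "\<dots> < \<infinity>"
  proof -
    have "summable (\<lambda>i. g i * (3 * 4^(u+i)))" using summable_mult[OF sm, of 3] by (simp add: mult_ac)
    then have "(\<Sum>i. ennreal (g i * (3 * 4^(u+i)))) = ennreal (\<Sum>i. g i * (3 * 4^(u+i)))"
      using g by (intro suminf_ennreal2) auto
    then show ?thesis by simp
  qed
  finally have s: "(\<integral>\<^sup>+l. ?s l \<partial>lborel) < \<infinity>" .
  have b: "(\<integral>\<^sup>+l. ennreal B * indicator {M<..4^u} l \<partial>lborel) < \<infinity>"
    using u by (subst nn_integral_cmult_indicator) (auto simp: ennreal_mult_less_top)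
  have "(\<integral>\<^sup>+l\<in>{M<..}. ennreal (F l) \<partial>lborel) \<le> (\<integral>\<^sup>+l. ennreal B * indicator {M<..4^u} l + ?s l \<partial>lborel)"
    by (intro nn_integral_mono point)
  also have "\<dots> = (\<integral>\<^sup>+l. ennreal B * indicator {M<..4^u} l \<partial>lborel) + (\<integral>\<^sup>+l. ?s l \<partial>lborel)"
    by (intro nn_integral_add) auto
  also have "\<dots> < \<infinity>" using s b by simp
  finally show ?thesis .
qed

text \<open>Either side forces \<psi> to reach 1. From there on \<open>gtail (\<psi> l)\<close> is
  nonincreasing in \<open>l\<close>, so its values on a cell lie between those at the
  endpoints.\<close>

theorem integral_finite_iff_summable:
  fixes \<psi> :: "real \<Rightarrow> real"
  assumes M: "M > 0" and pos: "\<And>l. l > M \<Longrightarrow> \<psi> l > 0" and mono: "mono_on {M<..} \<psi>"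
  shows "(\<integral>\<^sup>+l\<in>{M<..}. ennreal (gtail (\<psi> l) / l) \<partial>lborel) < \<infinity> \<longleftrightarrow>
    summable (\<lambda>u. gtail (\<psi> (4^u)))" (is "?I < \<infinity> \<longleftrightarrow> ?S")
proof -
  obtain u0 :: nat where u0: "M < 4^u0" using real_arch_pow[of 4 M] by auto
  have Mlt: "M < 4^u" if "u \<ge> u0" for u
    using that u0 power_increasing[of u0 u "4::real"] by linarith
  have mono_le: "\<psi> x \<le> \<psi> y" if "M < x" "x \<le> y" for x y
    using that by (intro mono_onD[OF mono]) auto
  show ?thesis
  proof
    assume S: ?S
    have "\<exists>u. \<psi> (4^(u+u0)) \<ge> 1"
    proof (rule eventually_ge_1_if_summable_gtail)
      show "summable (\<lambda>u. gtail (\<psi> (4^(u+u0))))" using S by (rule summable_ignore_initial_segment)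
      show "mono (\<lambda>u. \<psi> (4^(u+u0)))"
        by (intro monoI mono_le Mlt power_increasing) auto
    qed (use pos Mlt in auto)
    then obtain U where U: "U \<ge> u0" "\<psi> (4^U) \<ge> 1" by (metis le_add2)
    show "?I < \<infinity>"
    \<comment> \<open>The choice \<open>B = 1/M\<close> works because \<open>gtail\<close> is at
      most 1, by \<open>y \<le> 1 + y^2 / 2 \<le> exp (y^2 / 2)\<close>.\<close>
    proof (rule integral_finite_if_cell_upper[where B = "1/M" and u = U and g = "\<lambda>i. gtail (\<psi> (4^(U+i))) / 4^(U+i)"])
      show "M < 4^U" using Mlt U by simp
      show "gtail (\<psi> l) / l \<le> 1 / M" if "l > M" for l
      proof -
        have "\<psi> l \<le> exp ((\<psi> l)\<^sup>2 / 2)"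
        proof -
          have "\<psi> l \<le> 1 + (\<psi> l)\<^sup>2 / 2"
            using zero_le_power2[of "\<psi> l - 1"] by (simp add: power2_eq_square algebra_simps)
          also have "\<dots> \<le> exp ((\<psi> l)\<^sup>2 / 2)" by (rule exp_ge_add_one_self)
          finally show ?thesis .
        qed
        then have "gtail (\<psi> l) \<le> 1" by (simp add: gtail_def exp_minus field_simps)
        then show ?thesis using that M by (intro frac_le) auto
      qed
      show "gtail (\<psi> l) / l \<le> gtail (\<psi> (4^(U+i))) / 4^(U+i)" if "4^(U+i) \<le> l" for i l
      proof (intro frac_le gtail_antimono that)
        have "1 \<le> \<psi> (4^U)" by fact
        also have "\<dots> \<le> \<psi> (4^(U+i))" using U by (intro mono_le Mlt power_increasing) auto
        finally show "1 \<le> \<psi> (4^(U+i))" .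
        show "\<psi> (4^(U+i)) \<le> \<psi> l" using that U by (intro mono_le Mlt) auto
        show "0 \<le> gtail (\<psi> (4^(U+i)))" using U by (intro less_imp_le[OF gtail_pos] pos Mlt) auto
      qed auto
      show "0 \<le> gtail (\<psi> (4^(U+i))) / 4^(U+i)" for i
        using U by (intro divide_nonneg_nonneg less_imp_le[OF gtail_pos] pos Mlt) auto
      show "summable (\<lambda>i. gtail (\<psi> (4^(U+i))) / 4^(U+i) * 4^(U+i))"
        using summable_ignore_initial_segment[OF S, of U] by (simp add: add.commute)
    qed (use M in auto)
  next
    assume I: "?I < \<infinity>"
    have "\<exists>u\<ge>u0. \<psi> (4^u) \<ge> 1"
    proof (rule ccontr)
      assume "\<not> ?thesis"
      then have lt: "\<psi> (4^u) < 1" if "u \<ge> u0" for u using that by (meson not_le)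
      define c where "c = \<psi> (4^u0) * exp (-1/2)"
      have c: "c > 0" using pos[OF u0] by (simp add: c_def)
      \<comment> \<open>If \<psi> stayed below 1 along the powers of 4, the integrand would be at
        least \<open>c / l\<close>, and every cell would contribute at least the same positive
        amount.\<close>
      have "summable (\<lambda>i. c / 4^(u0 + Suc i) * 4^(u0 + i))"
      proof (rule summable_if_cell_lower[OF _ u0 _ I])
        fix i l assume l: "4^(u0+i) \<le> l" "l < (4::real)^(u0+Suc i)"
        have 1: "\<psi> (4^u0) \<le> \<psi> l"
        proof (rule mono_le[OF u0])
          have "(4::real)^u0 \<le> 4^(u0+i)" by (intro power_increasing) auto
          then show "4^u0 \<le> l" using l by linarith
        qed
        have lM: "M < l" using Mlt[of "u0+i"] l by simp
        have "\<psi> l \<le> \<psi> (4^(u0+Suc i))" using lM l by (intro mono_le) auto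
        also have "\<dots> < 1" by (intro lt) simp
        finally have "(\<psi> l)\<^sup>2 \<le> 1" using pos[OF lM] by (intro power_le_one) auto
        then have "c \<le> gtail (\<psi> l)" unfolding c_def gtail_def
          using 1 pos[OF u0] by (intro mult_mono) auto
        then show "c / 4^(u0 + Suc i) \<le> gtail (\<psi> l) / l"
          using l lM M c by (intro frac_le) auto
      qed (use c in auto)
      then have "summable (\<lambda>i. c / 4)" by simp
      then show False using c by (simp add: summable_const_iff)
    qed
    then obtain U where U: "U \<ge> u0" "\<psi> (4^U) \<ge> 1" by auto
    \<comment> \<open>The lower bound on a cell is taken from its right end, hence the shift of the
      index by one and the factor 4 afterwards.\<close>
    have "summable (\<lambda>i. gtail (\<psi> (4^(U + Suc i))) / 4^(U + Suc i) * 4^(U + i))"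
    proof (rule summable_if_cell_lower[OF _ _ _ I])
      fix i l assume l: "4^(U+i) \<le> l" "l < (4::real)^(U+Suc i)"
      have lM: "M < l" using Mlt[of "U+i"] l U by simp
      show "gtail (\<psi> (4^(U + Suc i))) / 4^(U + Suc i) \<le> gtail (\<psi> l) / l"
      proof (intro frac_le gtail_antimono)
        have "(4::real)^U \<le> 4^(U+i)" by (intro power_increasing) auto
        also have "\<dots> \<le> l" by (rule l)
        finally have "\<psi> (4^U) \<le> \<psi> l" using U by (intro mono_le Mlt) auto
        then show "1 \<le> \<psi> l" using U by simp
        show "\<psi> l \<le> \<psi> (4^(U + Suc i))" using lM l by (intro mono_le) auto
        show "0 \<le> gtail (\<psi> l)" using gtail_pos[OF pos[OF lM]] by simp
      qed (use l lM M in auto)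
    next
      show "0 \<le> gtail (\<psi> (4^(U + Suc i))) / 4^(U + Suc i)" for i
        using U by (intro divide_nonneg_nonneg less_imp_le[OF gtail_pos] pos Mlt) auto
    qed (use Mlt U in auto)
    from summable_mult[OF this, of 4] have "summable (\<lambda>i. gtail (\<psi> (4^(i + Suc U))))"
      by (simp add: add.commute)
    then show ?S by (subst (asm) summable_iff_shift)
  qed
qed

section \<open>Binomial coefficients\<close>

text \<open>\<open>ln ((1 - z) / (1 + z))\<close> expands as
  \<open>- 2 * z - 2 * z^3 / 3 - ...\<close>; for \<open>z \<le> 1/2\<close> the full
  \<open>z^3\<close> covers the whole remainder. The quotient is the ratio of neighbouring binomial
  coefficients, see \<open>bin_weight_step\<close>.\<close>

lemma log_odds_bounds:
  fixes z :: real
  assumes z: "0 \<le> z" "z < 1"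
  shows "(1 - z) / (1 + z) \<le> exp (- 2 * z)"
    and "z \<le> 1/2 \<Longrightarrow> exp (- 2 * z - z^3) \<le> (1 - z) / (1 + z)"
proof -
  have "(\<lambda>z. ln (1 + z) - ln (1 - z) - 2 * z) 0 \<le> (\<lambda>z. ln (1 + z) - ln (1 - z) - 2 * z) z"
  proof (rule DERIV_nonneg_imp_nondecreasing[OF z(1)])
    fix t assume t: "0 \<le> t" "t \<le> z"
    have d: "((\<lambda>z. ln (1 + z) - ln (1 - z) - 2 * z) has_real_derivative (1/(1+t) + 1/(1-t) - 2)) (at t)"
      using t z by (auto intro!: derivative_eq_intros)
    have "1 + t \<noteq> 0" "1 - t \<noteq> 0" using t z by auto
    then have "1/(1+t) + 1/(1-t) - 2 = 2 * t\<^sup>2 / ((1 + t) * (1 - t))"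
      by (simp add: divide_simps) (simp add: algebra_simps power2_eq_square)
    also have "\<dots> \<ge> 0" using t z by (intro divide_nonneg_nonneg mult_nonneg_nonneg) auto
    finally show "\<exists>y. ((\<lambda>z. ln (1 + z) - ln (1 - z) - 2 * z) has_real_derivative y) (at t) \<and> 0 \<le> y"
      using d by blast
  qed
  then have "ln ((1 - z) / (1 + z)) \<le> - 2 * z" using z by (simp add: ln_div)
  then have "exp (ln ((1 - z) / (1 + z))) \<le> exp (- 2 * z)" by (rule iffD2[OF exp_le_cancel_iff])
  moreover have p: "(1 - z) / (1 + z) > 0" using z by auto
  ultimately show "(1 - z) / (1 + z) \<le> exp (- 2 * z)" by simp
  assume h: "z \<le> 1/2"
  have "(\<lambda>z. 2 * z + z^3 - ln (1 + z) + ln (1 - z)) 0 \<le> (\<lambda>z. 2 * z + z^3 - ln (1 + z) + ln (1 - z)) z"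
  proof (rule DERIV_nonneg_imp_nondecreasing[OF z(1)])
    fix t assume t: "0 \<le> t" "t \<le> z"
    have d: "((\<lambda>z. 2 * z + z^3 - ln (1 + z) + ln (1 - z)) has_real_derivative (2 + 3 * t\<^sup>2 - 1/(1+t) - 1/(1-t))) (at t)"
      using t z by (auto intro!: derivative_eq_intros)
    have "t * t \<le> 1/2 * (1/2)" using t h by (intro mult_mono) auto
    then have "0 \<le> t\<^sup>2 * (1 - 3 * t\<^sup>2)" by (intro mult_nonneg_nonneg) (auto simp: power2_eq_square)
    moreover have "0 < (1 + t) * (1 - t)" using t z by (intro mult_pos_pos) auto
    ultimately have "0 \<le> t\<^sup>2 * (1 - 3 * t\<^sup>2) / ((1 + t) * (1 - t))" by simp
    also have "\<dots> = 2 + 3 * t\<^sup>2 - 1/(1+t) - 1/(1-t)"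
    proof -
      have "1 + t \<noteq> 0" "1 - t \<noteq> 0" using t z by auto
      then show ?thesis by (simp add: divide_simps) (simp add: algebra_simps power2_eq_square)
    qed
    finally show "\<exists>y. ((\<lambda>z. 2 * z + z^3 - ln (1 + z) + ln (1 - z)) has_real_derivative y) (at t) \<and> 0 \<le> y"
      using d by blast
  qed
  then have "- 2 * z - z^3 \<le> ln ((1 - z) / (1 + z))" using z by (simp add: ln_div)
  then have "exp (- 2 * z - z^3) \<le> exp (ln ((1 - z) / (1 + z)))" by (rule iffD2[OF exp_le_cancel_iff])
  then show "exp (- 2 * z - z^3) \<le> (1 - z) / (1 + z)" using p by simp
qed

definition bin_weight :: "nat \<Rightarrow> nat \<Rightarrow> real"
  where "bin_weight n c = real (n choose c) / 2^n"

lemma bin_weight_nonneg: "bin_weight n c \<ge> 0"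
  by (simp add: bin_weight_def)

lemma bin_weight_central_step:
  "bin_weight (2 * Suc m) (Suc m) = bin_weight (2 * m) m * ((2 * real m + 1) / (2 * real m + 2))"
proof -
  have "real (2 * Suc m choose Suc m) = fact (Suc (Suc (2*m))) / (fact (Suc m) * fact (Suc m))"
    by (subst binomial_fact) auto
  also have "\<dots> = (2 * real m + 2) * (2 * real m + 1) / (real m + 1)\<^sup>2 * (fact (2*m) / (fact m * fact m))"
    by (simp add: power2_eq_square mult_ac add_ac)
  also have "fact (2*m) / (fact m * fact m) = real (2 * m choose m)"
    by (subst binomial_fact) (auto simp: mult_2)
  also have "(2 * real m + 2) * (2 * real m + 1) / (real m + 1)\<^sup>2 = 4 * ((2 * real m + 1) / (2 * real m + 2))"
    by (simp add: power2_eq_square divide_simps) (simp add: algebra_simps)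
  finally have "real (2 * Suc m choose Suc m) = 4 * ((2 * real m + 1) / (2 * real m + 2)) * real (2 * m choose m)" .
  moreover have "(2::real)^(2 * Suc m) = 4 * 2^(2*m)" by simp
  ultimately show ?thesis unfolding bin_weight_def by (simp only: divide_simps) simp
qed

text \<open>In place of Stirling's formula: \<open>(bin_weight (2*m) m)^2 * (2*m + 1)\<close> is
  nonincreasing in \<open>m\<close> and starts at 1.\<close>

lemma bin_weight_central_upper:
  assumes "m \<ge> 1"
  shows "bin_weight (2 * m) m \<le> 1 / sqrt (real m)"
proof -
  have "(bin_weight (2 * m) m)\<^sup>2 * (2 * real m + 1) \<le> 1" for m
  proof (induction m)
    case (Suc m)
    define t where "t = real m"
    have t: "t \<ge> 0" by (simp add: t_def)
    have "(bin_weight (2 * Suc m) (Suc m))\<^sup>2 * (2 * real (Suc m) + 1)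
       = (bin_weight (2 * m) m)\<^sup>2 * (2 * t + 1) * ((2*t+1) * (2*t+3) / (2*t+2)\<^sup>2)"
      unfolding bin_weight_central_step t_def[symmetric]
      by (simp add: power_mult_distrib power_divide t_def power2_eq_square)
    also have "\<dots> \<le> 1 * ((2*t+1) * (2*t+3) / (2*t+2)\<^sup>2)"
      using Suc t by (intro mult_right_mono) (auto simp: t_def)
    also have "\<dots> \<le> 1"
    proof -
      have "(2*t+1) * (2*t+3) \<le> (2*t+2)\<^sup>2" by (simp add: power2_eq_square algebra_simps)
      then show ?thesis using t by (simp add: divide_le_eq_1_pos)
    qed
    finally show ?case .
  qed (simp add: bin_weight_def)
  from order_trans[OF mult_left_mono this[of m], of "real m"]
  have "(bin_weight (2 * m) m)\<^sup>2 * real m \<le> 1" by simp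
  then have "(bin_weight (2 * m) m)\<^sup>2 \<le> (1 / sqrt (real m))\<^sup>2"
    using assms by (simp add: power_divide field_simps)
  then show ?thesis by (rule power2_le_imp_le) simp
qed

text \<open>\<open>(bin_weight (2*m) m)^2 * 4 * m\<close> is nondecreasing and equals 1 at
  \<open>m = 1\<close>.\<close>

lemma bin_weight_central_lower:
  assumes "m \<ge> 1"
  shows "bin_weight (2 * m) m \<ge> 1 / (2 * sqrt (real m))"
proof -
  have "(bin_weight (2 * m) m)\<^sup>2 * (4 * real m) \<ge> 1"
    using assms
  proof (induction m rule: nat_induct_at_least)
    case (Suc m)
    define t where "t = real m"
    have t: "t > 0" using Suc by (simp add: t_def)
    have "4 * t * (t + 1) \<le> (2*t+1)\<^sup>2" by (simp add: power2_eq_square algebra_simps)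
    moreover have "4 * t * (t + 1) > 0" using t by simp
    ultimately have "1 \<le> (2*t+1)\<^sup>2 / (4 * t * (t + 1))" by (simp only: le_divide_eq_1_pos)
    then have "1 * 1 \<le> (bin_weight (2 * m) m)\<^sup>2 * (4 * t) * ((2*t+1)\<^sup>2 / (4 * t * (t + 1)))"
      using Suc unfolding t_def by (intro mult_mono) auto
    also have "\<dots> = (bin_weight (2 * Suc m) (Suc m))\<^sup>2 * (4 * real (Suc m))"
      unfolding bin_weight_central_step t_def[symmetric] using t
      by (simp add: power_mult_distrib power_divide t_def[symmetric] power2_eq_square divide_simps) (simp add: algebra_simps)
    finally show ?case by simp
  qed (simp add: bin_weight_def power2_eq_square)
  then have "(1 / (2 * sqrt (real m)))\<^sup>2 \<le> (bin_weight (2 * m) m)\<^sup>2"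
    using assms by (simp add: power_divide power_mult_distrib field_simps)
  then show ?thesis by (rule power2_le_imp_le) (rule bin_weight_nonneg)
qed

text \<open>The ratio is written through \<open>z = (i + 1/2) / (m + 1/2)\<close> to match
  \<open>log_odds_bounds\<close>. The half-integers make the sum of \<open>2 * z\<close> over the
  first \<open>i\<close> steps exactly \<open>i^2 / (m + 1/2)\<close>.\<close>

lemma bin_weight_step:
  assumes "i < m"
  shows "bin_weight (2*m) (m + Suc i) = bin_weight (2*m) (m + i) *
    ((1 - (real i + 1/2) / (real m + 1/2)) / (1 + (real i + 1/2) / (real m + 1/2)))"
proof -
  have "Suc (m + i) * (2*m choose Suc (m + i)) = (m - i) * (2*m choose (m + i))"
    using binomial_absorb_comp[of "2*m" "m + i"] binomial_absorption[of "m + i" "2*m"] assms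
    by (simp add: mult_2)
  then have "(real m + real i + 1) * real (2*m choose Suc (m + i)) = (real m - real i) * real (2*m choose (m + i))"
    using assms by (metis (no_types, lifting) of_nat_mult of_nat_diff of_nat_Suc of_nat_add less_imp_le add.commute)
  then have "real (2*m choose Suc (m + i)) = real (2*m choose (m + i)) * ((real m - real i) / (real m + real i + 1))"
    by (simp add: field_simps)
  moreover have "(1 - (real i + 1/2) / (real m + 1/2)) / (1 + (real i + 1/2) / (real m + 1/2))
      = (real m - real i) / (real m + real i + 1)"
    by (simp add: divide_simps) (simp add: algebra_simps)
  ultimately show ?thesis by (simp add: bin_weight_def)
qed

text \<open>The steps away from the centre multiply up to at most
  \<open>exp (- i^2 / (m + 1/2))\<close>. Replacing \<open>m + 1/2\<close> by \<open>m\<close> costs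
  a factor \<open>exp (1/2) \<le> 2\<close>, as \<open>i \<le> m\<close>. Symmetry handles
  \<open>c < m\<close>.\<close>

lemma bin_weight_upper:
  assumes m: "m \<ge> 1"
  shows "bin_weight (2*m) c \<le> 2 / sqrt (real m) * exp (- (real c - real m)\<^sup>2 / real m)"
proof -
  have base: "bin_weight (2*m) (m + i) \<le> bin_weight (2*m) m * exp (- (real i)\<^sup>2 / (real m + 1/2))"
    if "i \<le> m" for i
    using that
  proof (induction i)
    case (Suc i)
    define N where "N = real m + 1/2"
    define z where "z = (real i + 1/2) / N"
    have z: "0 \<le> z" "z < 1" using Suc by (auto simp: z_def N_def divide_simps)
    have "bin_weight (2*m) (m + Suc i) = bin_weight (2*m) (m + i) * ((1 - z) / (1 + z))"
      using bin_weight_step[of i m] Suc by (simp add: z_def N_def)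
    also have "\<dots> \<le> (bin_weight (2*m) m * exp (- (real i)\<^sup>2 / N)) * exp (-2 * z)"
      using Suc log_odds_bounds(1)[OF z] z bin_weight_nonneg by (intro mult_mono) (auto simp: N_def)
    also have "\<dots> = bin_weight (2*m) m * exp (- (real i)\<^sup>2 / N + -2 * z)"
      by (simp only: exp_add mult.assoc)
    also have "- (real i)\<^sup>2 / N + -2 * z = - (real (Suc i))\<^sup>2 / N"
      by (simp add: z_def power2_eq_square diff_divide_distrib add_divide_distrib algebra_simps)
    finally show ?case by (simp add: N_def)
  qed simp
  have up: "bin_weight (2*m) (m + i) \<le> 2 / sqrt (real m) * exp (- (real i)\<^sup>2 / real m)" if "i \<le> m" for i
  proof -
    have "(real i)\<^sup>2 / real m - (real i)\<^sup>2 / (real m + 1/2) = (real i)\<^sup>2 / (real m * (2 * real m + 1))"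
      using m by (simp add: field_simps)
    also have "\<dots> \<le> 1/2"
    proof -
      have "(real i)\<^sup>2 \<le> (real m)\<^sup>2" using that by (intro power_mono) auto
      then have "2 * (real i)\<^sup>2 \<le> real m * (2 * real m + 1)" by (simp add: power2_eq_square algebra_simps)
      then show ?thesis using m by (simp add: divide_le_eq)
    qed
    finally have "- (real i)\<^sup>2 / (real m + 1/2) \<le> 1/2 + - (real i)\<^sup>2 / real m"
      unfolding minus_divide_left[symmetric] by linarith
    then have "exp (- (real i)\<^sup>2 / (real m + 1/2)) \<le> exp (1/2) * exp (- (real i)\<^sup>2 / real m)"
      unfolding exp_add[symmetric] by (rule iffD2[OF exp_le_cancel_iff])
    also have "exp (1/2) \<le> (2::real)" using exp_bound_half[of "1/2::real"] by simp
    finally have "exp (- (real i)\<^sup>2 / (real m + 1/2)) \<le> 2 * exp (- (real i)\<^sup>2 / real m)" by simp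
    then have "bin_weight (2*m) (m + i) \<le> 1 / sqrt (real m) * (2 * exp (- (real i)\<^sup>2 / real m))"
      using bin_weight_central_upper[OF m] bin_weight_nonneg
      by (intro order_trans[OF base[OF that]] mult_mono) auto
    then show ?thesis by simp
  qed
  consider "c > 2*m" | "m \<le> c" "c \<le> 2*m" | "c < m" by linarith
  then show ?thesis
  proof cases
    case 1
    then show ?thesis by (simp add: bin_weight_def binomial_eq_0)
  next
    case 2
    then show ?thesis using up[of "c - m"] by (simp add: of_nat_diff)
  next
    case 3
    then have "bin_weight (2*m) c = bin_weight (2*m) (m + (m - c))"
      unfolding bin_weight_def by (subst binomial_symmetric) (auto simp: mult_2)
    then show ?thesis using up[of "m - c"] 3 by (simp add: of_nat_diff power2_commute)
  qed
qed

text \<open>Each of the \<open>i\<close> steps loses at most a factor \<open>exp (- z^3)\<close>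
  against the Gaussian ratio, with \<open>z \<le> i / m\<close>; together they lose at most
  \<open>i^4 / m^3\<close> in the exponent. The condition \<open>2 * i \<le> m\<close> gives
  \<open>z \<le> 1/2\<close>.\<close>

lemma bin_weight_lower:
  assumes m: "m \<ge> 1" and i: "2 * i \<le> m"
  shows "bin_weight (2*m) (m + i) \<ge> 1 / (2 * sqrt (real m)) * exp (- (real i)\<^sup>2 / real m - (real i)^4 / (real m)^3)"
proof -
  define N where "N = real m + 1/2"
  define t where "t = (real i / real m)^3"
  have "bin_weight (2*m) (m + j) \<ge> bin_weight (2*m) m * exp (- (real j)\<^sup>2 / N - real j * t)" if "j \<le> i" for j
    using that
  proof (induction j)
    case (Suc j)
    define z where "z = (real j + 1/2) / N"
    have z: "0 \<le> z" "z \<le> 1/2" using Suc i by (auto simp: z_def N_def divide_simps)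
    have zi: "z \<le> real i / real m" unfolding z_def N_def using Suc m by (intro frac_le) auto
    have zt: "z^3 \<le> t" unfolding t_def by (intro power_mono zi z)
    have "- (real (Suc j))\<^sup>2 / N - real (Suc j) * t = (- (real j)\<^sup>2 / N - real j * t) + (-2 * z - t)"
      by (simp add: z_def power2_eq_square diff_divide_distrib add_divide_distrib algebra_simps)
    then have "bin_weight (2*m) m * exp (- (real (Suc j))\<^sup>2 / N - real (Suc j) * t)
        = (bin_weight (2*m) m * exp (- (real j)\<^sup>2 / N - real j * t)) * exp (-2 * z - t)"
      by (simp only: exp_add mult.assoc)
    also have "\<dots> \<le> bin_weight (2*m) (m + j) * exp (-2 * z - z^3)"
      using Suc zt bin_weight_nonneg by (intro mult_mono) auto
    also have "\<dots> \<le> bin_weight (2*m) (m + j) * ((1 - z) / (1 + z))"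
      using log_odds_bounds(2)[of z] z bin_weight_nonneg by (intro mult_left_mono) auto
    also have "\<dots> = bin_weight (2*m) (m + Suc j)"
      using bin_weight_step[of j m] Suc i by (simp add: z_def N_def)
    finally show ?case .
  qed simp
  from this[of i] have "bin_weight (2*m) m * exp (- (real i)\<^sup>2 / N - real i * t) \<le> bin_weight (2*m) (m + i)" by simp
  moreover have "1 / (2 * sqrt (real m)) * exp (- (real i)\<^sup>2 / real m - (real i)^4 / (real m)^3)
      \<le> bin_weight (2*m) m * exp (- (real i)\<^sup>2 / N - real i * t)"
  proof (intro mult_mono bin_weight_central_lower m bin_weight_nonneg)
    have "(real i)\<^sup>2 / N \<le> (real i)\<^sup>2 / real m" unfolding N_def using m by (intro divide_left_mono) auto
    moreover have "real i * t = (real i)^4 / (real m)^3" by (simp add: t_def power_divide power_numeral_reduce)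
    ultimately show "exp (- (real i)\<^sup>2 / real m - (real i)^4 / (real m)^3) \<le> exp (- (real i)\<^sup>2 / N - real i * t)"
      by simp
  qed auto
  ultimately show ?thesis by linarith
qed

section \<open>Coin tossing\<close>

definition coins :: "(nat \<Rightarrow> bool) measure"
  where "coins = PiM UNIV (\<lambda>_. measure_pmf (bernoulli_pmf (1/2)))"

interpretation coin_factors: product_prob_space "\<lambda>_::nat. measure_pmf (bernoulli_pmf (1/2))" UNIV
  by unfold_locales

interpretation coins: prob_space coins
  unfolding coins_def by (rule coin_factors.P.prob_space_axioms)

definition wins :: "nat \<Rightarrow> (nat \<Rightarrow> bool) \<Rightarrow> nat set"
  where "wins n \<omega> = {i. i < n \<and> \<omega> i}"

lemma cylinder_coins:
  assumes "B \<subseteq> {..<n}"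
  shows "{\<omega>. wins n \<omega> = B} \<in> sets coins" "measure coins {\<omega>. wins n \<omega> = B} = (1/2)^n"
proof -
  have eq: "{\<omega>. wins n \<omega> = B} = prod_emb UNIV (\<lambda>_. measure_pmf (bernoulli_pmf (1/2))) {..<n} (Pi\<^sub>E {..<n} (\<lambda>i. {i \<in> B}))"
  proof (intro set_eqI iffI)
    fix \<omega> assume "\<omega> \<in> {\<omega>. wins n \<omega> = B}"
    then show "\<omega> \<in> prod_emb UNIV (\<lambda>_. measure_pmf (bernoulli_pmf (1/2))) {..<n} (Pi\<^sub>E {..<n} (\<lambda>i. {i \<in> B}))"
      by (auto simp: prod_emb_def wins_def PiE_iff)
  next
    fix \<omega> assume "\<omega> \<in> prod_emb UNIV (\<lambda>_. measure_pmf (bernoulli_pmf (1/2))) {..<n} (Pi\<^sub>E {..<n} (\<lambda>i. {i \<in> B}))"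
    then have "\<omega> i = (i \<in> B)" if "i < n" for i using that by (auto simp: prod_emb_def PiE_iff)
    then show "\<omega> \<in> {\<omega>. wins n \<omega> = B}" using assms by (auto simp: wins_def)
  qed
  show "{\<omega>. wins n \<omega> = B} \<in> sets coins"
    unfolding eq coins_def by (intro sets_PiM_I) auto
  have half: "measure (measure_pmf (bernoulli_pmf (1/2))) {b} = 1/2" for b
    by (cases b) (auto simp: measure_pmf_single)
  then show "measure coins {\<omega>. wins n \<omega> = B} = (1/2)^n"
    unfolding eq coins_def by (subst coin_factors.measure_PiM_emb) (auto simp: half power_divide)
qed

lemma
  shows sets_coins_wins: "{\<omega>. Q (wins n \<omega>)} \<in> sets coins"
    and measure_coins_wins: "measure coins {\<omega>. Q (wins n \<omega>)} = real (card {B. B \<subseteq> {..<n} \<and> Q B}) / 2^n"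
proof -
  let ?F = "{B. B \<subseteq> {..<n} \<and> Q B}"
  have fin: "finite ?F" by (rule finite_subset[of _ "Pow {..<n}"]) auto
  have eq: "{\<omega>. Q (wins n \<omega>)} = (\<Union>B\<in>?F. {\<omega>. wins n \<omega> = B})"
    by (auto simp: wins_def)
  show "{\<omega>. Q (wins n \<omega>)} \<in> sets coins"
    unfolding eq using fin by (intro sets.finite_UN cylinder_coins) auto
  have "measure coins {\<omega>. Q (wins n \<omega>)} = (\<Sum>B\<in>?F. measure coins {\<omega>. wins n \<omega> = B})"
    unfolding eq using fin cylinder_coins
    by (intro coins.finite_measure_finite_Union) (auto simp: disjoint_family_on_def)
  also have "\<dots> = (\<Sum>B\<in>?F. (1/2)^n)" using cylinder_coins by (intro sum.cong) auto
  finally show "measure coins {\<omega>. Q (wins n \<omega>)} = real (card ?F) / 2^n"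
    by (simp add: power_divide)
qed

definition heads :: "nat \<Rightarrow> (nat \<Rightarrow> bool) \<Rightarrow> nat"
  where "heads n \<omega> = card (wins n \<omega>)"

lemma heads_le: "heads n \<omega> \<le> n"
  unfolding heads_def wins_def by (rule order_trans[OF card_mono[of "{..<n}"]]) auto

lemma sets_coins_heads: "{\<omega>. Q (heads n \<omega>)} \<in> sets coins"
  unfolding heads_def by (rule sets_coins_wins)

text \<open>Independence of the increments is a bijection here: a subset of
  \<open>{..<n + m}\<close> is split into its parts below \<open>n\<close> and from \<open>n\<close>
  on.\<close>

lemma measure_coins_two_heads:
  "measure coins {\<omega>. heads n \<omega> = c \<and> heads (n + m) \<omega> = c + d} = bin_weight n c * bin_weight m d"
proof -
  let ?G = "{B. B \<subseteq> {..<n + m} \<and> card (B \<inter> {..<n}) = c \<and> card B = c + d}"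
  let ?G1 = "{B. B \<subseteq> {..<n} \<and> card B = c}" and ?G2 = "{B. B \<subseteq> {n..<n + m} \<and> card B = d}"
  have "wins n \<omega> = wins (n + m) \<omega> \<inter> {..<n}" for \<omega> by (auto simp: wins_def)
  then have "measure coins {\<omega>. heads n \<omega> = c \<and> heads (n + m) \<omega> = c + d} = real (card ?G) / 2^(n + m)"
    unfolding heads_def by (simp add: measure_coins_wins[symmetric])
  also have "card ?G = card (?G1 \<times> ?G2)"
  proof (rule bij_betw_same_card[of "\<lambda>B. (B \<inter> {..<n}, B \<inter> {n..<n + m})"])
    have split: "card B = card (B \<inter> {..<n}) + card (B \<inter> {n..<n + m})" if "B \<subseteq> {..<n + m}" for B
    proof -
      have "B = (B \<inter> {..<n}) \<union> (B \<inter> {n..<n + m})" using that by auto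
      then have "card B = card ((B \<inter> {..<n}) \<union> (B \<inter> {n..<n + m}))" by simp
      also have "\<dots> = card (B \<inter> {..<n}) + card (B \<inter> {n..<n + m})" by (intro card_Un_disjoint) auto
      finally show ?thesis .
    qed
    show "bij_betw (\<lambda>B. (B \<inter> {..<n}, B \<inter> {n..<n + m})) ?G (?G1 \<times> ?G2)"
    proof (rule bij_betw_byWitness[where f' = "\<lambda>(X, Y). X \<union> Y"])
      show "(\<lambda>B. (B \<inter> {..<n}, B \<inter> {n..<n + m})) ` ?G \<subseteq> ?G1 \<times> ?G2"
        using split by fastforce
      have eq: "(X \<union> Y) \<inter> {..<n} = X" "(X \<union> Y) \<inter> {n..<n + m} = Y"
        if "X \<subseteq> {..<n}" "Y \<subseteq> {n..<n + m}" for X Y using that by auto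
      have "X \<union> Y \<in> ?G" if "X \<in> ?G1" "Y \<in> ?G2" for X Y
      proof -
        have s: "X \<subseteq> {..<n}" "Y \<subseteq> {n..<n + m}" "X \<union> Y \<subseteq> {..<n + m}" using that by auto
        show ?thesis using that split[OF s(3)] eq[OF s(1,2)] s(3) by simp
      qed
      then show "(\<lambda>(X, Y). X \<union> Y) ` (?G1 \<times> ?G2) \<subseteq> ?G" by auto
    qed auto
  qed
  also have "\<dots> = (n choose c) * (m choose d)"
    using n_subsets[of "{..<n}" c] n_subsets[of "{n..<n + m}" d] by (simp add: card_cartesian_product)
  finally show ?thesis by (simp add: bin_weight_def power_add)
qed

lemma measure_coins_heads: "measure coins {\<omega>. heads n \<omega> = c} = bin_weight n c"
proof -
  have "heads 0 \<omega> = 0" for \<omega> by (simp add: heads_def wins_def)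
  then show ?thesis using measure_coins_two_heads[of 0 0 n c] by (simp add: bin_weight_def)
qed

definition bin_prob :: "nat \<Rightarrow> nat set \<Rightarrow> real"
  where "bin_prob n X = (\<Sum>c\<in>{..n} \<inter> X. bin_weight n c)"

lemma measure_coins_heads_set: "measure coins {\<omega>. heads n \<omega> \<in> X} = bin_prob n X"
proof -
  have "{\<omega>. heads n \<omega> \<in> X} = (\<Union>c\<in>{..n} \<inter> X. {\<omega>. heads n \<omega> = c})"
    using heads_le by auto
  also have "measure coins \<dots> = (\<Sum>c\<in>{..n} \<inter> X. measure coins {\<omega>. heads n \<omega> = c})"
    by (intro coins.finite_measure_finite_Union) (auto simp: disjoint_family_on_def intro: sets_coins_heads)
  finally show ?thesis by (simp add: bin_prob_def measure_coins_heads)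
qed

text \<open>The Markov property: given \<open>c\<close> heads after \<open>n\<close> tosses, the
  heads in the next \<open>m\<close> tosses form a fresh binomial variable, and \<open>B\<close>
  bounds its probability uniformly in \<open>c\<close>.\<close>

lemma measure_coins_two_heads_le:
  assumes B: "\<And>c. c \<in> X \<Longrightarrow> bin_prob m {d. c + d \<in> Y} \<le> B"
  shows "measure coins {\<omega>. heads n \<omega> \<in> X \<and> heads (n + m) \<omega> \<in> Y} \<le> measure coins {\<omega>. heads n \<omega> \<in> X} * B"
proof -
  let ?I = "SIGMA c:{..n} \<inter> X. {..m} \<inter> {d. c + d \<in> Y}"
  have mono: "heads n \<omega> \<le> heads (n + m) \<omega> \<and> heads (n + m) \<omega> \<le> heads n \<omega> + m" for \<omega>
  proof
    show "heads n \<omega> \<le> heads (n + m) \<omega>"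
      unfolding heads_def wins_def by (intro card_mono) auto
    have "wins (n + m) \<omega> \<subseteq> wins n \<omega> \<union> {n..<n + m}" by (auto simp: wins_def)
    then have "heads (n + m) \<omega> \<le> card (wins n \<omega> \<union> {n..<n + m})"
      unfolding heads_def by (intro card_mono) (auto simp: wins_def)
    also have "\<dots> \<le> card (wins n \<omega>) + card {n..<n + m}" by (rule card_Un_le)
    finally show "heads (n + m) \<omega> \<le> heads n \<omega> + m" by (simp add: heads_def)
  qed
  have "{\<omega>. heads n \<omega> \<in> X \<and> heads (n + m) \<omega> \<in> Y}
      = (\<Union>p\<in>?I. {\<omega>. heads n \<omega> = fst p \<and> heads (n + m) \<omega> = fst p + snd p})" (is "?L = ?R")
  proof (intro equalityI subsetI)
    fix \<omega> assume w: "\<omega> \<in> ?L"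
    have "(heads n \<omega>, heads (n + m) \<omega> - heads n \<omega>) \<in> ?I"
      using w mono[of \<omega>] heads_le[of n \<omega>] by auto
    then show "\<omega> \<in> ?R" using mono[of \<omega>] by (intro UN_I) auto
  qed auto
  also have "measure coins \<dots> = (\<Sum>p\<in>?I. measure coins {\<omega>. heads n \<omega> = fst p \<and> heads (n + m) \<omega> = fst p + snd p})"
  proof (intro coins.finite_measure_finite_Union)
    have "{\<omega>. heads n \<omega> = c \<and> heads (n + m) \<omega> = d} \<in> sets coins" for c d
      unfolding Collect_conj_eq by (intro sets.Int sets_coins_heads)
    then show "(\<lambda>p. {\<omega>. heads n \<omega> = fst p \<and> heads (n + m) \<omega> = fst p + snd p}) ` ?I \<subseteq> sets coins"
      by blast
    show "disjoint_family_on (\<lambda>p. {\<omega>. heads n \<omega> = fst p \<and> heads (n + m) \<omega> = fst p + snd p}) ?I"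
      unfolding disjoint_family_on_def by (auto simp del: SigmaE2)
    show "finite ?I" by (intro finite_SigmaI) auto
  qed
  also have "\<dots> = (\<Sum>(c, d)\<in>?I. bin_weight n c * bin_weight m d)"
    by (simp add: measure_coins_two_heads case_prod_beta)
  also have "\<dots> = (\<Sum>c\<in>{..n} \<inter> X. bin_weight n c * bin_prob m {d. c + d \<in> Y})"
    by (simp add: sum.Sigma[symmetric] bin_prob_def sum_distrib_left)
  also have "\<dots> \<le> (\<Sum>c\<in>{..n} \<inter> X. bin_weight n c * B)"
    using B by (intro sum_mono mult_left_mono bin_weight_nonneg) auto
  also have "\<dots> = measure coins {\<omega>. heads n \<omega> \<in> X} * B"
    by (simp add: measure_coins_heads_set bin_prob_def sum_distrib_right)
  finally show ?thesis .
qed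

section \<open>Coin tosses as Reality's moves, and Ville's inequality\<close>

definition coin_path :: "(nat \<Rightarrow> bool) \<Rightarrow> nat \<Rightarrow> real"
  where "coin_path \<omega> i = (if \<omega> i then 1 else -1)"

lemma coin_path_in_paths: "coin_path \<omega> \<in> paths"
  by (simp add: paths_def coin_path_def)

lemma S_coin_path: "S (coin_path \<omega>) n = 2 * real (heads n \<omega>) - real n"
proof -
  have "S (coin_path \<omega>) n = (\<Sum>i<n. 2 * (if \<omega> i then 1 else 0) - 1)"
    unfolding S_def by (intro sum.cong) (auto simp: coin_path_def)
  also have "\<dots> = 2 * (\<Sum>i<n. if \<omega> i then 1 else 0) - real n"
    by (simp add: sum_subtractf sum_distrib_left)
  also have "(\<Sum>i<n. if \<omega> i then 1 else (0::real)) = real (heads n \<omega>)"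
  proof -
    have "{..<n} \<inter> {i. \<omega> i} = wins n \<omega>" by (auto simp: wins_def)
    then show ?thesis by (simp add: sum.If_cases heads_def)
  qed
  finally show ?thesis .
qed

lemma A_coin_path: "A (coin_path \<omega>) n = sqrt (real n)"
proof -
  have "(coin_path \<omega> i)\<^sup>2 = 1" for i by (simp add: coin_path_def)
  then show ?thesis by (simp add: A_def)
qed

lemma capital_coin_path_wins:
  "i \<le> n \<Longrightarrow> capital K \<sigma> (coin_path \<omega>) i = capital K \<sigma> (coin_path (\<lambda>j. j \<in> wins n \<omega>)) i"
  by (intro capital_cong) (auto simp: coin_path_def wins_def)

text \<open>The capital is a martingale under fair coins: the two continuations of a history average
  to the present capital, so the mean stays 1.\<close>

lemma sum_capital_coin_path:
  "(\<Sum>B\<in>Pow {..<n}. capital 1 \<sigma> (coin_path (\<lambda>j. j \<in> B)) n) = 2^n"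
proof (induction n)
  case (Suc n)
  let ?c = "\<lambda>B. capital 1 \<sigma> (coin_path (\<lambda>j. j \<in> B))"
  have inj: "inj_on (insert n) (Pow {..<n})"
    by (rule inj_onI) (metis PowD insert_ident lessThan_iff order_less_irrefl subsetD)
  have ins: "?c (insert n B) (Suc n) + ?c B (Suc n) = 2 * ?c B n" if "B \<subseteq> {..<n}" for B
  proof -
    have agree: "coin_path (\<lambda>j. j \<in> insert n B) i = coin_path (\<lambda>j. j \<in> B) i" if "i < n" for i
      using that by (simp add: coin_path_def)
    have "?c (insert n B) n = ?c B n" by (rule capital_cong) (rule agree)
    moreover have "map (coin_path (\<lambda>j. j \<in> insert n B)) [0..<n] = map (coin_path (\<lambda>j. j \<in> B)) [0..<n]"
      using agree by (intro map_cong) auto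
    moreover have "n \<notin> B" using that by auto
    ultimately show ?thesis by (simp add: coin_path_def del: map_eq_conv)
  qed
  have "(\<Sum>B\<in>Pow {..<Suc n}. ?c B (Suc n))
      = (\<Sum>B\<in>Pow {..<n}. ?c B (Suc n)) + (\<Sum>B\<in>insert n ` Pow {..<n}. ?c B (Suc n))"
    unfolding lessThan_Suc Pow_insert by (rule sum.union_disjoint) auto
  also have "(\<Sum>B\<in>insert n ` Pow {..<n}. ?c B (Suc n)) = (\<Sum>B\<in>Pow {..<n}. ?c (insert n B) (Suc n))"
    by (subst sum.reindex[OF inj]) simp
  also have "(\<Sum>B\<in>Pow {..<n}. ?c B (Suc n)) + (\<Sum>B\<in>Pow {..<n}. ?c (insert n B) (Suc n))
      = (\<Sum>B\<in>Pow {..<n}. 2 * ?c B n)"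
    unfolding sum.distrib[symmetric]
    by (rule sum.cong[OF refl], subst add.commute, rule ins) (rule PowD)
  also have "\<dots> = 2^Suc n" unfolding sum_distrib_left[symmetric] Suc by simp
  finally show ?case .
qed (simp add: coin_path_def)

text \<open>On the event the stopped capital is at least \<open>C\<close> after \<open>n\<close>
  rounds, elsewhere it is nonnegative, and its mean is 1. Hence Markov's inequality controls the
  maximum over all rounds up to \<open>n\<close>.\<close>

lemma ville_finite:
  assumes nonneg: "\<And>x n. x \<in> paths \<Longrightarrow> capital 1 \<sigma> x n \<ge> 0" and C: "C > 0"
  shows "measure coins {\<omega>. \<exists>i\<le>n. capital 1 \<sigma> (coin_path \<omega>) i \<ge> C} \<le> 1 / C"
    and "{\<omega>. \<exists>i\<le>n. capital 1 \<sigma> (coin_path \<omega>) i \<ge> C} \<in> sets coins"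
proof -
  let ?Q = "\<lambda>B. \<exists>i\<le>n. capital 1 \<sigma> (coin_path (\<lambda>j. j \<in> B)) i \<ge> C"
  let ?F = "{B. B \<subseteq> {..<n} \<and> ?Q B}"
  have eq: "{\<omega>. \<exists>i\<le>n. capital 1 \<sigma> (coin_path \<omega>) i \<ge> C} = {\<omega>. ?Q (wins n \<omega>)}"
  proof (intro Collect_cong ex_cong1 conj_cong refl)
    fix \<omega> i assume i: "i \<le> n"
    then show "(C \<le> capital 1 \<sigma> (coin_path \<omega>) i) = (C \<le> capital 1 \<sigma> (coin_path (\<lambda>j. j \<in> wins n \<omega>)) i)"
      by (subst capital_coin_path_wins[OF i]) (rule refl)
  qed
  show "{\<omega>. \<exists>i\<le>n. capital 1 \<sigma> (coin_path \<omega>) i \<ge> C} \<in> sets coins"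
    unfolding eq by (rule sets_coins_wins[of ?Q n])
  have ge: "capital 1 (stopped \<sigma> C) (coin_path (\<lambda>j. j \<in> B)) n \<ge> (if ?Q B then C else 0)" for B
  proof (cases "?Q B")
    case True
    then have "\<not> (\<forall>i<n. capital 1 \<sigma> (coin_path (\<lambda>j. j \<in> B)) i < C) \<or>
        C \<le> capital 1 \<sigma> (coin_path (\<lambda>j. j \<in> B)) n"
      by (auto simp: not_less le_less)
    then show ?thesis using True capital_stopped[of \<sigma> C "coin_path (\<lambda>j. j \<in> B)" n] by auto
  next
    case False
    then show ?thesis
      using capital_stopped[of \<sigma> C "coin_path (\<lambda>j. j \<in> B)" n] nonneg[OF coin_path_in_paths] by auto
  qed
  have "C * real (card ?F) = (\<Sum>B\<in>Pow {..<n}. if ?Q B then C else 0)"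
  proof -
    have "Pow {..<n} \<inter> {B. ?Q B} = ?F" by auto
    then show ?thesis by (simp add: sum.If_cases)
  qed
  also have "\<dots> \<le> (\<Sum>B\<in>Pow {..<n}. capital 1 (stopped \<sigma> C) (coin_path (\<lambda>j. j \<in> B)) n)"
    by (rule sum_mono) (rule ge)
  also have "\<dots> = 2^n" by (rule sum_capital_coin_path)
  finally show "measure coins {\<omega>. \<exists>i\<le>n. capital 1 \<sigma> (coin_path \<omega>) i \<ge> C} \<le> 1 / C"
    unfolding eq measure_coins_wins[of ?Q n] using C by (simp add: field_simps)
qed

lemma ville:
  assumes nonneg: "\<And>x n. x \<in> paths \<Longrightarrow> capital 1 \<sigma> x n \<ge> 0" and C: "C > 0"
  shows "measure coins {\<omega>. \<exists>i. capital 1 \<sigma> (coin_path \<omega>) i \<ge> C} \<le> 1 / C"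
    and "{\<omega>. \<exists>i. capital 1 \<sigma> (coin_path \<omega>) i \<ge> C} \<in> sets coins"
proof -
  let ?V = "\<lambda>n. {\<omega>. \<exists>i\<le>n. capital 1 \<sigma> (coin_path \<omega>) i \<ge> C}"
  have eq: "{\<omega>. \<exists>i. capital 1 \<sigma> (coin_path \<omega>) i \<ge> C} = (\<Union>n. ?V n)" by auto
  show "{\<omega>. \<exists>i. capital 1 \<sigma> (coin_path \<omega>) i \<ge> C} \<in> sets coins"
    unfolding eq using ville_finite(2)[OF assms] by blast
  have "(\<lambda>n. measure coins (?V n)) \<longlonglongrightarrow> measure coins (\<Union>n. ?V n)"
    using ville_finite(2)[OF assms]
    by (intro coins.finite_Lim_measure_incseq) (auto simp: incseq_def, meson order_trans)
  then show "measure coins {\<omega>. \<exists>i. capital 1 \<sigma> (coin_path \<omega>) i \<ge> C} \<le> 1 / C"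
    unfolding eq using ville_finite(1)[OF assms] by (intro tendsto_upperbound) auto
qed

text \<open>Second moment method, with \<open>X\<close> counting the events that occur.
  Cauchy-Schwarz appears as the pointwise bound \<open>X \<le> (s / B * X^2 + B / s) / 2\<close> on
  the union; the weight \<open>s / B\<close> makes the first part integrate to at most
  \<open>s / 2\<close>.\<close>

lemma (in prob_space) kochen_stone:
  assumes fin: "finite I" and E: "\<And>i. i \<in> I \<Longrightarrow> E i \<in> events"
    and B: "(\<Sum>i\<in>I. \<Sum>j\<in>I. prob (E i \<inter> E j)) \<le> B" "B > 0"
  shows "prob (\<Union>i\<in>I. E i) \<ge> (\<Sum>i\<in>I. prob (E i))\<^sup>2 / B"
proof -
  define s where "s = (\<Sum>i\<in>I. prob (E i))"
  define X where "X \<omega> = (\<Sum>i\<in>I. indicator (E i) \<omega> :: real)" for \<omega>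
  let ?U = "\<Union>i\<in>I. E i"
  have U: "?U \<in> events" using fin E by auto
  have s0: "s \<ge> 0" by (simp add: s_def sum_nonneg)
  have X2: "(X \<omega>)\<^sup>2 = (\<Sum>i\<in>I. \<Sum>j\<in>I. indicator (E i \<inter> E j) \<omega>)" for \<omega>
    by (simp add: X_def power2_eq_square sum_product indicator_inter_arith)
  have point: "X \<omega> \<le> (s / B * (X \<omega>)\<^sup>2 + B / s * indicator ?U \<omega>) / 2" if "s > 0" for \<omega>
  proof (cases "\<omega> \<in> ?U")
    case True
    have "0 \<le> (s / B * X \<omega> - 1)\<^sup>2 * (B / s)" using that B by simp
    also have "\<dots> = s / B * (X \<omega>)\<^sup>2 + B / s - 2 * X \<omega>"
      using that B by (simp add: power2_eq_square field_simps)
    finally show ?thesis using True by simp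
  next
    case False
    then have "X \<omega> = 0" by (auto simp: X_def)
    then show ?thesis using False by simp
  qed
  show ?thesis
  proof (cases "s > 0")
    case True
    have int: "integrable M (\<lambda>\<omega>. indicator (E i \<inter> E j) \<omega> :: real)" if "i \<in> I" "j \<in> I" for i j
      using E that by (intro integrable_real_indicator) (auto simp: emeasure_eq_measure)
    have int1: "integrable M (\<lambda>\<omega>. indicator (E i) \<omega> :: real)" if "i \<in> I" for i
      using E that by (intro integrable_real_indicator) (auto simp: emeasure_eq_measure)
    have intX: "integrable M X" unfolding X_def[abs_def] using int1 by auto
    have intX2: "integrable M (\<lambda>\<omega>. (X \<omega>)\<^sup>2)" unfolding X2 using int by auto
    have intU: "integrable M (\<lambda>\<omega>. indicator ?U \<omega> :: real)"
      using U by (intro integrable_real_indicator) (auto simp: emeasure_eq_measure)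
    have "s = (\<integral>\<omega>. X \<omega> \<partial>M)"
      unfolding X_def s_def using int1 E by (subst Bochner_Integration.integral_sum) auto
    also have "\<dots> \<le> (\<integral>\<omega>. (s / B * (X \<omega>)\<^sup>2 + B / s * indicator ?U \<omega>) / 2 \<partial>M)"
      using point[OF True] intX intX2 intU by (intro integral_mono) auto
    also have "\<dots> = (s / B * (\<integral>\<omega>. (X \<omega>)\<^sup>2 \<partial>M) + B / s * prob ?U) / 2"
      using intX2 intU U by simp
    also have "(\<integral>\<omega>. (X \<omega>)\<^sup>2 \<partial>M) = (\<Sum>i\<in>I. \<Sum>j\<in>I. prob (E i \<inter> E j))"
      unfolding X2 using int E by (simp add: Bochner_Integration.integral_sum)
    also have "(s / B * \<dots> + B / s * prob ?U) / 2 \<le> (s / B * B + B / s * prob ?U) / 2"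
      using B True by (intro divide_right_mono add_right_mono mult_left_mono) auto
    also have "\<dots> = s / 2 + B / s * prob ?U / 2" using B by (simp add: add_divide_distrib)
    finally have "s \<le> B / s * prob ?U" by simp
    then show ?thesis using True B unfolding s_def[symmetric] by (simp add: field_simps power2_eq_square)
  next
    case False
    then have "s = 0" using s0 by simp
    then show ?thesis by (simp add: s_def[symmetric])
  qed
qed

section \<open>Moderate deviations of the coin-tossing walk\<close>

lemma
  fixes x w :: real
  assumes "w \<ge> 0"
  shows finite_nat_window: "finite {c::nat. x < real c \<and> real c \<le> x + w}"
    and card_nat_window_upper: "real (card {c::nat. x < real c \<and> real c \<le> x + w}) \<le> w + 1"
    and card_nat_window_lower: "x \<ge> 0 \<Longrightarrow> w - 1 \<le> real (card {c::nat. x < real c \<and> real c \<le> x + w})"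
proof -
  let ?W = "{c::nat. x < real c \<and> real c \<le> x + w}" and ?J = "{\<lfloor>x\<rfloor> + 1..\<lfloor>x + w\<rfloor>}"
  have sub: "?W \<subseteq> nat ` ?J"
  proof
    fix c assume "c \<in> ?W"
    then have "int c \<in> ?J" by (auto simp: le_floor_iff floor_less_iff zless_iff_Suc_zadd[symmetric] add1_zle_eq)
    then show "c \<in> nat ` ?J" by (metis imageI nat_int)
  qed
  then show fin: "finite ?W" by (rule finite_subset) auto
  have fl: "\<lfloor>x\<rfloor> \<le> \<lfloor>x + w\<rfloor>" using assms by (intro floor_mono) auto
  have "card ?W \<le> card (nat ` ?J)" using sub by (intro card_mono) auto
  also have "\<dots> \<le> card ?J" by (rule card_image_le) auto
  finally have "real (card ?W) \<le> real_of_int (\<lfloor>x + w\<rfloor> - \<lfloor>x\<rfloor>)" using fl by simp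
  also have "\<dots> \<le> w + 1" by linarith
  finally show "real (card ?W) \<le> w + 1" .
  assume x: "x \<ge> 0"
  have "nat ` ?J \<subseteq> ?W"
  proof
    fix c assume "c \<in> nat ` ?J"
    then obtain i where i: "i \<in> ?J" "c = nat i" by auto
    have "\<lfloor>x\<rfloor> \<ge> 0" using x by simp
    moreover have "\<lfloor>x\<rfloor> + 1 \<le> i" using i by simp
    ultimately have "i \<ge> 0" by linarith
    then have "real c = of_int i" using i by simp
    then show "c \<in> ?W" using i by simp linarith
  qed
  then have "card (nat ` ?J) \<le> card ?W" using fin by (rule card_mono[rotated])
  moreover have "card (nat ` ?J) = card ?J"
  proof (intro card_image inj_onI)
    fix i j assume ij: "i \<in> ?J" "j \<in> ?J" "nat i = nat j"
    have "\<lfloor>x\<rfloor> \<ge> 0" using x by simp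
    moreover have "\<lfloor>x\<rfloor> + 1 \<le> i" "\<lfloor>x\<rfloor> + 1 \<le> j" using ij by simp_all
    ultimately have "0 \<le> i" "0 \<le> j" by linarith+
    then show "i = j" using ij by simp
  qed
  ultimately have "real_of_int (\<lfloor>x + w\<rfloor> - \<lfloor>x\<rfloor>) \<le> real (card ?W)" using fl by simp
  then show "w - 1 \<le> real (card ?W)" by linarith
qed

text \<open>The Gaussian exponent \<open>- y^2 / m\<close> lies below its tangents
  \<open>- 2 * \<theta> * y + \<theta>^2 * m\<close>. For \<open>\<theta> \<ge> 0\<close> these are
  nonincreasing in \<open>y\<close>, so the left end \<open>d\<close> is the worst case, whatever
  its sign.\<close>

lemma bin_prob_window_upper:
  fixes d w \<theta> :: real
  assumes m: "m \<ge> 1" and w: "w \<ge> 0" and \<theta>: "\<theta> \<ge> 0"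
  shows "bin_prob (2*m) {c. d < real c - real m \<and> real c - real m \<le> d + w}
    \<le> (w + 1) * (2 / sqrt (real m)) * exp (- 2 * \<theta> * d + \<theta>\<^sup>2 * real m)"
proof -
  let ?e = "2 / sqrt (real m) * exp (- 2 * \<theta> * d + \<theta>\<^sup>2 * real m)"
  let ?W = "{c::nat. d + real m < real c \<and> real c \<le> (d + real m) + w}"
  have W: "{c. d < real c - real m \<and> real c - real m \<le> d + w} = ?W" by auto
  have "bin_prob (2*m) ?W \<le> (\<Sum>c\<in>?W. bin_weight (2*m) c)"
    unfolding bin_prob_def using finite_nat_window[OF w] bin_weight_nonneg by (intro sum_mono2) auto
  also have "\<dots> \<le> (\<Sum>c\<in>?W. ?e)"
  proof (rule sum_mono)
    fix c assume c: "c \<in> ?W"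
    define y where "y = real c - real m"
    have y: "d \<le> y" using c by (simp add: y_def)
    have "0 \<le> (y - \<theta> * real m)\<^sup>2 / real m" by simp
    also have "\<dots> = y\<^sup>2 / real m - 2 * \<theta> * y + \<theta>\<^sup>2 * real m"
      using m by (simp add: power2_eq_square field_simps)
    finally have "- y\<^sup>2 / real m \<le> - 2 * \<theta> * y + \<theta>\<^sup>2 * real m" by simp
    also have "\<dots> \<le> - 2 * \<theta> * d + \<theta>\<^sup>2 * real m" using mult_left_mono[OF y \<theta>] by simp
    finally have "exp (- y\<^sup>2 / real m) \<le> exp (- 2 * \<theta> * d + \<theta>\<^sup>2 * real m)" by simp
    then have "2 / sqrt (real m) * exp (- y\<^sup>2 / real m) \<le> ?e" by (intro mult_left_mono) auto
    then show "bin_weight (2*m) c \<le> ?e" using bin_weight_upper[OF m, of c] by (simp add: y_def)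
  qed
  also have "\<dots> = real (card ?W) * ?e" by simp
  also have "\<dots> \<le> (w + 1) * ?e" by (intro mult_right_mono card_nat_window_upper[OF w]) auto
  finally show ?thesis unfolding W by (simp only: mult.assoc)
qed

definition level :: "nat \<Rightarrow> real \<Rightarrow> real"
  where "level m a = a * sqrt (real m / 2)"

definition width :: "nat \<Rightarrow> real \<Rightarrow> real"
  where "width m a = sqrt (real m / 2) / a"

text \<open>The upper end is there for pairs: it limits how far the walk may be at the earlier hit.
  Its distance \<open>width\<close> is the scale on which the tail decays, so only a constant factor
  of probability is lost.\<close>

definition window :: "nat \<Rightarrow> real \<Rightarrow> nat set"
  where "window m a = {c. level m a < real c - real m \<and> real c - real m \<le> level m a + width m a}"

text \<open>The number of heads \<open>c\<close> after \<open>2 m\<close> tosses corresponds to the value \<open>2 (c - m)\<close> of the walk,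
  so that this is the event \<open>a < S / sqrt n \<le> a + 1 / a\<close> at time \<open>n = 2 m\<close>.\<close>

definition hit :: "nat \<Rightarrow> real \<Rightarrow> (nat \<Rightarrow> bool) set"
  where "hit m a = {\<omega>. heads (2*m) \<omega> \<in> window m a}"

lemma sets_hit: "hit m a \<in> sets coins"
  unfolding hit_def by (rule sets_coins_heads)

lemma S_gt_if_hit:
  assumes "\<omega> \<in> hit m a"
  shows "S (coin_path \<omega>) (2*m) > A (coin_path \<omega>) (2*m) * a"
proof -
  have "a * sqrt (real m / 2) < real (heads (2*m) \<omega>) - real m"
    using assms by (simp add: hit_def window_def level_def)
  moreover have "sqrt (real (2*m)) = 2 * sqrt (real m / 2)"
  proof -
    have "sqrt (real (2*m)) = sqrt (2^2 * (real m / 2))" by simp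
    also have "\<dots> = 2 * sqrt (real m / 2)" by (simp only: real_sqrt_mult real_sqrt_abs abs_numeral)
    finally show ?thesis .
  qed
  ultimately show ?thesis unfolding S_coin_path A_coin_path by simp (simp add: algebra_simps)
qed

text \<open>At the earlier hit the excess of heads is at most \<open>level m a + width m a\<close>,
  and the later tosses must make up the difference to \<open>level m' b\<close>. The tilt \<theta>
  is left open, because close and distant pairs need different choices.\<close>

lemma prob_two_hits:
  assumes m: "m < m'" and a: "a > 0" "b > 0" and \<theta>: "\<theta> \<ge> 0"
  shows "measure coins (hit m a \<inter> hit m' b) \<le> measure coins (hit m a) *
    ((width m' b + 1) * (2 / sqrt (real (m' - m))) *
      exp (- 2 * \<theta> * (level m' b - level m a - width m a) + \<theta>\<^sup>2 * real (m' - m)))"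
proof -
  let ?B = "(width m' b + 1) * (2 / sqrt (real (m' - m))) *
      exp (- 2 * \<theta> * (level m' b - level m a - width m a) + \<theta>\<^sup>2 * real (m' - m))"
  have w: "width m' b \<ge> 0" using a by (simp add: width_def)
  have "bin_prob (2 * (m' - m)) {d. c + d \<in> window m' b} \<le> ?B" if c: "c \<in> window m a" for c
  proof -
    define d where "d = level m' b - (real c - real m)"
    have eq: "{d. c + d \<in> window m' b} =
        {e. d < real e - real (m' - m) \<and> real e - real (m' - m) \<le> d + width m' b}"
      using m by (auto simp: window_def d_def of_nat_diff)
    have "bin_prob (2 * (m' - m)) {d. c + d \<in> window m' b}
        \<le> (width m' b + 1) * (2 / sqrt (real (m' - m))) * exp (- 2 * \<theta> * d + \<theta>\<^sup>2 * real (m' - m))"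
      unfolding eq using m w \<theta> by (intro bin_prob_window_upper) auto
    also have "\<dots> \<le> ?B"
    proof -
      have "level m' b - level m a - width m a \<le> d" using c by (simp add: d_def window_def)
      from mult_left_mono[OF this \<theta>]
      have "- 2 * \<theta> * d + \<theta>\<^sup>2 * real (m' - m)
          \<le> - 2 * \<theta> * (level m' b - level m a - width m a) + \<theta>\<^sup>2 * real (m' - m)" by simp
      then show ?thesis using w by (intro mult_left_mono) auto
    qed
    finally show ?thesis .
  qed
  from measure_coins_two_heads_le[of "window m a" "2 * (m' - m)" "window m' b" ?B "2*m", OF this]
  have "measure coins {\<omega>. heads (2*m) \<omega> \<in> window m a \<and> heads (2*m + 2*(m' - m)) \<omega> \<in> window m' b}
    \<le> measure coins {\<omega>. heads (2*m) \<omega> \<in> window m a} * ?B" by simp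
  moreover have "2*m + 2*(m' - m) = 2 * m'" using m by simp
  ultimately show ?thesis by (simp add: hit_def Collect_conj_eq)
qed

text \<open>No factor of the later tail is kept, only the decay in \<open>r\<close>. The condition
  \<open>gap\<close> bounds \<open>width m' b\<close> by a multiple of the standard deviation of the
  increment, which gives the prefactor 5; the window of the earlier hit costs a further
  \<open>exp (1/2) \<le> 2\<close>.\<close>

lemma prob_two_hits_near:
  assumes m: "0 < m" "m < m'" and a: "0 < a" "a \<le> b" and gap: "real m' \<le> 4 * b\<^sup>2 * real (m' - m)"
    and r: "r = sqrt (real m' / real m)"
  shows "measure coins (hit m a \<inter> hit m' b) \<le>
    measure coins (hit m a) * (10 * exp (- a\<^sup>2 * (r - 1) / (2 * (r + 1))))"
proof -
  define s where "s = sqrt (real m / 2)"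
  have s: "s > 0" "s\<^sup>2 = real m / 2" using m by (auto simp: s_def)
  have r1: "r > 1" using m by (simp add: r)
  have r2: "r\<^sup>2 = real m' / real m" using m by (simp add: r)
  have sr: "sqrt (real m' / 2) = s * r"
    unfolding s_def r real_sqrt_mult[symmetric] using m by simp
  define al where "al = 1 / (r + 1)"
  have al: "0 < al" "al \<le> 1/2" using r1 by (auto simp: al_def field_simps)
  \<comment> \<open>The minimizer of \<open>- 2 * \<theta> * a * s * (r - 1) + 2 * \<theta>^2 * s^2
    * (r^2 - 1)\<close>, the exponent without the window width and with \<open>b\<close> replaced by
    \<open>a\<close>.\<close>
  define \<theta> where "\<theta> = al * a / (2 * s)"
  have \<theta>: "\<theta> \<ge> 0" using al a s by (simp add: \<theta>_def)
  have diff: "real (m' - m) = 2 * s\<^sup>2 * (r\<^sup>2 - 1)" using m by (simp add: r2 s of_nat_diff field_simps)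
  have "2 * \<theta> * (level m' b - level m a - width m a) \<ge> al * a\<^sup>2 * (r - 1) - al"
  proof -
    have "level m' b \<ge> a * (s * r)" unfolding level_def sr using a s r1 by (intro mult_right_mono) auto
    then have "level m' b - level m a - width m a \<ge> a * (s * r) - a * s - s / a"
      by (simp add: level_def width_def s_def)
    from mult_left_mono[OF this, of "2 * \<theta>"] \<theta>
    have "2 * \<theta> * (level m' b - level m a - width m a) \<ge> 2 * \<theta> * (a * (s * r) - a * s - s / a)" by simp
    also have "2 * \<theta> * (a * (s * r) - a * s - s / a) = al * a\<^sup>2 * (r - 1) - al"
      using s a by (simp add: \<theta>_def power2_eq_square field_simps)
    finally show ?thesis .
  qed
  moreover have "\<theta>\<^sup>2 * real (m' - m) = al * a\<^sup>2 * (r - 1) / 2"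
  proof -
    have "\<theta>\<^sup>2 * real (m' - m) = al\<^sup>2 * a\<^sup>2 * (r\<^sup>2 - 1) / 2"
      unfolding diff using s(1) by (simp add: \<theta>_def power2_eq_square)
    also have "al\<^sup>2 * (r\<^sup>2 - 1) = al * (r - 1)"
      using r1 by (simp add: al_def power2_eq_square divide_simps) (simp add: algebra_simps)
    then have "al\<^sup>2 * a\<^sup>2 * (r\<^sup>2 - 1) / 2 = al * a\<^sup>2 * (r - 1) / 2" by (simp add: mult_ac)
    finally show ?thesis .
  qed
  ultimately have "- 2 * \<theta> * (level m' b - level m a - width m a) + \<theta>\<^sup>2 * real (m' - m)
      \<le> 1/2 + - (al * a\<^sup>2 * (r - 1)) / 2" using al by simp
  also have "- (al * a\<^sup>2 * (r - 1)) / 2 = - a\<^sup>2 * (r - 1) / (2 * (r + 1))" by (simp add: al_def)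
  finally have "exp (- 2 * \<theta> * (level m' b - level m a - width m a) + \<theta>\<^sup>2 * real (m' - m))
      \<le> exp (1/2) * exp (- a\<^sup>2 * (r - 1) / (2 * (r + 1)))"
    unfolding exp_add[symmetric] by (rule iffD2[OF exp_le_cancel_iff])
  also have "\<dots> \<le> 2 * exp (- a\<^sup>2 * (r - 1) / (2 * (r + 1)))"
    using exp_bound_half[of "1/2::real"] by (intro mult_right_mono) auto
  finally have e: "exp (- 2 * \<theta> * (level m' b - level m a - width m a) + \<theta>\<^sup>2 * real (m' - m))
      \<le> 2 * exp (- a\<^sup>2 * (r - 1) / (2 * (r + 1)))" .
  have pre: "(width m' b + 1) * (2 / sqrt (real (m' - m))) \<le> 5"
  proof -
    have d: "real (m' - m) \<ge> 1" using m by simp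
    have "real m' / 2 \<le> (sqrt 2 * b * sqrt (real (m' - m)))\<^sup>2"
      using gap d by (simp add: power_mult_distrib)
    then have "sqrt (real m' / 2) \<le> sqrt 2 * b * sqrt (real (m' - m))"
      using a d by (intro real_le_lsqrt) auto
    then have "width m' b \<le> sqrt 2 * sqrt (real (m' - m))" using a by (simp add: width_def field_simps)
    moreover have "sqrt 2 \<le> (3/2::real)" by (rule real_le_lsqrt) (auto simp: power2_eq_square)
    ultimately have "width m' b \<le> 3/2 * sqrt (real (m' - m))" using d
      by (smt (verit) mult_right_mono real_sqrt_ge_zero)
    moreover have "1 \<le> sqrt (real (m' - m))" using d by simp
    ultimately have "width m' b + 1 \<le> 5/2 * sqrt (real (m' - m))" by linarith
    then have "(width m' b + 1) * (2 / sqrt (real (m' - m))) \<le> 5/2 * sqrt (real (m' - m)) * (2 / sqrt (real (m' - m)))"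
      by (intro mult_right_mono) auto
    also have "\<dots> = 5" using d by simp
    finally show ?thesis .
  qed
  have w: "width m' b \<ge> 0" using a by (simp add: width_def)
  have "(width m' b + 1) * (2 / sqrt (real (m' - m))) *
      exp (- 2 * \<theta> * (level m' b - level m a - width m a) + \<theta>\<^sup>2 * real (m' - m))
      \<le> 5 * (2 * exp (- a\<^sup>2 * (r - 1) / (2 * (r + 1))))"
    using pre e w by (intro mult_mono) auto
  from mult_left_mono[OF this, of "measure coins (hit m a)"] prob_two_hits[OF m(2) a(1) _ \<theta>, of b] a
  show ?thesis by simp
qed

text \<open>The tilt is the one for a walk starting at 0, so that the later tail
  \<open>exp (- b^2 / 2) / b\<close> reappears. The position at the earlier hit enters only through
  the factor \<open>exp D\<close>.\<close>

lemma prob_two_hits_far: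
  assumes m: "0 < m" "2 * m \<le> m'" and a: "1 \<le> a" "1 \<le> b" and bm: "b\<^sup>2 \<le> real m'"
    and D: "2 * a * b * sqrt (real m / real m') \<le> D"
  shows "measure coins (hit m a \<inter> hit m' b) \<le>
    measure coins (hit m a) * (5 * exp D * (exp (- b\<^sup>2 / 2) / b))"
proof -
  define t where "t = sqrt (real m' / 2)"
  have t: "t > 0" "t\<^sup>2 = real m' / 2" using m by (auto simp: t_def)
  define \<theta> where "\<theta> = b / (2 * t)"
  have \<theta>: "\<theta> \<ge> 0" using a t by (simp add: \<theta>_def)
  define q where "q = sqrt (real m / real m')"
  have qt: "sqrt (real m / 2) = t * q"
    unfolding t_def q_def real_sqrt_mult[symmetric] using m by simp
  have "2 * \<theta> * level m' b = b\<^sup>2" using t by (simp add: \<theta>_def level_def t_def[symmetric] power2_eq_square)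
  moreover have "2 * \<theta> * (level m a + width m a) \<le> D"
  proof -
    have "1 / a \<le> a" using a mult_mono[of 1 a 1 a] by (simp add: divide_le_eq)
    have "2 * \<theta> * (level m a + width m a) = b * q * (a + 1 / a)"
      using t a by (simp add: \<theta>_def level_def width_def qt field_simps)
    also have "\<dots> \<le> b * q * (a + a)" using \<open>1 / a \<le> a\<close> a by (intro mult_left_mono) (auto simp: q_def)
    also have "\<dots> \<le> D" using D by (simp add: q_def mult_ac)
    finally show ?thesis .
  qed
  moreover have "\<theta>\<^sup>2 * real (m' - m) \<le> b\<^sup>2 / 2"
  proof -
    have "\<theta>\<^sup>2 * real (m' - m) \<le> \<theta>\<^sup>2 * (2 * t\<^sup>2)" using t by (intro mult_left_mono) auto
    also have "\<dots> = b\<^sup>2 / 2" using t(1) by (simp add: \<theta>_def power2_eq_square)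
    finally show ?thesis .
  qed
  ultimately have "- 2 * \<theta> * (level m' b - level m a - width m a) + \<theta>\<^sup>2 * real (m' - m) \<le> D + - b\<^sup>2 / 2"
    by (simp add: algebra_simps)
  then have e: "exp (- 2 * \<theta> * (level m' b - level m a - width m a) + \<theta>\<^sup>2 * real (m' - m))
      \<le> exp D * exp (- b\<^sup>2 / 2)"
    unfolding exp_add[symmetric] by (rule iffD2[OF exp_le_cancel_iff])
  have pre: "(width m' b + 1) * (2 / sqrt (real (m' - m))) \<le> 5 / b"
  proof -
    have "t \<le> sqrt (real (m' - m))" unfolding t_def using m by (simp add: of_nat_diff)
    then have "(width m' b + 1) * (2 / sqrt (real (m' - m))) \<le> (width m' b + 1) * (2 / t)"
      using t a m by (intro mult_left_mono divide_left_mono mult_pos_pos) (auto simp: width_def)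
    also have "\<dots> = 2 / b + 2 / t" using t a by (simp add: width_def t_def[symmetric] field_simps)
    \<comment> \<open>This term stems from the \<open>+ 1\<close> in the count of lattice points;
      \<open>b^2 \<le> m'\<close> keeps it of order \<open>1 / b\<close>.\<close>
    also have "2 / t \<le> 3 / b"
    proof -
      have "b\<^sup>2 \<le> (3/2 * t)\<^sup>2" using bm by (simp add: power_mult_distrib power_divide t(2))
      then have "b \<le> 3/2 * t" using t by (rule_tac power2_le_imp_le) auto
      then show ?thesis using t a by (simp add: field_simps)
    qed
    finally show ?thesis by simp
  qed
  have w: "width m' b \<ge> 0" using a by (simp add: width_def)
  have "(width m' b + 1) * (2 / sqrt (real (m' - m))) *
      exp (- 2 * \<theta> * (level m' b - level m a - width m a) + \<theta>\<^sup>2 * real (m' - m))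
      \<le> 5 / b * (exp D * exp (- b\<^sup>2 / 2))"
    using pre e w a by (intro mult_mono) auto
  from mult_left_mono[OF this, of "measure coins (hit m a)"] prob_two_hits[of m m' a b \<theta>] m a \<theta>
  show ?thesis by simp
qed

text \<open>The window holds at least \<open>width m a / 2\<close> integers, each of weight at least
  \<open>e\<close>. In the exponent \<open>(a + 1 / a)^2 / 2 \<le> a^2 / 2 + 3/2\<close>, and the
  quartic correction is at most 1, together \<open>5/2\<close>. The constant 8 ensures
  \<open>width m a \<ge> 2 * a\<close>.\<close>

lemma prob_hit_lower:
  assumes a: "a \<ge> 1" and m: "8 * a^4 \<le> real m"
  shows "measure coins (hit m a) \<ge> exp (-5/2) / 6 * (exp (- a\<^sup>2 / 2) / a)"
proof -
  have a2: "1 \<le> a\<^sup>2" using a by simp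
  have a24: "a\<^sup>2 \<le> a^4" using a by (intro power_increasing) auto
  have m8: "8 * a\<^sup>2 \<le> real m" using m a24 by linarith
  have m1: "m \<ge> 1" using m8 a2 by linarith
  define t where "t = sqrt (real m / 2)"
  have t: "t > 0" "t\<^sup>2 = real m / 2" using m1 by (auto simp: t_def)
  have "(2 * a\<^sup>2)\<^sup>2 = 4 * a^4" by (simp add: power_mult_distrib power_mult[symmetric])
  then have "(2 * a\<^sup>2)\<^sup>2 \<le> t\<^sup>2" using m t(2) by linarith
  then have ta: "2 * a\<^sup>2 \<le> t" using less_imp_le[OF t(1)] by (rule power2_le_imp_le)
  have lv: "level m a = a * t" and wd: "width m a = t / a" by (simp_all add: level_def width_def t_def)
  have w2: "width m a \<ge> 2 * a" using ta a by (simp add: wd field_simps power2_eq_square)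
  have wl: "width m a \<le> level m a"
    using a t mult_mono[of 1 a 1 a] by (simp add: wd lv field_simps)
  let ?W = "{c::nat. level m a + real m < real c \<and> real c \<le> (level m a + real m) + width m a}"
  have W: "window m a = ?W" by (auto simp: window_def)
  have i2: "level m a + width m a \<le> real m / 2"
  proof -
    have "(2 * a * t)\<^sup>2 \<le> (real m / 2)\<^sup>2"
    proof -
      have "(2 * a * t)\<^sup>2 = 4 * a\<^sup>2 * t\<^sup>2" by (simp add: power_mult_distrib)
      also have "\<dots> = 8 * a\<^sup>2 * real m / 4" unfolding t(2) by simp
      also have "\<dots> \<le> real m * real m / 4" using m8 by (intro divide_right_mono mult_right_mono) auto
      finally show ?thesis by (simp add: power2_eq_square)
    qed
    then have "2 * a * t \<le> real m / 2" by (rule power2_le_imp_le) simp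
    then show ?thesis using wl by (simp add: lv)
  qed
  define e where "e = 1 / (2 * sqrt (real m)) * exp (- a\<^sup>2 / 2 - 5/2)"
  have e: "bin_weight (2*m) c \<ge> e" if c: "c \<in> ?W" for c
  proof -
    have lpos: "level m a \<ge> 0" using a t by (simp add: lv)
    then have cm: "c \<ge> m" using c by simp
    define i where "i = c - m"
    have ci: "c = m + i" using cm by (simp add: i_def)
    have i: "real i \<le> level m a + width m a" using c by (simp add: ci)
    have "2 * i \<le> m" using i i2 by linarith
    from bin_weight_lower[OF m1 this]
    have "1 / (2 * sqrt (real m)) * exp (- (real i)\<^sup>2 / real m - (real i)^4 / (real m)^3) \<le> bin_weight (2*m) c"
      by (simp add: ci)
    moreover have "e \<le> 1 / (2 * sqrt (real m)) * exp (- (real i)\<^sup>2 / real m - (real i)^4 / (real m)^3)"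
    proof -
      have "(real i)\<^sup>2 / real m \<le> (level m a + width m a)\<^sup>2 / real m"
        using i by (intro divide_right_mono power_mono) auto
      also have "\<dots> = t\<^sup>2 * (a + 1/a)\<^sup>2 / real m"
        by (simp add: lv wd power2_eq_square algebra_simps)
      also have "\<dots> = a\<^sup>2 / 2 + 1 + 1 / (2 * a\<^sup>2)"
        unfolding t using a m1 by (simp add: power2_eq_square field_simps)
      also have "1 / (2 * a\<^sup>2) \<le> 1 / 2" using a2 by (intro frac_le) auto
      finally have 1: "(real i)\<^sup>2 / real m \<le> a\<^sup>2 / 2 + 3 / 2" by simp
      have "(real i)^4 \<le> (2 * a * t)^4" using i wl by (intro power_mono) (auto simp: lv)
      also have "\<dots> = 16 * a^4 * (t\<^sup>2)\<^sup>2" by (simp add: power_mult_distrib)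
      also have "\<dots> = 4 * a^4 * (real m)\<^sup>2" unfolding t by (simp add: power_divide)
      also have "\<dots> \<le> real m * (real m)\<^sup>2" using m by (intro mult_right_mono) auto
      finally have "(real i)^4 \<le> (real m)^3" by (simp add: power2_eq_square power3_eq_cube)
      then have 2: "(real i)^4 / (real m)^3 \<le> 1" using m1 by (simp add: divide_le_eq_1)
      have "- a\<^sup>2 / 2 - 5/2 \<le> - (real i)\<^sup>2 / real m - (real i)^4 / (real m)^3" 
        using 1 2 unfolding minus_divide_left[symmetric] by linarith
      then show ?thesis unfolding e_def by (intro mult_left_mono) auto
    qed
    ultimately show ?thesis by linarith
  qed
  have e0: "e \<ge> 0" by (simp add: e_def)
  have "exp (-5/2) / 6 * (exp (- a\<^sup>2 / 2) / a) \<le> (width m a / 2) * e"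
  proof -
    have "sqrt (real m) = sqrt 2 * t" unfolding t_def real_sqrt_mult[symmetric] by simp
    then have "(width m a / 2) * e = 1 / (4 * sqrt 2) * (exp (- a\<^sup>2 / 2 - 5/2) / a)"
      using t by (simp add: e_def wd field_simps)
    moreover have "1 / 6 \<le> 1 / (4 * sqrt (2::real))"
    proof -
      have "sqrt 2 \<le> (3/2::real)" by (rule real_le_lsqrt) (auto simp: power2_eq_square)
      then show ?thesis by (simp add: field_simps)
    qed
    moreover have "exp (-5/2) / 6 * (exp (- a\<^sup>2 / 2) / a) = 1 / 6 * (exp (- a\<^sup>2 / 2 - 5/2) / a)"
    proof -
      have "exp (- a\<^sup>2 / 2 - 5/2) = exp (-5/2) * exp (- a\<^sup>2 / 2)" unfolding exp_add[symmetric] by simp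
      then show ?thesis by (simp only: times_divide_eq_left times_divide_eq_right mult_1_left)
    qed
    ultimately show ?thesis using a by (simp only:) (intro mult_right_mono, auto)
  qed
  also have "\<dots> \<le> real (card ?W) * e"
    using card_nat_window_lower[of "width m a" "level m a + real m"] w2 a t e0
    by (intro mult_right_mono) (auto simp: lv)
  also have "\<dots> \<le> (\<Sum>c\<in>?W. bin_weight (2*m) c)" using sum_mono[of ?W "\<lambda>_. e", OF e] by simp
  also have "\<dots> = bin_prob (2*m) (window m a)"
  proof -
    have "?W \<subseteq> {..2*m}"
    proof
      fix c assume "c \<in> ?W"
      then have "real c \<le> real m / 2 + real m" using i2 by simp
      then show "c \<in> {..2*m}" by simp
    qed
    then show ?thesis unfolding bin_prob_def W by (simp add: Int_absorb1)
  qed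
  finally show ?thesis by (simp add: hit_def measure_coins_heads_set)
qed

text \<open>Block \<open>u\<close> has \<open>L u\<close> test times and threshold
  \<open>a u\<close>. \<open>L_small\<close> together with \<open>a_upper\<close> yields
  \<open>8 * a^4 \<le> 4^u\<close> for \<open>prob_hit_lower\<close>, as
  \<open>8 * 4^2 = 128\<close>. \<open>L_growth\<close> bounds both the number and the size of the
  later blocks that are not far from \<open>u\<close>.\<close>

locale coin_blocks =
  fixes L :: "nat \<Rightarrow> nat" and a :: "nat \<Rightarrow> real" and U :: "nat set"
  assumes L_pos: "u \<in> U \<Longrightarrow> 1 \<le> L u"
    and L_small: "u \<in> U \<Longrightarrow> 128 * (real (L u))\<^sup>2 \<le> 4^u"
    and a_ge_1: "u \<in> U \<Longrightarrow> 1 \<le> a u"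
    and a_lower: "u \<in> U \<Longrightarrow> real (L u) \<le> (a u)\<^sup>2"
    and a_upper: "u \<in> U \<Longrightarrow> (a u)\<^sup>2 \<le> 4 * real (L u)"
    and a_mono: "u \<in> U \<Longrightarrow> u' \<in> U \<Longrightarrow> u \<le> u' \<Longrightarrow> a u \<le> a u'"
    and L_growth: "u \<in> U \<Longrightarrow> u' \<in> U \<Longrightarrow> u < u' \<Longrightarrow> u' < u + L u' \<Longrightarrow> L u' \<le> 2 * L u"
begin

text \<open>Half the number of tosses, since the binomial bounds are for even numbers. It stays in
  \<open>[4^u, 2 * 4^u]\<close> for \<open>v < L u\<close>, so times in different blocks differ by a
  factor of at least 2.\<close>

definition half_time :: "nat \<Rightarrow> nat \<Rightarrow> nat"
  where "half_time u v = 4^u + v * (4^u div L u)"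

definition block_hit :: "nat \<times> nat \<Rightarrow> (nat \<Rightarrow> bool) set"
  where "block_hit p = hit (half_time (fst p) (snd p)) (a (fst p))"

abbreviation hit_prob :: "nat \<times> nat \<Rightarrow> real"
  where "hit_prob p \<equiv> measure coins (block_hit p)"

text \<open>\<open>L u \<le> 4^u\<close>, so rounding the grid step down loses at most a factor
  2.\<close>

lemma step_bounds:
  assumes u: "u \<in> U"
  shows "4^u \<le> 2 * real (L u) * real (4^u div L u)" "real (L u) * real (4^u div L u) \<le> 4^u"
    "4^u div L u \<ge> 1"
proof -
  have "real (L u) \<le> 128 * (real (L u))\<^sup>2"
    using L_pos[OF u] by (simp add: power2_eq_square)
  also have "\<dots> \<le> real (4^u)" using L_small[OF u] by simp
  finally have le: "L u \<le> 4^u" by (simp only: of_nat_le_iff)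
  then show 1: "4^u div L u \<ge> 1" using L_pos[OF u] by (simp add: div_greater_zero_iff Suc_le_eq)
  have "4^u < Suc (4^u div L u) * L u"
    using L_pos[OF u] dividend_less_div_times[of "L u" "4^u"] by simp
  also have "\<dots> \<le> 2 * L u * (4^u div L u)" using 1 by (simp add: algebra_simps)
  finally have "real (4^u) \<le> real (2 * L u * (4^u div L u))" by (simp only: of_nat_le_iff less_imp_le)
  then show "4^u \<le> 2 * real (L u) * real (4^u div L u)" by simp
  have "L u * (4^u div L u) \<le> 4^u" by simp
  then have "real (L u * (4^u div L u)) \<le> real (4^u)" by (simp only: of_nat_le_iff)
  then show "real (L u) * real (4^u div L u) \<le> 4^u" by simp
qed

lemma half_time_bounds:
  assumes u: "u \<in> U" and v: "v < L u"
  shows "4^u \<le> half_time u v" "half_time u v \<le> 2 * 4^u" "real (half_time u v) \<ge> 4^u"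
    "real (half_time u v) \<le> 2 * 4^u"
proof -
  show 1: "4^u \<le> half_time u v" by (simp add: half_time_def)
  have "v * (4^u div L u) \<le> L u * (4^u div L u)" using v by (intro mult_right_mono) auto
  also have "\<dots> \<le> 4^u" by simp
  finally show 2: "half_time u v \<le> 2 * 4^u" by (simp add: half_time_def)
  have "real (4^u) \<le> real (half_time u v)" using 1 by (simp only: of_nat_le_iff)
  then show "real (half_time u v) \<ge> 4^u" by simp
  have "real (half_time u v) \<le> real (2 * 4^u)" using 2 by (simp only: of_nat_le_iff)
  then show "real (half_time u v) \<le> 2 * 4^u" by simp
qed

lemma half_time_diff:
  assumes "v \<le> v'"
  shows "half_time u v' - half_time u v = (v' - v) * (4^u div L u)"
  using assms by (simp add: half_time_def diff_mult_distrib)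

lemma half_time_pos: "half_time u v > 0"
  by (simp add: half_time_def)

lemma half_time_blocks:
  assumes "u \<in> U" "u' \<in> U" "u < u'" "v < L u" "v' < L u'"
  shows "2 * half_time u v \<le> half_time u' v'"
proof -
  have "2 * half_time u v \<le> 4 * 4^u" using half_time_bounds(2)[of u v] assms by simp
  also have "\<dots> = 4^Suc u" by simp
  also have "\<dots> \<le> 4^u'" using assms by (intro power_increasing) auto
  also have "\<dots> \<le> half_time u' v'" using half_time_bounds(1)[of u' v'] assms by simp
  finally show ?thesis .
qed

lemma sets_block_hit: "block_hit p \<in> sets coins"
  unfolding block_hit_def by (rule sets_hit)

text \<open>Hits in blocks \<open>u\<close> and \<open>u'\<close> with \<open>u' - u \<ge> L u'\<close> are independent up to the factor
  \<open>far_const\<close>. For closer pairs, \<open>near_coeff\<close> bounds the conditional probability of the later hit;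
  its sum over all later hits is bounded although the number of points per block is not.\<close>

definition near_coeff :: "nat \<times> nat \<Rightarrow> nat \<times> nat \<Rightarrow> real"
  where "near_coeff p p' = (let (u, v) = p; (u', v') = p' in
    if u = u' then (if v \<le> v' then 10 * exp (- (real v' - real v) / 48) else 0)
    else if u < u' \<and> u' < u + L u' then 10 * exp (- real (L u) / 12) else 0)"

lemma near_coeff_nonneg: "near_coeff p p' \<ge> 0"
  by (simp add: near_coeff_def split: prod.split)

lemma hit_prob_lower:
  assumes "u \<in> U" "v < L u"
  shows "hit_prob (u, v) \<ge> exp (-5/2) / 6 * (exp (- (a u)\<^sup>2 / 2) / a u)"
proof -
  have "8 * (a u)^4 = 8 * ((a u)\<^sup>2)\<^sup>2" by simp
  also have "\<dots> \<le> 8 * (4 * real (L u))\<^sup>2" using a_upper[OF assms(1)] by (intro mult_left_mono power_mono) auto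
  also have "\<dots> = 128 * (real (L u))\<^sup>2" by (simp add: power_mult_distrib)
  also have "\<dots> \<le> 4^u" by (rule L_small) fact
  also have "\<dots> \<le> real (half_time u v)" by (rule half_time_bounds(3)) fact+
  finally show ?thesis unfolding block_hit_def using a_ge_1[OF assms(1)]
    by (simp only: fst_conv snd_conv) (rule prob_hit_lower)
qed

text \<open>\<open>5 * exp 12\<close> is the constant of \<open>prob_two_hits_far\<close> with
  \<open>D = 12\<close>; the divisor is the constant of \<open>hit_prob_lower\<close>.\<close>

definition far_const :: real where "far_const = 5 * exp 12 / (exp (-5/2) / 6)"

lemma far_const_pos: "far_const > 0"
  by (simp add: far_const_def)

text \<open>Here \<open>r^2 - 1 \<ge> (v' - v) / (4 * L u)\<close> and \<open>L u \<le> a^2\<close>,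
  so \<open>a^2 * (r - 1) \<ge> (v' - v) / (4 * (r + 1))\<close>. With
  \<open>(r + 1)^2 \<le> 6\<close> the decay exponent is at least \<open>(v' - v) / 48\<close>,
  where \<open>48 = 4 * 2 * 6\<close>.\<close>

lemma same_block:
  assumes u: "u \<in> U" and v: "v < v'" "v' < L u"
  shows "measure coins (block_hit (u, v) \<inter> block_hit (u, v')) \<le> hit_prob (u, v) * near_coeff (u, v) (u, v')"
proof -
  let ?g = "4^u div L u" and ?m = "half_time u v" and ?m' = "half_time u v'"
  have vL: "v < L u" using v by simp
  have L: "real (L u) > 0" using L_pos[OF u] by simp
  have diff: "?m' - ?m = (v' - v) * ?g" using v by (simp add: half_time_diff)
  have g1: "?g \<ge> 1" by (rule step_bounds) fact
  then have "(v' - v) * ?g > 0" using v by simp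
  then have mm: "?m < ?m'" unfolding diff[symmetric] by (simp only: zero_less_diff)
  have dr: "real (?m' - ?m) = real (v' - v) * real ?g" unfolding diff by simp
  have gr: "4^u \<le> 2 * real (L u) * real ?g" by (rule step_bounds) fact
  have gap: "real ?m' \<le> 4 * (a u)\<^sup>2 * real (?m' - ?m)"
  proof -
    have "real ?m' \<le> 2 * 4^u" by (rule half_time_bounds) fact+
    also have "\<dots> \<le> 4 * real (L u) * real ?g" using gr by simp
    also have "\<dots> \<le> 4 * (a u)\<^sup>2 * real ?g" using a_lower[OF u] by (intro mult_right_mono) auto
    also have "\<dots> \<le> 4 * (a u)\<^sup>2 * (real (v' - v) * real ?g)"
      using v mult_right_mono[of 1 "real (v' - v)" "real ?g"] by (intro mult_left_mono) auto
    finally show ?thesis unfolding dr .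
  qed
  define r where "r = sqrt (real ?m' / real ?m)"
  have mpos: "real ?m > 0" using half_time_pos by simp
  have r2: "r\<^sup>2 = real ?m' / real ?m" using mpos by (simp add: r_def)
  have r1: "r \<ge> 1" using mm mpos by (simp add: r_def)
  have "real ?m' \<le> 2 * real ?m"
    using half_time_bounds(3)[OF u vL] half_time_bounds(4)[OF u v(2)] by linarith
  \<comment> \<open>\<open>17/12\<close> is a rational upper bound for
    \<open>sqrt 2\<close>.\<close>
  then have "r\<^sup>2 \<le> (17/12)\<^sup>2" unfolding r2 using mpos by (simp add: divide_le_eq power2_eq_square)
  then have r32: "r \<le> 17/12" by (rule power2_le_imp_le) simp
  have "real (v' - v) / (4 * real (L u)) \<le> r\<^sup>2 - 1"
  proof -
    have "real (v' - v) / (4 * real (L u)) \<le> real (v' - v) * real ?g / (2 * 4^u)"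
    proof -
      have "1 / (4 * real (L u)) \<le> real ?g / (2 * 4^u)" using gr L by (simp add: field_simps)
      from mult_left_mono[OF this, of "real (v' - v)"] show ?thesis by simp
    qed
    also have "\<dots> \<le> real (v' - v) * real ?g / real ?m"
      using mpos half_time_bounds(4)[OF u vL] by (intro divide_left_mono mult_pos_pos) auto
    also have "\<dots> = r\<^sup>2 - 1" unfolding r2 dr[symmetric] using mpos mm by (simp add: of_nat_diff diff_divide_distrib)
    finally show ?thesis .
  qed
  then have d: "real (v' - v) \<le> 4 * real (L u) * (r\<^sup>2 - 1)" using L by (simp add: field_simps)
  also have "\<dots> \<le> 4 * (a u)\<^sup>2 * (r\<^sup>2 - 1)" using a_lower[OF u] r1 by (intro mult_right_mono) auto
  also have "\<dots> = 4 * (a u)\<^sup>2 * (r - 1) * (r + 1)" by (simp add: power2_eq_square algebra_simps)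
  finally have d2: "real (v' - v) \<le> 4 * (a u)\<^sup>2 * (r - 1) * (r + 1)" .
  have "real (v' - v) / 48 \<le> (a u)\<^sup>2 * (r - 1) / (2 * (r + 1))"
  proof -
    have "real (v' - v) * (r + 1) \<le> 4 * (a u)\<^sup>2 * (r - 1) * (r + 1) * (r + 1)"
      using d2 r1 by (intro mult_right_mono) auto
    also have "\<dots> = 4 * (a u)\<^sup>2 * (r - 1) * ((r + 1) * (r + 1))" by simp
    also have "\<dots> \<le> 4 * (a u)\<^sup>2 * (r - 1) * 6"
    proof (intro mult_left_mono)
      have "(r + 1) * (r + 1) \<le> 29/12 * (29/12)" using r1 r32 by (intro mult_mono) auto
      then show "(r + 1) * (r + 1) \<le> 6" by simp
    qed (use r1 in auto)
    finally have "real (v' - v) * (r + 1) \<le> 24 * ((a u)\<^sup>2 * (r - 1))" by (simp add: mult_ac)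
    moreover have "real (v' - v) * (r + 1) \<ge> 0" using r1 by simp
    ultimately show ?thesis using r1 by (simp add: field_simps)
  qed
  then have "exp (- (a u)\<^sup>2 * (r - 1) / (2 * (r + 1))) \<le> exp (- (real v' - real v) / 48)"
    using v by (simp add: of_nat_diff)
  then have "hit_prob (u, v) * (10 * exp (- (a u)\<^sup>2 * (r - 1) / (2 * (r + 1)))) \<le> hit_prob (u, v) * (10 * exp (- (real v' - real v) / 48))"
    by (intro mult_left_mono) auto
  moreover have "measure coins (block_hit (u, v) \<inter> block_hit (u, v')) \<le>
      hit_prob (u, v) * (10 * exp (- (a u)\<^sup>2 * (r - 1) / (2 * (r + 1))))"
    unfolding block_hit_def fst_conv snd_conv
    using a_ge_1[OF u] by (intro prob_two_hits_near half_time_pos mm gap r_def) auto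
  ultimately show ?thesis using v by (simp add: near_coeff_def)
qed

text \<open>The times differ by a factor of at least 2, so \<open>r \<ge> 7/5\<close> and
  \<open>(r - 1) / (2 * (r + 1)) \<ge> 1/12\<close>. With \<open>L u \<le> a^2\<close> this gives
  the decay that pays for all points of all near blocks.\<close>

lemma near_block:
  assumes u: "u \<in> U" "u' \<in> U" "u < u'" "u' < u + L u'" and v: "v < L u" "v' < L u'"
  shows "measure coins (block_hit (u, v) \<inter> block_hit (u', v')) \<le> hit_prob (u, v) * near_coeff (u, v) (u', v')"
proof -
  let ?m = "half_time u v" and ?m' = "half_time u' v'"
  have m2: "2 * ?m \<le> ?m'" by (intro half_time_blocks u v)
  have mpos: "?m > 0" by (rule half_time_pos)
  then have mm: "?m < ?m'" using m2 by simp
  have "1 \<le> (a u')\<^sup>2" using a_ge_1[OF u(2)] by simp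
  have "real ?m' \<le> 2 * real (?m' - ?m)" using m2 by (simp add: of_nat_diff)
  also have "\<dots> \<le> 4 * (a u')\<^sup>2 * real (?m' - ?m)"
    using \<open>1 \<le> (a u')\<^sup>2\<close> by (intro mult_right_mono) auto
  finally have gap: "real ?m' \<le> 4 * (a u')\<^sup>2 * real (?m' - ?m)" .
  define r where "r = sqrt (real ?m' / real ?m)"
  have r2: "r\<^sup>2 = real ?m' / real ?m" by (simp add: r_def)
  have "real (2 * ?m) \<le> real ?m'" using m2 by (simp only: of_nat_le_iff)
  then have "(7/5)\<^sup>2 \<le> r\<^sup>2" unfolding r2 using mpos by (simp add: le_divide_eq power2_eq_square)
  then have r75: "7/5 \<le> r" by (rule power2_le_imp_le) (simp add: r_def)
  have "real (L u) / 12 \<le> (a u)\<^sup>2 / 12" using a_lower[OF u(1)] by simp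
  also have "\<dots> \<le> (a u)\<^sup>2 * (r - 1) / (2 * (r + 1))"
  proof -
    have "1/12 \<le> (r - 1) / (2 * (r + 1))" using r75 by (simp add: field_simps)
    from mult_left_mono[OF this, of "(a u)\<^sup>2"] show ?thesis by simp
  qed
  finally have "exp (- (a u)\<^sup>2 * (r - 1) / (2 * (r + 1))) \<le> exp (- real (L u) / 12)" by simp
  then have "hit_prob (u, v) * (10 * exp (- (a u)\<^sup>2 * (r - 1) / (2 * (r + 1)))) \<le> hit_prob (u, v) * (10 * exp (- real (L u) / 12))"
    by (intro mult_left_mono) auto
  moreover have "measure coins (block_hit (u, v) \<inter> block_hit (u', v')) \<le>
      hit_prob (u, v) * (10 * exp (- (a u)\<^sup>2 * (r - 1) / (2 * (r + 1))))"
    unfolding block_hit_def fst_conv snd_conv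
    using a_ge_1[OF u(1)] a_mono[OF u(1,2)] u by (intro prob_two_hits_near half_time_pos mm gap r_def) auto
  ultimately show ?thesis using u by (simp add: near_coeff_def)
qed

text \<open>The dependence stays bounded because \<open>a u * a u' \<le> 4 * 2^L u'\<close>, while a
  separation of \<open>L u'\<close> blocks gives \<open>sqrt (m / m') \<le> 3/2 / 2^L u'\<close>.
  Hence \<open>D = 2 * 4 * 3/2 = 12\<close>.\<close>

lemma far_block:
  assumes u: "u \<in> U" "u' \<in> U" "u + L u' \<le> u'" and v: "v < L u" "v' < L u'"
  shows "measure coins (block_hit (u, v) \<inter> block_hit (u', v')) \<le> far_const * hit_prob (u, v) * hit_prob (u', v')"
proof -
  let ?m = "half_time u v" and ?m' = "half_time u' v'"
  have uu: "u < u'" using u L_pos[OF u(2)] by simp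
  have m2: "2 * ?m \<le> ?m'" by (intro half_time_blocks u v uu)
  have mpos: "?m > 0" "?m' > 0" by (rule half_time_pos)+
  have bm: "(a u')\<^sup>2 \<le> real ?m'"
  proof -
    have "(a u')\<^sup>2 \<le> 4 * real (L u')" by (rule a_upper) fact
    also have "\<dots> \<le> 128 * (real (L u'))\<^sup>2" using L_pos[OF u(2)] by (simp add: power2_eq_square)
    also have "\<dots> \<le> 4^u'" by (rule L_small) fact
    also have "\<dots> \<le> real ?m'" by (rule half_time_bounds) fact+
    finally show ?thesis .
  qed
  have D: "2 * a u * a u' * sqrt (real ?m / real ?m') \<le> 12"
  proof -
    have "a u * a u' \<le> a u' * a u'"
      using a_mono[OF u(1,2)] uu a_ge_1[OF u(2)] by (intro mult_right_mono) auto
    also have "\<dots> \<le> 4 * real (L u')" using a_upper[OF u(2)] by (simp add: power2_eq_square)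
    also have "\<dots> \<le> 4 * 2^L u'" using of_nat_mono[OF less_imp_le[OF less_exp[of "L u'"]], where 'a = real] by simp
    finally have 1: "a u * a u' \<le> 4 * 2^L u'" .
    have "sqrt (real ?m / real ?m') \<le> 3 / 2 / 2^L u'"
    proof (rule real_le_lsqrt)
      have "real ?m / real ?m' \<le> (2 * 4^u) / 4^u'"
        using half_time_bounds(3)[OF u(2) v(2)] half_time_bounds(4)[OF u(1) v(1)] by (intro frac_le) auto
      also have "\<dots> = 2 / 4^(u' - u)" using uu by (simp add: power_diff)
      also have "\<dots> \<le> 2 / 4^L u'" using u(3) by (intro divide_left_mono power_increasing) auto
      also have "\<dots> \<le> (3 / 2 / 2^L u')\<^sup>2"
      proof -
        have "((2::real)^L u')\<^sup>2 = 4^L u'" by (simp add: power_mult_distrib[symmetric] power2_eq_square)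
        then show ?thesis by (simp add: power_divide divide_simps)
      qed
      finally show "real ?m / real ?m' \<le> (3 / 2 / 2^L u')\<^sup>2" .
    qed auto
    then have "2 * (a u * a u') * sqrt (real ?m / real ?m') \<le> 2 * (4 * 2^L u') * (3 / 2 / 2^L u')"
      by (intro mult_mono[OF mult_left_mono[OF 1]]) auto
    then show ?thesis by (simp add: mult.assoc)
  qed
  have "measure coins (block_hit (u, v) \<inter> block_hit (u', v'))
      \<le> hit_prob (u, v) * (5 * exp 12 * (exp (- (a u')\<^sup>2 / 2) / a u'))"
    unfolding block_hit_def fst_conv snd_conv
    using a_ge_1[OF u(1)] a_ge_1[OF u(2)] by (intro prob_two_hits_far half_time_pos m2 bm D)
  also have "\<dots> = hit_prob (u, v) * (far_const * (exp (-5/2) / 6 * (exp (- (a u')\<^sup>2 / 2) / a u')))"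
    by (simp add: far_const_def)
  also have "\<dots> \<le> hit_prob (u, v) * (far_const * hit_prob (u', v'))"
    using far_const_pos hit_prob_lower[OF u(2) v(2)] by (intro mult_left_mono) auto
  finally show ?thesis by (simp add: mult_ac)
qed

lemma ordered_pair:
  assumes u: "u \<in> U" "u' \<in> U" and v: "v < L u" "v' < L u'" and le: "u < u' \<or> (u = u' \<and> v \<le> v')"
  shows "measure coins (block_hit (u, v) \<inter> block_hit (u', v'))
    \<le> hit_prob (u, v) * near_coeff (u, v) (u', v') + far_const * hit_prob (u, v) * hit_prob (u', v')"
proof -
  have nn: "0 \<le> hit_prob (u, v) * near_coeff (u, v) (u', v')" "0 \<le> far_const * hit_prob (u, v) * hit_prob (u', v')"
    using near_coeff_nonneg far_const_pos by (auto intro!: mult_nonneg_nonneg simp: less_imp_le)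
  consider "u = u'" "v = v'" | "u = u'" "v < v'" | "u < u'" "u' < u + L u'" | "u + L u' \<le> u'"
    using le by linarith
  then show ?thesis
  proof cases
    case 1
    then have "hit_prob (u, v) * 1 \<le> hit_prob (u, v) * near_coeff (u, v) (u', v')" by (intro mult_left_mono) (auto simp: near_coeff_def)
    then show ?thesis using 1 nn by simp
  next
    case 2
    then show ?thesis using same_block[of u v v'] u v nn by simp
  next
    case 3
    then show ?thesis using near_block[OF u 3 v] nn by linarith
  next
    case 4
    then show ?thesis using far_block[OF u 4 v] nn by linarith
  qed
qed

text \<open>\<open>near_coeff\<close> vanishes when its first argument is the later one, so adding
  both orders covers unordered pairs.\<close>

lemma pair_bound:
  assumes p: "fst p \<in> U" "snd p < L (fst p)" and p': "fst p' \<in> U" "snd p' < L (fst p')"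
  shows "measure coins (block_hit p \<inter> block_hit p') \<le> hit_prob p * near_coeff p p' + hit_prob p' * near_coeff p' p + far_const * hit_prob p * hit_prob p'"
proof -
  obtain u v u' v' where e: "p = (u, v)" "p' = (u', v')" by (cases p, cases p')
  have nn: "0 \<le> hit_prob p * near_coeff p p'" "0 \<le> hit_prob p' * near_coeff p' p" using near_coeff_nonneg by auto
  consider "u < u' \<or> (u = u' \<and> v \<le> v')" | "u' < u \<or> (u' = u \<and> v' \<le> v)" by linarith
  then show ?thesis
  proof cases
    case 1
    then show ?thesis using ordered_pair[of u u' v v'] p p' e nn by simp
  next
    case 2
    then show ?thesis using ordered_pair[of u' u v' v] p p' e nn
      by (simp add: Int_commute mult_ac)
  qed
qed

text \<open>The first summand is the geometric series within a block. There are at most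
  \<open>2 * L\<close> near blocks with at most \<open>2 * L\<close> points each and coefficient
  \<open>10 * exp (- L / 12)\<close>; \<open>L^2 \<le> 288 * exp (L / 12)\<close> gives
  \<open>40 * 288 = 11520\<close>.\<close>

definition near_const :: real where "near_const = 10 / (1 - exp (-1/48)) + 11520"

lemma near_const_pos: "near_const > 0"
proof -
  have "exp (-1/48) < (1::real)" by simp
  then show ?thesis unfolding near_const_def by (intro add_pos_pos divide_pos_pos) auto
qed

definition index :: "nat \<Rightarrow> nat \<Rightarrow> (nat \<times> nat) set"
  where "index r N = (SIGMA u:{u\<in>U. r \<le> u \<and> u < N}. {..<L u})"

lemma finite_index: "finite (index r N)"
  unfolding index_def by (intro finite_SigmaI) auto

lemma sum_near_coeff:
  assumes p: "fst p \<in> U" "snd p < L (fst p)"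
  shows "(\<Sum>p'\<in>index r N. near_coeff p p') \<le> near_const"
proof -
  obtain u v where e: "p = (u, v)" by (cases p)
  have u: "u \<in> U" and v: "v < L u" using p e by auto
  let ?near = "{u'\<in>U. u < u' \<and> u' < u + L u'}"
  have near_sub: "?near \<subseteq> {u<..<u + 2 * L u}"
    using L_growth[OF u] by fastforce
  then have fin: "finite ?near" by (rule finite_subset) auto
  have "(\<Sum>p'\<in>index r N. near_coeff p p') = (\<Sum>u'\<in>{u\<in>U. r \<le> u \<and> u < N}. \<Sum>v'<L u'. near_coeff p (u', v'))"
    unfolding index_def by (subst sum.Sigma) auto
  also have "\<dots> \<le> (\<Sum>u'\<in>insert u ?near. \<Sum>v'<L u'. near_coeff p (u', v'))"
  proof -
    have z: "(\<Sum>v'<L u'. near_coeff p (u', v')) = 0" if "u' \<in> U" "u' \<notin> insert u ?near" for u'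
      using that by (intro sum.neutral) (auto simp: e near_coeff_def)
    have "(\<Sum>u'\<in>{u\<in>U. r \<le> u \<and> u < N}. \<Sum>v'<L u'. near_coeff p (u', v'))
        = (\<Sum>u'\<in>{u\<in>U. r \<le> u \<and> u < N} \<inter> insert u ?near. \<Sum>v'<L u'. near_coeff p (u', v'))"
      using z by (intro sum.mono_neutral_right) auto
    also have "\<dots> \<le> (\<Sum>u'\<in>insert u ?near. \<Sum>v'<L u'. near_coeff p (u', v'))"
      using fin near_coeff_nonneg by (intro sum_mono2 sum_nonneg) auto
    finally show ?thesis .
  qed
  also have "\<dots> = (\<Sum>v'<L u. near_coeff p (u, v')) + (\<Sum>u'\<in>?near. \<Sum>v'<L u'. near_coeff p (u', v'))"
    using fin by (subst sum.insert) auto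
  also have "(\<Sum>v'<L u. near_coeff p (u, v')) \<le> 10 / (1 - exp (-1/48))"
  proof -
    let ?q = "exp (-1/48) :: real"
    have q: "?q < 1" "0 < ?q" by auto
    have "(\<Sum>v'<L u. near_coeff p (u, v')) = (\<Sum>v'\<in>{v..<L u}. 10 * exp (- (real v' - real v) / 48))"
      by (intro sum.mono_neutral_cong_right) (auto simp: e near_coeff_def)
    also have "\<dots> = (\<Sum>i<L u - v. 10 * ?q^i)"
    proof (rule sum.reindex_bij_witness[of _ "\<lambda>i. i + v" "\<lambda>v'. v' - v"])
      fix v' assume "v' \<in> {v..<L u}"
      then have "- (real v' - real v) / 48 = real (v' - v) * (-1/48)" by (simp add: of_nat_diff field_simps)
      then show "10 * ?q^(v' - v) = 10 * exp (- (real v' - real v) / 48)"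
        by (simp only: exp_of_nat_mult)
    qed auto
    also have "\<dots> = 10 * (\<Sum>i<L u - v. ?q^i)" by (simp add: sum_distrib_left)
    also have "\<dots> \<le> 10 * (\<Sum>i. ?q^i)"
      using q by (intro mult_left_mono sum_le_suminf summable_geometric) auto
    also have "(\<Sum>i. ?q^i) = 1 / (1 - ?q)" using q by (intro suminf_geometric) auto
    finally show ?thesis by simp
  qed
  also have "(\<Sum>u'\<in>?near. \<Sum>v'<L u'. near_coeff p (u', v')) \<le> 11520"
  proof -
    let ?x = "10 * exp (- real (L u) / 12)"
    have "(\<Sum>u'\<in>?near. \<Sum>v'<L u'. near_coeff p (u', v')) = (\<Sum>u'\<in>?near. real (L u') * ?x)"
      by (intro sum.cong) (auto simp: e near_coeff_def)
    also have "\<dots> \<le> (\<Sum>u'\<in>?near. real (2 * L u) * ?x)"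
    proof (intro sum_mono mult_right_mono)
      fix u' assume "u' \<in> ?near"
      then have "L u' \<le> 2 * L u" using L_growth[OF u] by simp
      then show "real (L u') \<le> real (2 * L u)" by (simp only: of_nat_le_iff)
    qed auto
    also have "\<dots> = real (card ?near) * (real (2 * L u) * ?x)" by simp
    also have "\<dots> \<le> real (2 * L u) * (real (2 * L u) * ?x)"
    proof -
      have "card ?near \<le> card {u<..<u + 2 * L u}" using near_sub by (intro card_mono) auto
      then have "card ?near \<le> 2 * L u" by simp
      then have "real (card ?near) \<le> real (2 * L u)" by (simp only: of_nat_le_iff)
      then show ?thesis by (intro mult_right_mono) auto
    qed
    also have "\<dots> = 40 * (real (L u))\<^sup>2 * exp (- real (L u) / 12)" by (simp add: power2_eq_square)
    also have "\<dots> \<le> 40 * (288 * exp (real (L u) / 12)) * exp (- real (L u) / 12)"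
    proof -
      have "1 + real (L u) / 12 + (real (L u) / 12)\<^sup>2 / 2 \<le> exp (real (L u) / 12)"
        by (rule exp_lower_Taylor_quadratic) simp
      then have "(real (L u) / 12)\<^sup>2 / 2 \<le> exp (real (L u) / 12)"
        by (smt (verit) divide_nonneg_nonneg of_nat_0_le_iff)
      then have "(real (L u))\<^sup>2 \<le> 288 * exp (real (L u) / 12)" by (simp add: power_divide)
      then show ?thesis by (intro mult_right_mono mult_left_mono) auto
    qed
    also have "\<dots> = 11520 * (exp (real (L u) / 12) * exp (- real (L u) / 12))" by simp
    also have "exp (real (L u) / 12) * exp (- real (L u) / 12) = 1" unfolding exp_add[symmetric] by simp
    finally show ?thesis by simp
  qed
  finally show ?thesis by (simp add: near_const_def)
qed

text \<open>The bound does not depend on \<open>r\<close>, so it survives the passage to infinitely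
  many hits. Enough blocks are taken to make the expected number \<open>s\<close> of hits at least
  1; then \<open>s \<le> s^2\<close> bounds the second moment by a multiple of
  \<open>s^2\<close>.\<close>

lemma prob_some_hit:
  assumes div: "\<not> summable (\<lambda>u. if u \<in> U then gtail (a u) else 0)"
  shows "measure coins (\<Union>p\<in>{(u, v). u \<in> U \<and> r \<le> u \<and> v < L u}. block_hit p) \<ge> 1 / (2 * near_const + far_const)"
proof -
  \<comment> \<open>\<open>24 = 6 * 4\<close>, with 6 from \<open>hit_prob_lower\<close> and 4 from
    \<open>a^2 \<le> 4 * L\<close>; block \<open>u\<close> then contributes at least
    \<open>c * gtail (a u)\<close> to \<open>s\<close>.\<close>
  define c :: real where "c = exp (-5/2) / 24"
  have c: "c > 0" by (simp add: c_def)
  let ?f = "\<lambda>u. if u \<in> U then gtail (a u) else 0"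
  have f0: "?f u \<ge> 0" for u using a_ge_1[of u] gtail_pos[of "a u"] by auto
  have "\<not> summable (\<lambda>u. ?f (u + r))" using div by (subst summable_iff_shift)
  then have "\<exists>n. (\<Sum>u<n. ?f (u + r)) > 1 / c"
    using summableI_nonneg_bounded[of "\<lambda>u. ?f (u + r)" "1 / c", OF f0] by (meson not_le)
  then obtain n where n: "(\<Sum>u<n. ?f (u + r)) > 1 / c" by blast
  let ?I = "index r (n + r)"
  define s where "s = (\<Sum>p\<in>?I. hit_prob p)"
  have mem: "fst p \<in> U" "snd p < L (fst p)" if "p \<in> ?I" for p using that by (auto simp: index_def)
  have "1 \<le> c * (\<Sum>u<n. ?f (u + r))" using n c by (simp add: field_simps)
  also have "(\<Sum>u<n. ?f (u + r)) = (\<Sum>u\<in>{r..<n + r}. ?f u)"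
    by (rule sum.reindex_bij_witness[of _ "\<lambda>u. u - r" "\<lambda>u. u + r"]) auto
  also have "\<dots> = (\<Sum>u\<in>{u\<in>U. r \<le> u \<and> u < n + r}. gtail (a u))"
    by (intro sum.mono_neutral_cong_right) auto
  also have "c * \<dots> \<le> (\<Sum>u\<in>{u\<in>U. r \<le> u \<and> u < n + r}. \<Sum>v<L u. hit_prob (u, v))"
    unfolding sum_distrib_left
  proof (rule sum_mono)
    fix u assume "u \<in> {u\<in>U. r \<le> u \<and> u < n + r}"
    then have u: "u \<in> U" by simp
    let ?e = "exp (- (a u)\<^sup>2 / 2)"
    have a1: "a u \<ge> 1" by (rule a_ge_1) fact
    have "c * gtail (a u) = exp (-5/2) / 6 * ((a u)\<^sup>2 / 4) * (?e / a u)"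
      using a1 by (simp add: c_def gtail_def power2_eq_square)
    also have "\<dots> \<le> exp (-5/2) / 6 * real (L u) * (?e / a u)"
      using a_upper[OF u] a1 by (intro mult_right_mono mult_left_mono) auto
    also have "\<dots> = (\<Sum>v<L u. exp (-5/2) / 6 * (?e / a u))" by simp
    also have "\<dots> \<le> (\<Sum>v<L u. hit_prob (u, v))" using u by (intro sum_mono hit_prob_lower) auto
    finally show "c * gtail (a u) \<le> (\<Sum>v<L u. hit_prob (u, v))" .
  qed
  also have "\<dots> = s" unfolding s_def index_def by (subst sum.Sigma) (auto simp: case_prod_beta)
  finally have s1: "1 \<le> s" .
  have "(\<Sum>p\<in>?I. \<Sum>p'\<in>?I. measure coins (block_hit p \<inter> block_hit p'))
      \<le> (\<Sum>p\<in>?I. \<Sum>p'\<in>?I. hit_prob p * near_coeff p p' + hit_prob p' * near_coeff p' p + far_const * hit_prob p * hit_prob p')"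
    by (intro sum_mono pair_bound mem)
  also have "\<dots> = (\<Sum>p\<in>?I. \<Sum>p'\<in>?I. hit_prob p * near_coeff p p') + (\<Sum>p\<in>?I. \<Sum>p'\<in>?I. hit_prob p' * near_coeff p' p)
      + (\<Sum>p\<in>?I. \<Sum>p'\<in>?I. far_const * hit_prob p * hit_prob p')"
    by (simp add: sum.distrib)
  also have "(\<Sum>p\<in>?I. \<Sum>p'\<in>?I. hit_prob p' * near_coeff p' p) = (\<Sum>p\<in>?I. \<Sum>p'\<in>?I. hit_prob p * near_coeff p p')"
    by (rule sum.swap)
  also have "(\<Sum>p\<in>?I. \<Sum>p'\<in>?I. far_const * hit_prob p * hit_prob p') = far_const * s\<^sup>2"
    by (simp add: s_def power2_eq_square sum_distrib_left sum_distrib_right mult_ac)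
  also have "(\<Sum>p\<in>?I. \<Sum>p'\<in>?I. hit_prob p * near_coeff p p') \<le> near_const * s"
  proof -
    have "(\<Sum>p\<in>?I. \<Sum>p'\<in>?I. hit_prob p * near_coeff p p') \<le> (\<Sum>p\<in>?I. hit_prob p * near_const)"
      unfolding sum_distrib_left[symmetric] by (intro sum_mono mult_left_mono sum_near_coeff mem) auto
    also have "\<dots> = near_const * s" by (simp add: s_def sum_distrib_left mult.commute)
    finally show ?thesis .
  qed
  finally have B: "(\<Sum>p\<in>?I. \<Sum>p'\<in>?I. measure coins (block_hit p \<inter> block_hit p')) \<le> 2 * near_const * s + far_const * s\<^sup>2"
    by simp
  have Bpos: "2 * near_const * s + far_const * s\<^sup>2 > 0" using far_const_pos near_const_pos s1 by (intro add_pos_pos) auto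
  have "1 / (2 * near_const + far_const) \<le> s\<^sup>2 / (2 * near_const * s + far_const * s\<^sup>2)"
  proof -
    have "2 * near_const * s + far_const * s\<^sup>2 \<le> (2 * near_const + far_const) * s\<^sup>2"
      using mult_left_mono[of s "s * s" "2 * near_const"] s1 near_const_pos by (simp add: power2_eq_square algebra_simps)
    then show ?thesis using Bpos far_const_pos near_const_pos s1 by (simp add: divide_simps mult_ac)
  qed
  also have "\<dots> \<le> measure coins (\<Union>p\<in>?I. block_hit p)"
    using coins.kochen_stone[OF finite_index _ B Bpos] sets_block_hit by (simp add: s_def)
  also have "\<dots> \<le> measure coins (\<Union>p\<in>{(u, v). u \<in> U \<and> r \<le> u \<and> v < L u}. block_hit p)"
  proof (rule coins.finite_measure_mono)
    show "(\<Union>p\<in>?I. block_hit p) \<subseteq> (\<Union>p\<in>{(u, v). u \<in> U \<and> r \<le> u \<and> v < L u}. block_hit p)"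
      by (auto simp: index_def)
    show "(\<Union>p\<in>{(u, v). u \<in> U \<and> r \<le> u \<and> v < L u}. block_hit p) \<in> sets coins"
      using sets_block_hit by (intro sets.countable_UN') auto
  qed
  finally show ?thesis .
qed

end

section \<open>Divergence of the series\<close>

text \<open>The decreasing events \<open>H r\<close> all have probability at least \<open>c\<close>,
  hence so has their intersection; Ville's inequality at level \<open>2 / c\<close> removes at most
  \<open>c / 2\<close> of it.\<close>

lemma (in coin_blocks) ex_bounded_capital_path:
  assumes div: "\<not> summable (\<lambda>u. if u \<in> U then gtail (a u) else 0)"
    and nonneg: "\<And>x n. x \<in> paths \<Longrightarrow> capital 1 \<sigma> x n \<ge> 0"
  obtains \<omega> C where "\<And>i. capital 1 \<sigma> (coin_path \<omega>) i < C"
    and "\<And>r. \<exists>u v. u \<in> U \<and> r \<le> u \<and> v < L u \<and> \<omega> \<in> block_hit (u, v)"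
proof -
  define c where "c = 1 / (2 * near_const + far_const)"
  have c: "c > 0" using far_const_pos near_const_pos by (simp add: c_def)
  define H where "H r = (\<Union>p\<in>{(u, v). u \<in> U \<and> r \<le> u \<and> v < L u}. block_hit p)" for r
  have sets_H: "H r \<in> sets coins" for r
    unfolding H_def using sets_block_hit by (intro sets.countable_UN') auto
  have "decseq H" unfolding decseq_def H_def by fastforce
  then have "(\<lambda>r. measure coins (H r)) \<longlonglongrightarrow> measure coins (\<Inter>r. H r)"
    using sets_H by (intro coins.finite_Lim_measure_decseq) auto
  then have lim: "measure coins (\<Inter>r. H r) \<ge> c"
    using prob_some_hit[OF div] by (intro tendsto_lowerbound) (auto simp: H_def c_def)
  let ?V = "{\<omega>. \<exists>i. capital 1 \<sigma> (coin_path \<omega>) i \<ge> 2 / c}"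
  have V: "measure coins ?V \<le> c / 2" "?V \<in> sets coins"
    using ville[OF nonneg, of "2 / c"] c by auto
  have "\<not> (\<Inter>r. H r) \<subseteq> ?V"
  proof
    assume "(\<Inter>r. H r) \<subseteq> ?V"
    then have "measure coins (\<Inter>r. H r) \<le> measure coins ?V"
      using V(2) by (rule coins.finite_measure_mono)
    then show False using lim V(1) c by linarith
  qed
  then obtain \<omega> where w: "\<omega> \<in> (\<Inter>r. H r)" "\<omega> \<notin> ?V" by blast
  show thesis
  proof (rule that)
    show "capital 1 \<sigma> (coin_path \<omega>) i < 2 / c" for i using w(2) by (simp add: not_le)
    show "\<exists>u v. u \<in> U \<and> r \<le> u \<and> v < L u \<and> \<omega> \<in> block_hit (u, v)" for r
      using w(1) unfolding H_def by blast
  qed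
qed

text \<open>The number of test times in block \<open>u\<close>, chosen before \<psi> is considered:
  \<open>ln u\<close> is the order of \<open>a^2\<close> at which \<open>gtail (a u)\<close> passes
  from summable to not summable.\<close>

definition log_ceil :: "nat \<Rightarrow> nat"
  where "log_ceil u = nat \<lceil>ln (real u)\<rceil>"

lemma log_ceil_bounds:
  assumes "u \<ge> 2"
  shows "ln (real u) \<le> real (log_ceil u)" "real (log_ceil u) \<le> ln (real u) + 1" "log_ceil u \<ge> 1"
proof -
  have pos: "ln (real u) > 0" using assms by simp
  then have "\<lceil>ln (real u)\<rceil> \<ge> 1" by (simp add: le_ceiling_iff)
  then show "log_ceil u \<ge> 1" by (simp add: log_ceil_def le_nat_iff)
  have "real (log_ceil u) = of_int \<lceil>ln (real u)\<rceil>"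
    using \<open>\<lceil>ln (real u)\<rceil> \<ge> 1\<close> by (simp add: log_ceil_def)
  then show "ln (real u) \<le> real (log_ceil u)" "real (log_ceil u) \<le> ln (real u) + 1"
    by linarith+
qed

lemma log_ceil_mono:
  assumes "1 \<le> u" "u \<le> u'"
  shows "log_ceil u \<le> log_ceil u'"
  unfolding log_ceil_def using assms by (intro nat_mono ceiling_mono) simp

text \<open>From \<open>ln u' \<le> u' / 4 + 1\<close> the hypotheses give
  \<open>u' \<le> 2 * u\<close>, so \<open>ln\<close> grows by at most \<open>ln 2 \<le> 1\<close>,
  which \<open>1 \<le> log_ceil u\<close> turns into the factor 2.\<close>

lemma log_ceil_growth:
  assumes u: "8 \<le> u" "u < u'" "u' < u + log_ceil u'"
  shows "log_ceil u' \<le> 2 * log_ceil u"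
proof -
  have ln4: "ln (4::real) \<le> 2"
    using ln_realpow[of 2 2] ln_le_minus_one[of "2::real"] by simp
  have "real (log_ceil u') \<le> ln (real u') + 1" using u by (intro log_ceil_bounds) auto
  also have "ln (real u') = ln (real u' / 4) + ln 4" using u by (simp add: ln_div)
  also have "\<dots> \<le> (real u' / 4 - 1) + 2" using u ln4 by (intro add_mono ln_le_minus_one) auto
  finally have "real u' \<le> 2 * real u" using u by linarith
  then have "ln (real u') \<le> ln (2 * real u)" using u by simp
  also have "\<dots> = ln 2 + ln (real u)" using u by (simp add: ln_mult)
  also have "\<dots> \<le> 1 + ln (real u)" using ln_le_minus_one[of "2::real"] by simp
  also have "\<dots> \<le> 1 + real (log_ceil u)" using log_ceil_bounds(1)[of u] u by simp
  finally have "\<lceil>ln (real u')\<rceil> \<le> int (1 + log_ceil u)" by (simp add: ceiling_le_iff)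
  then have "log_ceil u' \<le> 1 + log_ceil u" unfolding log_ceil_def[of u'] by (simp add: nat_le_iff)
  moreover have "1 \<le> log_ceil u" using log_ceil_bounds(3)[of u] u by simp
  ultimately show ?thesis by simp
qed

lemma log_ceil_small:
  assumes "8 \<le> u"
  shows "128 * (real (log_ceil u))\<^sup>2 \<le> 4^u"
proof -
  have "ln (real u) \<le> real u - 1" using assms by (intro ln_le_minus_one) auto
  then have "real (log_ceil u) \<le> real u" using log_ceil_bounds(2)[of u] assms by simp
  then have "128 * (real (log_ceil u))\<^sup>2 \<le> 128 * (real u)\<^sup>2" by (intro mult_left_mono power_mono) auto
  also have "\<dots> \<le> 4^u"
    using assms
  proof (induction u rule: nat_induct_at_least)
    case (Suc u)
    have "(real (Suc u))\<^sup>2 \<le> (2 * real u)\<^sup>2" using Suc by (intro power_mono) auto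
    then show ?case using Suc by (simp add: power_mult_distrib)
  qed simp
  finally show ?thesis .
qed

text \<open>Raising the thresholds to at least \<open>sqrt (ln u)\<close> preserves divergence: if the original
  ones are smaller at infinitely many \<open>u\<close>, then by monotonicity the raised ones are at most about
  \<open>sqrt (ln u)\<close> on the whole initial segment up to such a \<open>u\<close>.\<close>

lemma not_summable_raised:
  fixes b :: "nat \<Rightarrow> real"
  assumes mono: "\<And>u u'. u0 \<le> u \<Longrightarrow> u \<le> u' \<Longrightarrow> b u \<le> b u'" and u0: "2 \<le> u0"
    and div: "\<not> summable (\<lambda>u. gtail (b u))"
  shows "\<not> summable (\<lambda>u. gtail (max (b u) (sqrt (real (log_ceil u)))))"
proof
  let ?a = "\<lambda>u. max (b u) (sqrt (real (log_ceil u)))"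
  assume sm: "summable (\<lambda>u. gtail (?a u))"
  show False
  proof (cases "\<exists>u1. \<forall>u\<ge>u1. b u \<ge> sqrt (real (log_ceil u))")
    case True
    then obtain u1 where u1: "\<And>u. u \<ge> u1 \<Longrightarrow> b u \<ge> sqrt (real (log_ceil u))" by blast
    have "?a (u + u1) = b (u + u1)" for u using u1[of "u + u1"] by simp
    then have "summable (\<lambda>u. gtail (b (u + u1)))"
      using summable_ignore_initial_segment[OF sm, of u1] by simp
    then show False using div by (subst (asm) summable_iff_shift) simp
  next
    case False
    define T where "T = (\<Sum>u. gtail (?a (u + u0)))"
    have a1: "?a u \<ge> 1" if "u \<ge> u0" for u
    proof -
      have "1 \<le> real (log_ceil u)" using log_ceil_bounds(3)[of u] u0 that by simp
      then show ?thesis by (simp add: le_max_iff_disj)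
    qed
    obtain k :: nat where k: "16 * T\<^sup>2 < real k" using reals_Archimedean2 by blast
    obtain u where u: "u \<ge> max (2 * u0) k" "b u < sqrt (real (log_ceil u))"
      using False by (meson not_le)
    let ?l = "sqrt (real (log_ceil u))"
    have "1 \<le> log_ceil u" using log_ceil_bounds(3)[of u] u u0 by simp
    then have l1: "1 \<le> ?l" by simp
    have upos: "real u > 0" using u u0 by simp
    \<comment> \<open>Rounding \<open>ln u\<close> up costs at most the factor
      \<open>exp (1/2) \<le> 2\<close>. Since at least \<open>u / 2\<close> terms are that large,
      the partial sum is at least \<open>sqrt u / 4\<close>, for arbitrarily large
      \<open>u\<close>.\<close>
    have "1 / (2 * sqrt (real u)) \<le> gtail ?l"
    proof -
      have "real (log_ceil u) / 2 \<le> 1/2 + ln (sqrt (real u))"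
        using log_ceil_bounds(2)[of u] u u0 by (simp add: ln_sqrt)
      then have "exp (real (log_ceil u) / 2) \<le> exp (1/2) * exp (ln (sqrt (real u)))"
        unfolding exp_add[symmetric] by (rule iffD2[OF exp_le_cancel_iff])
      also have "\<dots> \<le> 2 * sqrt (real u)"
        using exp_bound_half[of "1/2::real"] upos by (simp add: mult_right_mono)
      finally have "1 / (2 * sqrt (real u)) \<le> 1 / exp (real (log_ceil u) / 2)"
        by (intro frac_le) auto
      also have "\<dots> = 1 * exp (- (?l)\<^sup>2 / 2)" by (simp add: exp_minus field_simps)
      also have "\<dots> \<le> gtail ?l" unfolding gtail_def using l1 by (intro mult_right_mono) auto
      finally show ?thesis .
    qed
    also have "gtail ?l \<le> gtail (?a (i + u0))" if "i < u - u0" for i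
    proof (rule gtail_antimono)
      show "1 \<le> ?a (i + u0)" by (rule a1) simp
      have "b (i + u0) \<le> b u" using that by (intro mono) auto
      moreover have "log_ceil (i + u0) \<le> log_ceil u" using that u0 by (intro log_ceil_mono) auto
      ultimately show "?a (i + u0) \<le> ?l" using u(2) by simp
    qed
    finally have *: "1 / (2 * sqrt (real u)) \<le> gtail (?a (i + u0))" if "i < u - u0" for i
      using that .
    have "sqrt (real u) / 4 = real u / 2 * (1 / (2 * sqrt (real u)))"
      using upos by (simp add: field_simps)
    also have "\<dots> \<le> real (u - u0) * (1 / (2 * sqrt (real u)))"
      using u by (intro mult_right_mono) auto
    also have "\<dots> = (\<Sum>i<u - u0. 1 / (2 * sqrt (real u)))" by simp
    also have "\<dots> \<le> (\<Sum>i<u - u0. gtail (?a (i + u0)))" using * by (intro sum_mono) auto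
    also have "\<dots> \<le> T" unfolding T_def
      using summable_ignore_initial_segment[OF sm, of u0]
      by (rule sum_le_suminf) (use a1 in \<open>auto intro!: less_imp_le[OF gtail_pos] intro: less_le_trans[OF zero_less_one]\<close>)
    finally have "sqrt (real u) \<le> 4 * T" by simp
    then have "(sqrt (real u))\<^sup>2 \<le> (4 * T)\<^sup>2" by (intro power_mono) auto
    then show False using k u by (simp add: power_mult_distrib)
  qed
qed

theorem not_upper_class_if_not_summable:
  fixes \<psi> :: "real \<Rightarrow> real"
  assumes K: "K > 0" and mono: "mono_on {M<..} \<psi>"
    and div: "\<not> summable (\<lambda>u. gtail (\<psi> (4^u)))"
  shows "\<not> upper_class K \<psi>"
proof
  assume "upper_class K \<psi>"
  then obtain \<sigma> where nonneg: "\<And>x n. x \<in> paths \<Longrightarrow> capital K \<sigma> x n \<ge> 0"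
    and force: "\<And>x. x \<in> paths \<Longrightarrow> filterlim (A x) at_top sequentially \<Longrightarrow>
      \<not> (\<forall>\<^sub>F n in sequentially. S x n - A x n * \<psi> ((A x n)\<^sup>2) \<le> 0) \<Longrightarrow>
      filterlim (capital K \<sigma> x) at_top sequentially"
    unfolding upper_class_def can_force_def by blast
  obtain n0 :: nat where n0: "M < 4^n0" using real_arch_pow[of 4 M] by auto
  define u0 where "u0 = max n0 8"
  have Mlt: "M < 4^u" if "u \<ge> u0" for u
    using that n0 power_increasing[of n0 u "4::real"] unfolding u0_def by linarith
  \<comment> \<open>In block \<open>u\<close> the value \<open>A^2 = 2 * half_time u v\<close>
    ranges up to \<open>4^Suc u\<close>, so \<psi> is taken at this right end.\<close>
  define b where "b u = \<psi> (4^Suc u)" for u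
  have b_mono: "b u \<le> b u'" if "u0 \<le> u" "u \<le> u'" for u u'
  proof -
    have "(4::real)^Suc u \<le> 4^Suc u'" using that by (intro power_increasing) auto
    then show ?thesis
      unfolding b_def using Mlt[of "Suc u"] Mlt[of "Suc u'"] that by (intro mono_onD[OF mono]) auto
  qed
  define a where "a u = max (b u) (sqrt (real (log_ceil u)))" for u
  \<comment> \<open>Blocks with a larger threshold are dropped: there
    \<open>gtail (a u) \<le> 2 * u powr (-3/2)\<close>, so the divergence remains on
    \<open>U\<close>.\<close>
  define U where "U = {u. u \<ge> u0 \<and> (a u)\<^sup>2 \<le> 4 * real (log_ceil u)}"
  have U8: "u \<ge> 8" "u \<ge> u0" if "u \<in> U" for u using that by (auto simp: U_def u0_def)
  have lc: "1 \<le> log_ceil u" if "u \<ge> u0" for u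
    using log_ceil_bounds(3)[of u] that by (simp add: u0_def)
  have a_sqrt: "sqrt (real (log_ceil u)) \<le> a u" for u by (simp add: a_def)
  have a1: "1 \<le> a u" if "u \<ge> u0" for u
  proof -
    have "1 \<le> sqrt (real (log_ceil u))" using lc[OF that] by simp
    then show ?thesis using a_sqrt[of u] by linarith
  qed
  interpret coin_blocks log_ceil a U
  proof
    show "1 \<le> log_ceil u" if "u \<in> U" for u using lc U8[OF that] by simp
    show "128 * (real (log_ceil u))\<^sup>2 \<le> 4^u" if "u \<in> U" for u using U8[OF that] by (intro log_ceil_small)
    show "1 \<le> a u" if "u \<in> U" for u using a1 U8[OF that] by simp
    show "real (log_ceil u) \<le> (a u)\<^sup>2" if "u \<in> U" for u
      using power_mono[OF a_sqrt[of u], of 2] by simp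
    show "(a u)\<^sup>2 \<le> 4 * real (log_ceil u)" if "u \<in> U" for u using that by (simp add: U_def)
    show "a u \<le> a u'" if "u \<in> U" "u' \<in> U" "u \<le> u'" for u u'
      unfolding a_def using that U8[OF that(1)] b_mono log_ceil_mono[of u u']
      by (intro max.mono) auto
    show "log_ceil u' \<le> 2 * log_ceil u" if "u \<in> U" "u' \<in> U" "u < u'" "u' < u + log_ceil u'" for u u'
      using that U8[OF that(1)] by (intro log_ceil_growth) auto
  qed
  have "\<not> summable (\<lambda>u. gtail (b u))"
  proof -
    have "\<not> summable (\<lambda>u. gtail (\<psi> (4^(u + 1))))" using div by (subst summable_iff_shift)
    then show ?thesis by (simp add: b_def)
  qed
  then have "\<not> summable (\<lambda>u. gtail (a u))"
    unfolding a_def by (intro not_summable_raised[of u0] b_mono) (auto simp: u0_def)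
  moreover have "summable (\<lambda>u. gtail (a u))" if sm: "summable (\<lambda>u. if u \<in> U then gtail (a u) else 0)"
  proof (rule summable_comparison_test')
    show "summable (\<lambda>u. (if u \<in> U then gtail (a u) else 0) + 2 * real u powr (-3/2))"
      using sm by (intro summable_add summable_mult) (auto simp: summable_real_powr_iff)
    fix u assume u: "u0 \<le> u"
    have g0: "gtail (a u) > 0" using a1[OF u] by (intro gtail_pos) auto
    show "norm (gtail (a u)) \<le> (if u \<in> U then gtail (a u) else 0) + 2 * real u powr (-3/2)"
    proof (cases "u \<in> U")
      case True
      then show ?thesis using g0 by simp
    next
      case False
      have u2: "u \<ge> 2" using u by (simp add: u0_def)
      have "4 * ln (real u) \<le> (a u)\<^sup>2" using False u log_ceil_bounds(1)[OF u2] by (simp add: U_def)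
      then have "- (3/8) * (a u)\<^sup>2 \<le> -3/2 * ln (real u)" by simp
      then have "exp (- (3/8) * (a u)\<^sup>2) \<le> exp (-3/2 * ln (real u))" by (rule iffD2[OF exp_le_cancel_iff])
      also have "\<dots> = real u powr (-3/2)" using u2 by (simp add: powr_def)
      finally show ?thesis using gtail_le[of "a u"] g0 False by simp
    qed
  qed
  ultimately have div': "\<not> summable (\<lambda>u. if u \<in> U then gtail (a u) else 0)" by blast
  have cap: "capital 1 (\<lambda>l. \<sigma> l / K) x n = capital K \<sigma> x n / K" for x n
    using capital_scale[of "1 / K" K \<sigma> x n] K by simp
  have nonneg1: "capital 1 (\<lambda>l. \<sigma> l / K) x n \<ge> 0" if "x \<in> paths" for x n
    unfolding cap using nonneg[OF that] K by simp
  from ex_bounded_capital_path[OF div' nonneg1]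
  obtain \<omega> C where bd: "\<And>i. capital 1 (\<lambda>l. \<sigma> l / K) (coin_path \<omega>) i < C"
    and hits: "\<And>r. \<exists>u v. u \<in> U \<and> r \<le> u \<and> v < log_ceil u \<and> \<omega> \<in> block_hit (u, v)" by blast
  let ?x = "coin_path \<omega>"
  have "filterlim (capital K \<sigma> ?x) at_top sequentially"
  proof (rule force)
    show "?x \<in> paths" by (rule coin_path_in_paths)
    show "filterlim (A ?x) at_top sequentially"
      unfolding A_coin_path[abs_def]
      by (rule filterlim_compose[OF sqrt_at_top filterlim_real_sequentially])
    show "\<not> (\<forall>\<^sub>F n in sequentially. S ?x n - A ?x n * \<psi> ((A ?x n)\<^sup>2) \<le> 0)"
    proof
      assume "\<forall>\<^sub>F n in sequentially. S ?x n - A ?x n * \<psi> ((A ?x n)\<^sup>2) \<le> 0"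
      then obtain N where N: "\<And>n. n \<ge> N \<Longrightarrow> S ?x n \<le> A ?x n * \<psi> ((A ?x n)\<^sup>2)"
        by (auto simp: eventually_sequentially)
      obtain u v where uv: "u \<in> U" "N \<le> u" "v < log_ceil u" "\<omega> \<in> block_hit (u, v)"
        using hits by blast
      define m where "m = half_time u v"
      have m: "4^u \<le> m" "4^u \<le> real m" "real m \<le> 2 * 4^u"
        unfolding m_def using half_time_bounds[OF uv(1,3)] by auto
      \<comment> \<open>Hit times exceed the block number, so hits in arbitrarily late blocks are
        violations at arbitrarily late rounds.\<close>
      have "u < 4^u" by (rule less_exp[THEN less_le_trans]) (simp add: power_mono)
      then have "N \<le> 2 * m" using m uv by linarith
      have AA: "(A ?x (2*m))\<^sup>2 = 2 * real m" by (simp add: A_coin_path)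
      have "\<psi> (2 * real m) \<le> \<psi> (4^Suc u)"
      proof (rule mono_onD[OF mono])
        have "M < 4^u" using U8[OF uv(1)] by (intro Mlt)
        also have "(4::real)^u \<le> real m" by (rule m(2))
        also have "\<dots> \<le> 2 * real m" by simp
        finally have "M < 2 * real m" .
        then show "2 * real m \<in> {M<..}" by simp
        show "4^Suc u \<in> {M<..}" using Mlt[of "Suc u"] U8[OF uv(1)] by simp
        show "2 * real m \<le> 4^Suc u" using m by simp
      qed
      also have "\<dots> \<le> a u" by (simp add: a_def b_def)
      finally have "A ?x (2*m) * \<psi> ((A ?x (2*m))\<^sup>2) \<le> A ?x (2*m) * a u"
        unfolding AA by (intro mult_left_mono A_nonneg)
      also have "\<dots> < S ?x (2*m)"
        using S_gt_if_hit[of \<omega> m "a u"] uv(4) by (simp add: block_hit_def m_def)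
      finally show False using N[OF \<open>N \<le> 2 * m\<close>] by linarith
    qed
  qed
  then have "\<forall>\<^sub>F n in sequentially. C * K \<le> capital K \<sigma> ?x n" by (simp add: filterlim_at_top)
  then obtain n where "C * K \<le> capital K \<sigma> ?x n" by (auto simp: eventually_sequentially)
  then have "C \<le> capital 1 (\<lambda>l. \<sigma> l / K) ?x n" unfolding cap using K by (simp add: field_simps)
  then show False using bd[of n] by linarith
qed

theorem corollary5p5:
  fixes K0 M :: real and \<psi> :: "real \<Rightarrow> real"
  assumes "K0 > 0"
    and "M > 0"
    and "\<And>l. l > M \<Longrightarrow> \<psi> l > 0"
    and "mono_on {M<..} \<psi>"
  shows "upper_class K0 \<psi> \<longleftrightarrow>
    (\<integral>\<^sup>+l\<in>{M<..}. ennreal (\<psi> l * exp (- (\<psi> l)\<^sup>2 / 2) / l) \<partial>lborel) < \<infinity>"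
  using integral_finite_iff_summable[OF assms(2-4)]
    upper_class_if_summable[OF assms(1,3,4)] not_upper_class_if_not_summable[OF assms(1,4)]
  unfolding gtail_def by blast

end
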